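(* Let $T\in(0,\infty)$, $\alpha>0$, $\nu:=\alpha-1/2$, let $0<z^{(\nu)}_1<z^{(\nu)}_2<\cdots$ be the positive zeros of the Bessel function $J_\nu$ of the first kind, and let $(X^{(\alpha)}_t)_{t\in[0,T]}$ be the $\alpha$-Wiener bridge on $[0,T]$. Then, as $x\to\infty$, $$\mathsf{P}\left(\int_0^T(X^{(\alpha)}_t)^2\,dt>x\right)=(1+o(1))\,\frac{2^{1-\nu/2}\,T\,\big(z_1^{(\nu)}\big)^{(\nu-3)/2}}{\sqrt{\pi\,\Gamma(\nu+1)\,J_{\nu+1}\big(z_1^{(\nu)}\big)}}\;x^{-1/2}\,e^{-(z_1^{(\nu)})^2x/(2T^2)}$$ $$=(1+o(1))\,\sqrt{\frac{2}{\pi}}\,\frac{T}{z_1^{(\nu)}}\prod_{k=2}^\infty\left(1-\frac{(z_1^{(\nu)})^2}{(z_k^{(\nu)})^2}\right)^{-1/2}x^{-1/2}\,e^{-(z_1^{(\nu)})^2x/(2T^2)}.$$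
   Context: Let $(B_t)_{t\ge 0}$ be a standard Wiener process. For $\alpha>0$ and $T\in(0,\infty)$ the $\alpha$-Wiener bridge on $[0,T]$ is the process $X_t^{(\alpha)}=\int_0^t\big(\frac{T-t}{T-s}\big)^\alpha\,dB_s$, $t\in[0,T)$, i.e. the unique strong solution of $dX_t^{(\alpha)}=-\frac{\alpha}{T-t}X_t^{(\alpha)}\,dt+dB_t$, $X_0^{(\alpha)}=0$, extended by $X_T^{(\alpha)}=0$ (the extension is almost surely continuous on $[0,T]$). The Bessel function of the first kind of order $\nu>-1$ is $J_\nu(x)=\sum_{k=0}^\infty\frac{(-1)^k}{k!\,\Gamma(k+\nu+1)}\big(\frac{x}{2}\big)^{2k+\nu}$, $x>0$; it has infinitely many positive zeros, all simple, listed increasingly as $z^{(\nu)}_k$, $k\in\mathbb{N}=\{1,2,\dots\}$. *)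

theory Defs
  imports "HOL-Probability.Probability" "HOL-Library.Landau_Symbols"
begin

definition wiener_process :: "'a measure \<Rightarrow> (real \<Rightarrow> 'a \<Rightarrow> real) \<Rightarrow> bool" where
  "wiener_process M B \<longleftrightarrow>
     prob_space M \<and>
     (\<forall>t\<ge>0. B t \<in> borel_measurable M) \<and>
     (AE \<omega> in M. B 0 \<omega> = 0) \<and>
     (\<forall>(n::nat) t. 0 \<le> t 0 \<and> (\<forall>i<n. t i \<le> t (Suc i)) \<longrightarrow>
        prob_space.indep_vars M (\<lambda>_. borel) (\<lambda>i \<omega>. B (t (Suc i)) \<omega> - B (t i) \<omega>) {..<n}) \<and>
     (\<forall>s t. 0 \<le> s \<and> s < t \<longrightarrow>
        distributed M lborel (\<lambda>\<omega>. B t \<omega> - B s \<omega>) (normal_density 0 (sqrt (t - s)))) \<and>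
     (AE \<omega> in M. continuous_on {0..} (\<lambda>t. B t \<omega>))"

definition step_function :: "nat \<Rightarrow> (nat \<Rightarrow> real) \<Rightarrow> (nat \<Rightarrow> real) \<Rightarrow> real \<Rightarrow> real" where
  "step_function n p c s = (\<Sum>i<n. c i * indicator {p i<..p (Suc i)} s)"

definition step_integral ::
    "(real \<Rightarrow> 'a \<Rightarrow> real) \<Rightarrow> nat \<Rightarrow> (nat \<Rightarrow> real) \<Rightarrow> (nat \<Rightarrow> real) \<Rightarrow> 'a \<Rightarrow> real" where
  "step_integral B n p c \<omega> = (\<Sum>i<n. c i * (B (p (Suc i)) \<omega> - B (p i) \<omega>))"

text \<open>
  \<open>Y\<close> is (a version of) the stochastic integral \<open>\<integral>\<^sub>0\<^sup>u f(s) dB\<^sub>s\<close> of the deterministic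
  square-integrable function \<open>f\<close>: an \<open>L\<^sup>2(M)\<close>-limit of the integrals of deterministic
  step functions which approximate \<open>f\<close> in \<open>L\<^sup>2([0,u])\<close>.  By the isometry property
  the limit does not depend on the approximating sequence, up to almost sure equality.
\<close>

definition is_wiener_integral ::
    "'a measure \<Rightarrow> (real \<Rightarrow> 'a \<Rightarrow> real) \<Rightarrow> real \<Rightarrow> (real \<Rightarrow> real) \<Rightarrow> ('a \<Rightarrow> real) \<Rightarrow> bool" where
  "is_wiener_integral M B u f Y \<longleftrightarrow>
     set_borel_measurable lborel {0..u} f \<and> Y \<in> borel_measurable M \<and>
     (\<exists>(n :: nat \<Rightarrow> nat) (p :: nat \<Rightarrow> nat \<Rightarrow> real) (c :: nat \<Rightarrow> nat \<Rightarrow> real).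
        (\<forall>m. 0 \<le> p m 0 \<and> (\<forall>i<n m. p m i \<le> p m (Suc i)) \<and> p m (n m) \<le> u) \<and>
        ((\<lambda>m. \<integral>\<^sup>+s\<in>{0..u}. ennreal ((f s - step_function (n m) (p m) (c m) s)\<^sup>2) \<partial>lborel)
           \<longlonglongrightarrow> 0) \<and>
        ((\<lambda>m. \<integral>\<^sup>+\<omega>. ennreal ((Y \<omega> - step_integral B (n m) (p m) (c m) \<omega>)\<^sup>2) \<partial>M)
           \<longlonglongrightarrow> 0))"

text \<open>
  The stochastic integrals determine each \<open>X t\<close> only almost surely; the continuity clause selects
  the version with almost surely continuous paths on \<open>[0,T)\<close> (the solution of the SDE).
  Continuity at \<open>T\<close> is a consequence and hence not required.
\<close>

definition wiener_bridge ::
    "'a measure \<Rightarrow> (real \<Rightarrow> 'a \<Rightarrow> real) \<Rightarrow> real \<Rightarrow> real \<Rightarrow> (real \<Rightarrow> 'a \<Rightarrow> real) \<Rightarrow> bool" where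
  "wiener_bridge M B \<alpha> T X \<longleftrightarrow>
     (\<forall>t\<in>{0..<T}. is_wiener_integral M B t (\<lambda>s. ((T - t) / (T - s)) powr \<alpha>) (X t)) \<and>
     (AE \<omega> in M. continuous_on {0..<T} (\<lambda>t. X t \<omega>)) \<and>
     (\<forall>\<omega>\<in>space M. X T \<omega> = 0)"

text \<open>The Bessel function of the first kind, for order \<open>\<nu> > -1\<close> and argument \<open>x > 0\<close>.\<close>

definition bessel_J :: "real \<Rightarrow> real \<Rightarrow> real" where
  "bessel_J \<nu> x =
     (\<Sum>k. (-1) ^ k / (fact k * Gamma (real k + \<nu> + 1)) * (x / 2) powr (2 * real k + \<nu>))"

text \<open>
  The probability that the squared \<open>L\<^sup>2\<close> norm of the path exceeds \<open>x\<close>.  Paths are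
  well-behaved only outside a null set, on which the path integral need not be measurable
  in \<open>\<omega>\<close>, so the probability is taken in the completion of \<open>M\<close>; it agrees with the
  probability under \<open>M\<close> whenever the event belongs to \<open>sets M\<close>.
\<close>

definition tail_prob :: "'a measure \<Rightarrow> real \<Rightarrow> (real \<Rightarrow> 'a \<Rightarrow> real) \<Rightarrow> real \<Rightarrow> real" where
  "tail_prob M T X x =
     measure (completion M) {\<omega> \<in> space M. (LINT t:{0..T}|lborel. (X t \<omega>)\<^sup>2) > x}"

end

theory Submission
  imports Defs "HOL-Complex_Analysis.Complex_Analysis" "HOL-Real_Asymp.Real_Asymp"
begin

text \<open>
  With \<open>r = T - t\<close>, the functions \<open>r\<^sup>\<alpha> f(w r\<^sup>2)\<close>, where \<open>f\<close> is the entire function underlying \<open>J\<^sub>\<nu>\<close> and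
  \<open>w T\<^sup>2\<close> runs through its zeros, are orthogonal and are mapped by the adjoint of the bridge kernel to
  functions which are orthogonal again.  The coefficients of \<open>X\<close> in this system are therefore
  uncorrelated Gaussian variables with variances \<open>T\<^sup>2 / z\<^sub>k\<^sup>2\<close>.  Completeness comes for free: Hadamard's product
  for \<open>f\<close>, an entire function of order \<open>1/2\<close>, yields \<open>\<Sum> 1 / z\<^sub>k\<^sup>2 = 1 / (4 (\<nu> + 1))\<close>, so the variances add up to
  the expectation of \<open>\<integral> X\<^sup>2\<close> and Bessel's inequality must be an equality almost surely.  Hence
  \<open>\<integral> X\<^sup>2 = \<Sum> \<lambda>\<^sub>k \<eta>\<^sub>k\<^sup>2\<close> with standard normal \<open>\<eta>\<^sub>k\<close>.  By uniqueness of Laplace transforms the leading term may be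
  taken independent of the rest \<open>W\<close>, and conditioning on \<open>W\<close> gives the tail with the factor
  \<open>E exp (W / (2 \<lambda>\<^sub>1)) = \<Prod> (1 - \<lambda>\<^sub>k / \<lambda>\<^sub>1)\<^sup>-\<^sup>1\<^sup>/\<^sup>2\<close>.  Differentiating the product for \<open>f\<close> at its first zero expresses this factor
  by \<open>J\<^bsub>\<nu>+1\<^esub>\<close>.
\<close>

section \<open>Gaussian quadratic forms\<close>

text \<open>The definitions give each \<open>X t\<close> with t < T as an L2 limit and the paths as
  almost surely continuous on [0,T), so no path integral is a priori measurable in
  \<open>\<omega>\<close>. Every functional is therefore replaced by a measurable version: a limit
  of Riemann sums over [0,b] with b < T, then a limit over b, because near T nothing is known
  beforehand about the paths. For the second moment of the path only an upper bound is proved, which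
  Fatou's lemma supplies; the matching lower bound is the sum of the variances. No spectral theory
  of the covariance enters: Green's identity for the first-order pair (mode, comode) yields both
  orthogonality relations and the reality of the zeros. The condition \<alpha> > 0 reads \<nu> >
  -1/2; it makes the boundary terms vanish at r = 0 and bounds the Taylor coefficients by those of
  cosh (sqrt w).\<close>

lemma nn_integral_std_normal_exp_quadratic:
  fixes a b :: real
  assumes "a < 1"
  shows "(\<integral>\<^sup>+x. ennreal (exp (a * x\<^sup>2 / 2 + b * x)) \<partial>std_normal_distribution)
           = ennreal (1 / sqrt (1 - a) * exp (b\<^sup>2 / (2 * (1 - a))))"
proof -
  define \<sigma> where "\<sigma> = 1 / sqrt (1 - a)"
  define C where "C = \<sigma> * exp (b\<^sup>2 / (2 * (1 - a)))"
  have \<sigma>: "\<sigma> > 0" "\<sigma>\<^sup>2 = 1 / (1 - a)" using assms by (auto simp: \<sigma>_def power_divide)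
  have C: "C \<ge> 0" using \<sigma> by (simp add: C_def)
  \<comment> \<open>Completing the square: the exponential tilt of the standard normal density is a
    multiple of the normal density with mean b / (1 - a) and variance 1 / (1 - a).\<close>
  have eq: "std_normal_density x * exp (a * x\<^sup>2 / 2 + b * x)
              = C * normal_density (b / (1 - a)) \<sigma> x" for x
  proof -
    have 1: "- x\<^sup>2 / 2 + (a * x\<^sup>2 / 2 + b * x)
        = b\<^sup>2 / (2 * (1 - a)) + - (x - b / (1 - a))\<^sup>2 / (2 * \<sigma>\<^sup>2)"
      using assms unfolding \<sigma>(2) by (simp add: power2_eq_square divide_simps) (simp add: algebra_simps)
    have 2: "\<sigma> / sqrt (2 * pi * \<sigma>\<^sup>2) = 1 / sqrt (2 * pi)"
      using \<sigma>(1) by (simp add: real_sqrt_mult)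
    have "std_normal_density x * exp (a * x\<^sup>2 / 2 + b * x)
        = 1 / sqrt (2 * pi) * exp (- x\<^sup>2 / 2 + (a * x\<^sup>2 / 2 + b * x))"
      by (simp only: std_normal_density_def exp_add mult.assoc)
    also have "\<dots> = \<sigma> / sqrt (2 * pi * \<sigma>\<^sup>2) * (exp (b\<^sup>2 / (2 * (1 - a))) * exp (- (x - b / (1 - a))\<^sup>2 / (2 * \<sigma>\<^sup>2)))"
      by (simp only: 1 2 exp_add)
    finally show ?thesis
      by (simp add: normal_density_def C_def)
  qed
  have "(\<integral>\<^sup>+x. ennreal (exp (a * x\<^sup>2 / 2 + b * x)) \<partial>std_normal_distribution)
      = (\<integral>\<^sup>+x. ennreal C * ennreal (normal_density (b / (1 - a)) \<sigma> x) \<partial>lborel)"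
    by (subst nn_integral_density) (auto simp: ennreal_mult'[symmetric] eq C)
  also have "\<dots> = ennreal C * (\<integral>\<^sup>+x. ennreal (normal_density (b / (1 - a)) \<sigma> x) \<partial>lborel)"
    by (rule nn_integral_cmult) auto
  also have "(\<integral>\<^sup>+x. ennreal (normal_density (b / (1 - a)) \<sigma> x) \<partial>lborel) = 1"
    using \<sigma> by (subst nn_integral_eq_integral) auto
  finally show ?thesis by (simp add: C_def \<sigma>_def)
qed

lemma integral_std_normal_exp_quadratic:
  fixes a :: real
  assumes "0 \<le> c"
  shows "(\<integral>x. exp (- (c * x\<^sup>2 / 2)) \<partial>std_normal_distribution) = 1 / sqrt (1 + c)"
  using nn_integral_std_normal_exp_quadratic[of "-c" 0] assms
  by (intro integral_eq_nn_integral[THEN trans]) auto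

lemma integral_std_normal_iexp:
  "(CLINT g|std_normal_distribution. iexp (g * x)) = of_real (exp (- (x\<^sup>2 / 2)))"
  using fun_cong[OF char_std_normal_distribution, of x]
  by (simp add: char_def mult.commute)

text \<open>The joint characteristic function characterises independent standard normal variables.\<close>

definition std_gaussian_family :: "'a measure \<Rightarrow> ('i \<Rightarrow> 'a \<Rightarrow> real) \<Rightarrow> 'i set \<Rightarrow> bool" where
  "std_gaussian_family M \<eta> I \<longleftrightarrow>
     (\<forall>k\<in>I. \<eta> k \<in> borel_measurable M) \<and>
     (\<forall>a. (CLINT \<omega>|M. iexp (\<Sum>k\<in>I. a k * \<eta> k \<omega>)) = of_real (exp (- ((\<Sum>k\<in>I. (a k)\<^sup>2) / 2))))"

lemma std_gaussian_familyD:
  assumes "std_gaussian_family M \<eta> I"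
  shows "k \<in> I \<Longrightarrow> \<eta> k \<in> borel_measurable M"
    and "(CLINT \<omega>|M. iexp (\<Sum>k\<in>I. a k * \<eta> k \<omega>)) = of_real (exp (- ((\<Sum>k\<in>I. (a k)\<^sup>2) / 2)))"
  using assms unfolding std_gaussian_family_def by blast+

text \<open>Weights that vanish outside \<open>J\<close> turn a linear form over \<open>I\<close>
  into one over \<open>J\<close>.\<close>

lemma std_gaussian_family_subset:
  assumes "std_gaussian_family M \<eta> I" "J \<subseteq> I" "finite I"
  shows "std_gaussian_family M \<eta> J"
proof -
  have "(CLINT \<omega>|M. iexp (\<Sum>k\<in>J. a k * \<eta> k \<omega>)) = of_real (exp (- ((\<Sum>k\<in>J. (a k)\<^sup>2) / 2)))" for a
  proof -
    define a' where "a' k = (if k \<in> J then a k else 0)" for k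
    have "(\<Sum>k\<in>I. a' k * \<eta> k \<omega>) = (\<Sum>k\<in>J. a k * \<eta> k \<omega>)" for \<omega>
      using assms by (intro sum.mono_neutral_cong_right) (auto simp: a'_def)
    moreover have "(\<Sum>k\<in>I. (a' k)\<^sup>2) = (\<Sum>k\<in>J. (a k)\<^sup>2)"
      using assms by (intro sum.mono_neutral_cong_right) (auto simp: a'_def)
    moreover have "(CLINT \<omega>|M. iexp (\<Sum>k\<in>I. a' k * \<eta> k \<omega>)) = of_real (exp (- ((\<Sum>k\<in>I. (a' k)\<^sup>2) / 2)))"
      using assms(1) unfolding std_gaussian_family_def by blast
    ultimately show ?thesis by (simp only:)
  qed
  then show ?thesis using assms unfolding std_gaussian_family_def by auto
qed

text \<open>The Gaussian quadratic form is linearised by averaging over independent normal weights.\<close>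

lemma (in prob_space) expectation_exp_neg_squares:
  fixes \<eta> :: "'i \<Rightarrow> 'a \<Rightarrow> real"
  assumes gf: "std_gaussian_family M \<eta> I" and I: "finite I" and c: "\<And>k. k \<in> I \<Longrightarrow> 0 \<le> c k"
  shows "(\<integral>\<omega>. exp (- ((\<Sum>k\<in>I. c k * (\<eta> k \<omega>)\<^sup>2) / 2)) \<partial>M) = (\<Prod>k\<in>I. 1 / sqrt (1 + c k))"
proof -
  let ?N = "std_normal_distribution"
  let ?P = "Pi\<^sub>M I (\<lambda>_. ?N)"
  interpret N: real_distribution ?N by (rule real_dist_normal_dist)
  interpret PP: finite_product_prob_space "\<lambda>_. ?N" I
    by unfold_locales (use I in auto)
  interpret P: pair_prob_space M ?P ..
  have [measurable]: "\<And>k. k \<in> I \<Longrightarrow> \<eta> k \<in> borel_measurable M"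
    using gf by (auto simp: std_gaussian_family_def)
  have meas[measurable]: "(\<lambda>x. \<Sum>k\<in>I. sqrt (c k) * snd x k * \<eta> k (fst x)) \<in> borel_measurable (M \<Otimes>\<^sub>M ?P)"
    by measurable
  have int: "integrable (M \<Otimes>\<^sub>M ?P) (\<lambda>x. iexp (\<Sum>k\<in>I. sqrt (c k) * snd x k * \<eta> k (fst x)))"
    by (intro P.integrable_iexp) (auto intro!: borel_measurable_of_real meas)
  \<comment> \<open>The double average is evaluated in both orders. Averaging over the weights g
    first produces exp of minus half the quadratic form; averaging over \<open>\<omega>\<close>
    first produces a product of one-dimensional Gaussian integrals in g.\<close>
  have "(CLINT \<omega>|M. (CLINT g|?P. iexp (\<Sum>k\<in>I. sqrt (c k) * g k * \<eta> k \<omega>)))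
      = (CLINT g|?P. (CLINT \<omega>|M. iexp (\<Sum>k\<in>I. sqrt (c k) * g k * \<eta> k \<omega>)))"
    using P.Fubini_integral[of "\<lambda>\<omega> g. iexp (\<Sum>k\<in>I. sqrt (c k) * g k * \<eta> k \<omega>)"] int
    by (simp add: case_prod_beta')
  moreover have "(CLINT g|?P. iexp (\<Sum>k\<in>I. sqrt (c k) * g k * \<eta> k \<omega>))
      = of_real (exp (- ((\<Sum>k\<in>I. c k * (\<eta> k \<omega>)\<^sup>2) / 2)))" for \<omega>
  proof -
    have "(CLINT g|?P. iexp (\<Sum>k\<in>I. sqrt (c k) * g k * \<eta> k \<omega>))
        = (CLINT g|?P. (\<Prod>k\<in>I. iexp (g k * (sqrt (c k) * \<eta> k \<omega>))))"
      using I by (simp add: exp_sum[symmetric] sum_distrib_left mult_ac)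
    also have "\<dots> = (\<Prod>k\<in>I. CLINT g|?N. iexp (g * (sqrt (c k) * \<eta> k \<omega>)))"
      by (rule PP.product_integral_prod) (use I in \<open>auto intro!: N.integrable_iexp\<close>)
    also have "\<dots> = (\<Prod>k\<in>I. of_real (exp (- ((sqrt (c k) * \<eta> k \<omega>)\<^sup>2 / 2))))"
      by (simp only: integral_std_normal_iexp)
    also have "\<dots> = of_real (exp (\<Sum>k\<in>I. - ((sqrt (c k) * \<eta> k \<omega>)\<^sup>2 / 2)))"
      using I by (simp add: exp_sum)
    also have "(\<Sum>k\<in>I. - ((sqrt (c k) * \<eta> k \<omega>)\<^sup>2 / 2)) = - ((\<Sum>k\<in>I. c k * (\<eta> k \<omega>)\<^sup>2) / 2)"
      using c by (simp add: sum_negf sum_divide_distrib power_mult_distrib)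
    finally show ?thesis .
  qed
  moreover have "(CLINT g|?P. (CLINT \<omega>|M. iexp (\<Sum>k\<in>I. sqrt (c k) * g k * \<eta> k \<omega>)))
      = of_real (\<Prod>k\<in>I. 1 / sqrt (1 + c k))"
  proof -
    have "(CLINT \<omega>|M. iexp (\<Sum>k\<in>I. sqrt (c k) * g k * \<eta> k \<omega>))
        = of_real (\<Prod>k\<in>I. exp (- (c k * (g k)\<^sup>2 / 2)))" for g
    proof -
      have "(CLINT \<omega>|M. iexp (\<Sum>k\<in>I. sqrt (c k) * g k * \<eta> k \<omega>))
          = of_real (exp (- ((\<Sum>k\<in>I. (sqrt (c k) * g k)\<^sup>2) / 2)))"
        by (rule std_gaussian_familyD(2)[OF gf, where a="\<lambda>k. sqrt (c k) * g k"])
      also have "- ((\<Sum>k\<in>I. (sqrt (c k) * g k)\<^sup>2) / 2) = (\<Sum>k\<in>I. - (c k * (g k)\<^sup>2 / 2))"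
        using c by (simp add: sum_negf sum_divide_distrib power_mult_distrib)
      finally show ?thesis using I by (simp add: exp_sum)
    qed
    moreover have "(LINT g|?P. (\<Prod>k\<in>I. exp (- (c k * (g k)\<^sup>2 / 2)))) = (\<Prod>k\<in>I. 1 / sqrt (1 + c k))"
      using c I
      by (subst PP.product_integral_prod)
         (auto intro!: N.integrable_const_bound[where B=1] prod.cong simp: integral_std_normal_exp_quadratic)
    ultimately show ?thesis by (simp del: of_real_prod)
  qed
  ultimately have "(CLINT \<omega>|M. of_real (exp (- ((\<Sum>k\<in>I. c k * (\<eta> k \<omega>)\<^sup>2) / 2))))
      = (of_real (\<Prod>k\<in>I. 1 / sqrt (1 + c k)) :: complex)"
    by (simp only:)
  then show ?thesis
    by (simp only: integral_complex_of_real of_real_eq_iff)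
qed

text \<open>Describing the law as an image of the standard normal law under scaling, rather than by
  a density, keeps the degenerate case v = 0.\<close>

lemma (in prob_space) distr_eq_scaled_normal:
  assumes [measurable]: "X \<in> borel_measurable M" and "0 \<le> v"
    and char: "\<And>u. (CLINT \<omega>|M. iexp (u * X \<omega>)) = of_real (exp (- (v * u\<^sup>2 / 2)))"
  shows "distr M borel X = distr std_normal_distribution borel (\<lambda>g. sqrt v * g)"
proof (rule Levy_uniqueness)
  interpret N: real_distribution std_normal_distribution by (rule real_dist_normal_dist)
  show "real_distribution (distr M borel X)" by (rule real_distribution_distr) simp
  show "real_distribution (distr std_normal_distribution borel (\<lambda>g. sqrt v * g))"
    by (rule N.real_distribution_distr) simp
  show "Characteristic_Functions.char (distr M borel X)
      = Characteristic_Functions.char (distr std_normal_distribution borel (\<lambda>g. sqrt v * g))"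
  proof
    fix u
    have "Characteristic_Functions.char (distr std_normal_distribution borel (\<lambda>g. sqrt v * g)) u
        = (CLINT g|std_normal_distribution. iexp (g * (u * sqrt v)))"
      unfolding char_def by (subst integral_distr) (auto simp: mult_ac)
    also have "\<dots> = of_real (exp (- (v * u\<^sup>2 / 2)))"
      unfolding integral_std_normal_iexp using \<open>0 \<le> v\<close> by (simp add: power_mult_distrib mult_ac)
    also have "\<dots> = Characteristic_Functions.char (distr M borel X) u"
      unfolding char_def by (subst integral_distr) (auto simp: char[symmetric])
    finally show "Characteristic_Functions.char (distr M borel X) u
        = Characteristic_Functions.char (distr std_normal_distribution borel (\<lambda>g. sqrt v * g)) u" ..
  qed
qed

lemma (in prob_space)
  assumes [measurable]: "X \<in> borel_measurable M" and "0 \<le> v"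
    and char: "\<And>u. (CLINT \<omega>|M. iexp (u * X \<omega>)) = of_real (exp (- (v * u\<^sup>2 / 2)))"
  shows nn_expectation_exp_gaussian: "(\<integral>\<^sup>+\<omega>. ennreal (exp (X \<omega>)) \<partial>M) = ennreal (exp (v / 2))"
    and nn_expectation_square_gaussian: "(\<integral>\<^sup>+\<omega>. ennreal ((X \<omega>)\<^sup>2) \<partial>M) = ennreal v"
proof -
  have eq: "(\<integral>\<^sup>+\<omega>. f (X \<omega>) \<partial>M) = (\<integral>\<^sup>+g. f (sqrt v * g) \<partial>std_normal_distribution)"
    if [measurable]: "f \<in> borel_measurable borel" for f :: "real \<Rightarrow> ennreal"
  proof -
    have "(\<integral>\<^sup>+\<omega>. f (X \<omega>) \<partial>M) = (\<integral>\<^sup>+x. f x \<partial>distr M borel X)"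
      by (simp add: nn_integral_distr)
    also have "\<dots> = (\<integral>\<^sup>+g. f (sqrt v * g) \<partial>std_normal_distribution)"
      unfolding distr_eq_scaled_normal[OF assms] by (simp add: nn_integral_distr)
    finally show ?thesis .
  qed
  show "(\<integral>\<^sup>+\<omega>. ennreal (exp (X \<omega>)) \<partial>M) = ennreal (exp (v / 2))"
    using nn_integral_std_normal_exp_quadratic[of 0 "sqrt v"] \<open>0 \<le> v\<close>
    by (subst eq[of "\<lambda>x. ennreal (exp x)"]) auto
  have "(\<integral>\<^sup>+g. ennreal (g\<^sup>2) \<partial>std_normal_distribution) = 1"
    using std_normal_distribution_even_moments[of 1]
    by (subst nn_integral_eq_integral) (auto simp: eval_nat_numeral)
  then show "(\<integral>\<^sup>+\<omega>. ennreal ((X \<omega>)\<^sup>2) \<partial>M) = ennreal v"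
    using \<open>0 \<le> v\<close>
    by (subst eq[of "\<lambda>x. ennreal (x\<^sup>2)"])
       (auto simp: power_mult_distrib ennreal_mult nn_integral_cmult)
qed

lemma std_gaussian_family_char_scaled:
  assumes "std_gaussian_family M \<eta> I"
  shows "(CLINT \<omega>|M. iexp (u * (\<Sum>k\<in>I. a k * \<eta> k \<omega>))) = of_real (exp (- ((\<Sum>k\<in>I. (a k)\<^sup>2) * u\<^sup>2 / 2)))"
proof -
  have "(CLINT \<omega>|M. iexp (\<Sum>k\<in>I. (u * a k) * \<eta> k \<omega>)) = of_real (exp (- ((\<Sum>k\<in>I. (u * a k)\<^sup>2) / 2)))"
    by (rule std_gaussian_familyD(2)[OF assms, where a="\<lambda>k. u * a k"])
  then show ?thesis by (simp add: sum_distrib_left sum_distrib_right mult_ac power_mult_distrib)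
qed

text \<open>The linearisation of \<open>expectation_exp_neg_squares\<close> with real instead of
  imaginary exponentials. Nonnegativity makes the exchange of integrals free; \<open>c k < 1\<close>
  keeps the Gaussian integral of exp (c k * g^2 / 2) finite.\<close>

lemma (in prob_space) nn_expectation_exp_squares:
  fixes \<eta> :: "'i \<Rightarrow> 'a \<Rightarrow> real"
  assumes gf: "std_gaussian_family M \<eta> I" and I: "finite I"
    and c: "\<And>k. k \<in> I \<Longrightarrow> 0 \<le> c k" "\<And>k. k \<in> I \<Longrightarrow> c k < 1"
  shows "(\<integral>\<^sup>+\<omega>. ennreal (exp ((\<Sum>k\<in>I. c k * (\<eta> k \<omega>)\<^sup>2) / 2)) \<partial>M) = ennreal (\<Prod>k\<in>I. 1 / sqrt (1 - c k))"
proof -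
  let ?N = "std_normal_distribution"
  let ?P = "Pi\<^sub>M I (\<lambda>_. ?N)"
  interpret N: real_distribution ?N by (rule real_dist_normal_dist)
  interpret PP: finite_product_prob_space "\<lambda>_. ?N" I
    by unfold_locales (use I in auto)
  interpret P: pair_prob_space M ?P ..
  have [measurable]: "\<And>k. k \<in> I \<Longrightarrow> \<eta> k \<in> borel_measurable M"
    using gf by (auto simp: std_gaussian_family_def)
  have meas[measurable]: "(\<lambda>x. \<Sum>k\<in>I. sqrt (c k) * snd x k * \<eta> k (fst x)) \<in> borel_measurable (M \<Otimes>\<^sub>M ?P)"
    by measurable
  have "(\<integral>\<^sup>+g. (\<integral>\<^sup>+\<omega>. ennreal (exp (\<Sum>k\<in>I. sqrt (c k) * g k * \<eta> k \<omega>)) \<partial>M) \<partial>?P)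
      = (\<integral>\<^sup>+\<omega>. (\<integral>\<^sup>+g. ennreal (exp (\<Sum>k\<in>I. sqrt (c k) * g k * \<eta> k \<omega>)) \<partial>?P) \<partial>M)"
    by (rule P.Fubini') (use meas in \<open>auto simp: case_prod_beta'\<close>)
  moreover have "(\<integral>\<^sup>+g. ennreal (exp (\<Sum>k\<in>I. sqrt (c k) * g k * \<eta> k \<omega>)) \<partial>?P)
      = ennreal (exp ((\<Sum>k\<in>I. c k * (\<eta> k \<omega>)\<^sup>2) / 2))" for \<omega>
  proof -
    have "(\<integral>\<^sup>+g. ennreal (exp (\<Sum>k\<in>I. sqrt (c k) * g k * \<eta> k \<omega>)) \<partial>?P)
        = (\<integral>\<^sup>+g. (\<Prod>k\<in>I. ennreal (exp (sqrt (c k) * \<eta> k \<omega> * g k))) \<partial>?P)"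
      using I by (simp add: exp_sum prod_ennreal mult_ac)
    also have "\<dots> = (\<Prod>k\<in>I. \<integral>\<^sup>+g. ennreal (exp (sqrt (c k) * \<eta> k \<omega> * g)) \<partial>?N)"
      by (rule PP.product_nn_integral_prod) (use I in auto)
    also have "\<dots> = (\<Prod>k\<in>I. ennreal (exp ((sqrt (c k) * \<eta> k \<omega>)\<^sup>2 / 2)))"
      using nn_integral_std_normal_exp_quadratic[of 0] by simp
    also have "\<dots> = ennreal (exp (\<Sum>k\<in>I. (sqrt (c k) * \<eta> k \<omega>)\<^sup>2 / 2))"
      using I by (simp add: exp_sum prod_ennreal)
    also have "(\<Sum>k\<in>I. (sqrt (c k) * \<eta> k \<omega>)\<^sup>2 / 2) = (\<Sum>k\<in>I. c k * (\<eta> k \<omega>)\<^sup>2) / 2"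
      using c by (simp add: sum_divide_distrib power_mult_distrib)
    finally show ?thesis .
  qed
  moreover have "(\<integral>\<^sup>+g. (\<integral>\<^sup>+\<omega>. ennreal (exp (\<Sum>k\<in>I. sqrt (c k) * g k * \<eta> k \<omega>)) \<partial>M) \<partial>?P)
      = ennreal (\<Prod>k\<in>I. 1 / sqrt (1 - c k))"
  proof -
    have "(\<integral>\<^sup>+\<omega>. ennreal (exp (\<Sum>k\<in>I. sqrt (c k) * g k * \<eta> k \<omega>)) \<partial>M)
        = (\<Prod>k\<in>I. ennreal (exp (c k * (g k)\<^sup>2 / 2)))" for g
    proof -
      have "(\<integral>\<^sup>+\<omega>. ennreal (exp (\<Sum>k\<in>I. sqrt (c k) * g k * \<eta> k \<omega>)) \<partial>M)
          = ennreal (exp ((\<Sum>k\<in>I. (sqrt (c k) * g k)\<^sup>2) / 2))"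
        by (rule nn_expectation_exp_gaussian)
           (auto intro!: sum_nonneg
             simp del: of_real_sum of_real_mult simp: std_gaussian_family_char_scaled[OF gf, where a="\<lambda>k. sqrt (c k) * g k"])
      also have "(\<Sum>k\<in>I. (sqrt (c k) * g k)\<^sup>2) / 2 = (\<Sum>k\<in>I. c k * (g k)\<^sup>2 / 2)"
        using c by (simp add: sum_divide_distrib power_mult_distrib)
      finally show ?thesis using I by (simp add: exp_sum prod_ennreal)
    qed
    then have "(\<integral>\<^sup>+g. (\<integral>\<^sup>+\<omega>. ennreal (exp (\<Sum>k\<in>I. sqrt (c k) * g k * \<eta> k \<omega>)) \<partial>M) \<partial>?P)
        = (\<integral>\<^sup>+g. (\<Prod>k\<in>I. ennreal (exp (c k * (g k)\<^sup>2 / 2))) \<partial>?P)"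
      by simp
    also have "\<dots> = (\<Prod>k\<in>I. \<integral>\<^sup>+g. ennreal (exp (c k * g\<^sup>2 / 2)) \<partial>?N)"
      by (rule PP.product_nn_integral_prod) (use I in auto)
    also have "\<dots> = (\<Prod>k\<in>I. ennreal (1 / sqrt (1 - c k)))"
      using nn_integral_std_normal_exp_quadratic[of _ 0] c by (intro prod.cong) auto
    finally show ?thesis using I c by (simp add: prod_ennreal less_imp_le)
  qed
  ultimately show ?thesis by simp
qed

section \<open>Uniqueness of Laplace transforms and tails of the normal law\<close>

text \<open>Boundedness by 1 allows the exponential series to be integrated term by term, so the
  characteristic function is a power series whose coefficients are the moments; Levy's uniqueness
  theorem concludes.\<close>

lemma distr_eq_of_bounded_moments:
  fixes U :: "'a \<Rightarrow> real" and V :: "'b \<Rightarrow> real"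
  assumes "prob_space M" "prob_space N"
    and [measurable]: "U \<in> borel_measurable M" "V \<in> borel_measurable N"
    and bU: "AE x in M. \<bar>U x\<bar> \<le> 1" and bV: "AE x in N. \<bar>V x\<bar> \<le> 1"
    and eq: "\<And>m. (\<integral>x. U x ^ m \<partial>M) = (\<integral>x. V x ^ m \<partial>N)"
  shows "distr M borel U = distr N borel V"
proof (rule Levy_uniqueness)
  have char: "(\<lambda>n. (\<i> * t) ^ n / fact n * of_real (\<integral>x. U x ^ n \<partial>M)) sums Characteristic_Functions.char (distr M borel U) t"
    if "prob_space M" "U \<in> borel_measurable M" "AE x in M. \<bar>U x\<bar> \<le> 1"
    for M :: "'c measure" and U :: "'c \<Rightarrow> real" and t
  proof -
    interpret prob_space M by fact
    note [measurable] = that(2)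
    let ?f = "\<lambda>n x. (\<i> * t * U x) ^ n /\<^sub>R fact n"
    have int: "integrable M (\<lambda>x. U x ^ n)" for n
      using that(3)
      by (intro integrable_const_bound[where B=1] eventually_mono[OF that(3)])
         (auto simp: power_abs intro!: power_le_one)
    have int_abs: "integrable M (\<lambda>x. \<bar>U x\<bar> ^ n)" for n
      using integrable_abs[OF int[of n]] by (simp add: power_abs)
    have eq: "?f n = (\<lambda>x. ((\<i> * t) ^ n / fact n) * of_real (U x ^ n))" for n
      by (auto simp: fun_eq_iff power_mult_distrib scaleR_conv_of_real divide_inverse)
    have f: "integrable M (?f n)" for n
      unfolding eq using int by (intro integrable_mult_right integrable_of_real)
    have "(\<lambda>n. integral\<^sup>L M (?f n)) sums (\<integral>x. (\<Sum>n. ?f n x) \<partial>M)"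
    proof (rule sums_integral[OF f])
      show "AE x in M. summable (\<lambda>n. norm (?f n x))"
        by (intro AE_I2 summable_norm_exp)
      have le: "(\<integral>x. norm (?f n x) \<partial>M) \<le> \<bar>t\<bar> ^ n /\<^sub>R fact n" for n
      proof -
        have "(\<integral>x. norm (?f n x) \<partial>M) \<le> (\<integral>x. \<bar>t\<bar> ^ n /\<^sub>R fact n \<partial>M)"
          using f int_abs
          by (intro integral_mono_AE eventually_mono[OF that(3)])
             (auto simp: norm_mult norm_power power_mult_distrib intro!: mult_left_le power_le_one divide_right_mono)
        then show ?thesis by (simp add: prob_space)
      qed
      have "summable (\<lambda>n. \<bar>t\<bar> ^ n /\<^sub>R fact n)"
        by (rule summable_exp_generic)
      then show "summable (\<lambda>n. \<integral>x. norm (?f n x) \<partial>M)"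
        by (rule summable_comparison_test') (use le in auto)
    qed
    moreover have "(\<integral>x. (\<Sum>n. ?f n x) \<partial>M) = Characteristic_Functions.char (distr M borel U) t"
      unfolding char_def by (subst integral_distr) (auto simp: exp_def mult.assoc)
    moreover have "integral\<^sup>L M (?f n) = (\<i> * t) ^ n / fact n * of_real (\<integral>x. U x ^ n \<partial>M)" for n
      unfolding eq integral_mult_right_zero integral_complex_of_real ..
    ultimately show ?thesis by simp
  qed
  interpret M: prob_space M by fact
  interpret N: prob_space N by fact
  show "real_distribution (distr M borel U)" "real_distribution (distr N borel V)"
    by (auto intro!: M.real_distribution_distr N.real_distribution_distr)
  show "Characteristic_Functions.char (distr M borel U) = Characteristic_Functions.char (distr N borel V)"
    using char[OF assms(1,3) bU] char[OF assms(2,4) bV] unfolding eq by (auto simp: fun_eq_iff intro: sums_unique2)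
qed

text \<open>Laplace transforms at the integers are the moments of the bounded variable \<open>exp (-Y)\<close>.\<close>

lemma tail_eq_of_laplace_eq:
  fixes Y :: "'a \<Rightarrow> real" and Z :: "'b \<Rightarrow> real"
  assumes "prob_space M" "prob_space N"
    and [measurable]: "Y \<in> borel_measurable M" "Z \<in> borel_measurable N"
    and "AE x in M. 0 \<le> Y x" "AE x in N. 0 \<le> Z x"
    and eq: "\<And>m::nat. (\<integral>x. exp (- (m * Y x)) \<partial>M) = (\<integral>x. exp (- (m * Z x)) \<partial>N)"
  shows "measure M {\<omega>\<in>space M. x < Y \<omega>} = measure N {\<omega>\<in>space N. x < Z \<omega>}"
proof -
  have d: "distr M borel (\<lambda>x. exp (- Y x)) = distr N borel (\<lambda>x. exp (- Z x))"
    by (rule distr_eq_of_bounded_moments)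
       (use assms in \<open>auto simp: exp_of_nat_mult[symmetric] elim!: eventually_mono\<close>)
  have *: "measure M {\<omega>\<in>space M. x < Y \<omega>} = measure (distr M borel (\<lambda>x. exp (- Y x))) {..< exp (- x)}"
    if [measurable]: "Y \<in> borel_measurable M" for M :: "'c measure" and Y
    by (subst measure_distr) (auto intro!: arg_cong[where f="measure M"])
  show ?thesis by (simp add: * d)
qed

text \<open>An explicit antiderivative of a function that is asymptotically the density itself; the
  correction factor 1 + 1 / x^2 is what both tail estimates are read off from.\<close>

lemma std_normal_density_derivs:
  assumes "0 < x"
  shows "DERIV (\<lambda>x. - std_normal_density x / x) x :> std_normal_density x * (1 + 1 / x\<^sup>2)"
  unfolding std_normal_density_def using assms
  by (auto intro!: derivative_eq_intros simp: divide_simps power2_eq_square) (simp add: algebra_simps)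

lemma tendsto_std_normal_density_over: "((\<lambda>x. - (std_normal_density x / x)) \<longlongrightarrow> 0) at_top"
  unfolding std_normal_density_def by real_asymp

text \<open>On {u..} the factor 1 + 1 / x^2 lies between 1 and 1 + 1 / u^2, while the density times
  this factor integrates exactly to the density at u over u.\<close>

lemma std_normal_mills:
  assumes u: "0 < u"
  shows "measure std_normal_distribution {u..} \<le> std_normal_density u / u"
    and "std_normal_density u / u \<le> (1 + 1 / u\<^sup>2) * measure std_normal_distribution {u..}"
proof -
  let ?N = "std_normal_distribution"
  interpret N: real_distribution ?N by (rule real_dist_normal_dist)
  have m: "(\<integral>\<^sup>+x. ennreal (std_normal_density x) * indicator {u..} x \<partial>lborel) = ennreal (measure ?N {u..})"
    by (subst N.emeasure_eq_measure[symmetric]) (simp add: emeasure_density)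
  have I: "(\<integral>\<^sup>+x. ennreal (std_normal_density x * (1 + 1 / x\<^sup>2)) * indicator {u..} x \<partial>lborel)
      = ennreal (std_normal_density u / u)"
  proof -
    have "(\<integral>\<^sup>+x. ennreal (std_normal_density x * (1 + 1 / x\<^sup>2)) * indicator {u..} x \<partial>lborel)
        = ennreal (0 - (- std_normal_density u / u))"
    proof (rule nn_integral_FTC_atLeast)
      show "DERIV (\<lambda>x. - std_normal_density x / x) x :> std_normal_density x * (1 + 1 / x\<^sup>2)" if "u \<le> x" for x
        using that u by (intro std_normal_density_derivs) simp
    qed (use tendsto_std_normal_density_over in \<open>auto\<close>)
    then show ?thesis by simp
  qed
  have "ennreal (measure ?N {u..}) \<le> ennreal (std_normal_density u / u)"
    unfolding m[symmetric] I[symmetric]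
    by (intro nn_integral_mono mult_right_mono ennreal_leI) (auto simp: algebra_simps)
  then show "measure ?N {u..} \<le> std_normal_density u / u"
    using u by (simp add: ennreal_le_iff)
  have "ennreal (std_normal_density u / u)
      \<le> (\<integral>\<^sup>+x. ennreal (1 + 1 / u\<^sup>2) * (ennreal (std_normal_density x) * indicator {u..} x) \<partial>lborel)"
    unfolding I[symmetric]
  proof (intro nn_integral_mono)
    fix x
    show "ennreal (std_normal_density x * (1 + 1 / x\<^sup>2)) * indicator {u..} x
        \<le> ennreal (1 + 1 / u\<^sup>2) * (ennreal (std_normal_density x) * indicator {u..} x)"
    proof (cases "u \<le> x")
      case True
      have "std_normal_density x * (1 + 1 / x\<^sup>2) \<le> std_normal_density x * (1 + 1 / u\<^sup>2)"
        using True u by (intro mult_left_mono add_left_mono divide_left_mono power_mono) auto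
      then have "ennreal (std_normal_density x * (1 + 1 / x\<^sup>2)) \<le> ennreal ((1 + 1 / u\<^sup>2) * std_normal_density x)"
        by (intro ennreal_leI) (simp only: mult.commute)
      also have "\<dots> = ennreal (1 + 1 / u\<^sup>2) * ennreal (std_normal_density x)"
        by (rule ennreal_mult) auto
      finally show ?thesis using True by (simp only: indicator_simps mult_1_right atLeast_iff)
    qed auto
  qed
  also have "\<dots> = ennreal ((1 + 1 / u\<^sup>2) * measure ?N {u..})"
    by (subst nn_integral_cmult) (auto simp: m ennreal_mult')
  finally show "std_normal_density u / u \<le> (1 + 1 / u\<^sup>2) * measure ?N {u..}"
    by (simp add: ennreal_le_iff)
qed

lemma std_normal_square_tail:
  assumes y: "0 < y"
  shows "measure std_normal_distribution {g. y < g\<^sup>2} = 2 * measure std_normal_distribution {sqrt y..}"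
proof -
  let ?N = "std_normal_distribution"
  interpret N: real_distribution ?N by (rule real_dist_normal_dist)
  have m: "emeasure ?N A = (\<integral>\<^sup>+x. ennreal (std_normal_density x) * indicator A x \<partial>lborel)" if "A \<in> sets borel" for A
    using that by (simp add: emeasure_density)
  have AE: "AE x in lborel. x \<noteq> c" for c :: real
    by (rule AE_lborel_singleton)
  have refl: "emeasure ?N {.. - sqrt y} = emeasure ?N {sqrt y..}"
    unfolding m[OF borel_closed[OF closed_atMost]] m[OF borel_closed[OF closed_atLeast]]
    by (subst nn_integral_real_affine[where c="-1" and t=0])
       (auto intro!: nn_integral_cong simp: std_normal_density_def indicator_def)
  have "measure ?N {g. y < g\<^sup>2} = measure ?N ({.. - sqrt y} \<union> {sqrt y..})"
  proof -
    \<comment> \<open>The strict and the closed half-lines differ only in the two points sqrt y and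
      - sqrt y, which are null.\<close>
    have "emeasure ?N {g. y < g\<^sup>2} = emeasure ?N ({.. - sqrt y} \<union> {sqrt y..})"
    proof (subst m, measurable, subst m, simp, intro nn_integral_cong_AE)
      show "AE x in lborel. ennreal (std_normal_density x) * indicator {g. y < g\<^sup>2} x
          = ennreal (std_normal_density x) * indicator ({.. - sqrt y} \<union> {sqrt y..}) x"
        using AE[of "sqrt y"] AE[of "- sqrt y"]
      proof eventually_elim
        case (elim x)
        have "y < x\<^sup>2 \<longleftrightarrow> sqrt y < \<bar>x\<bar>"
          using y by (metis real_sqrt_abs real_sqrt_less_iff)
        then show ?case using elim by (auto simp: indicator_def abs_if split: if_splits)
      qed
    qed
    then show ?thesis by (simp add: measure_def)
  qed
  also have "\<dots> = measure ?N {.. - sqrt y} + measure ?N {sqrt y..}"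
  proof (rule N.finite_measure_Union)
    have "0 < sqrt y" using y by simp
    then have "\<not> (x \<le> - sqrt y \<and> sqrt y \<le> x)" for x by linarith
    then show "{.. - sqrt y} \<inter> {sqrt y..} = {}" by auto
  qed auto
  finally show ?thesis using refl by (simp add: measure_def)
qed

lemma two_std_normal_density_sqrt:
  assumes "0 < y"
  shows "2 * (std_normal_density (sqrt y) / sqrt y) = sqrt (2 / pi) * exp (- y / 2) / sqrt y"
proof -
  have "2 / sqrt (2 * pi) = sqrt (2 / pi)"
    by (simp add: real_sqrt_divide real_sqrt_mult divide_simps)
  moreover have "2 * (std_normal_density (sqrt y)) = 2 / sqrt (2 * pi) * exp (- y / 2)"
    using assms by (simp add: std_normal_density_def)
  ultimately show ?thesis by (simp only: times_divide_eq_right)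
qed

lemma std_normal_square_tail_le:
  assumes y: "0 < y"
  shows "measure std_normal_distribution {g. y < g\<^sup>2} \<le> sqrt (2 / pi) * exp (- y / 2) / sqrt y"
  unfolding std_normal_square_tail[OF y] two_std_normal_density_sqrt[OF y, symmetric]
  using std_normal_mills(1)[of "sqrt y"] y by simp

lemma std_normal_square_tail_tendsto:
  "((\<lambda>y. sqrt y * exp (y / 2) * measure std_normal_distribution {g. y < g\<^sup>2}) \<longlongrightarrow> sqrt (2 / pi)) at_top"
proof (rule tendsto_sandwich)
  \<comment> \<open>The lower Mills bound at u = sqrt y costs the factor 1 + 1 / y, whose reciprocal
    is y / (1 + y).\<close>
  show "\<forall>\<^sub>F y in at_top. sqrt (2 / pi) * (y / (1 + y)) \<le> sqrt y * exp (y / 2) * measure std_normal_distribution {g. y < g\<^sup>2}"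
    using eventually_gt_at_top[of 0]
  proof eventually_elim
    case (elim y)
    let ?m = "measure std_normal_distribution {g. y < g\<^sup>2}"
    have "2 * (std_normal_density (sqrt y) / sqrt y) \<le> (1 + 1 / y) * ?m"
      unfolding std_normal_square_tail[OF elim] using std_normal_mills(2)[of "sqrt y"] elim by simp
    then have "sqrt (2 / pi) * exp (- y / 2) / sqrt y \<le> (1 + 1 / y) * ?m"
      by (simp only: two_std_normal_density_sqrt[OF elim])
    then have "(sqrt (2 / pi) * exp (- y / 2) / sqrt y) * (sqrt y * exp (y / 2) * (y / (1 + y)))
        \<le> ((1 + 1 / y) * ?m) * (sqrt y * exp (y / 2) * (y / (1 + y)))"
      using elim by (intro mult_right_mono) auto
    moreover have "(sqrt (2 / pi) * exp (- y / 2) / sqrt y) * (sqrt y * exp (y / 2) * (y / (1 + y)))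
        = sqrt (2 / pi) * (y / (1 + y)) * (exp (- y / 2) * exp (y / 2)) * (sqrt y / sqrt y)"
      by (simp only: divide_inverse mult_ac)
    moreover have "exp (- y / 2) * exp (y / 2) = 1" "sqrt y / sqrt y = 1"
      using elim by (simp_all add: exp_add[symmetric])
    moreover have "((1 + 1 / y) * ?m) * (sqrt y * exp (y / 2) * (y / (1 + y))) = sqrt y * exp (y / 2) * ?m * ((1 + 1 / y) * (y / (1 + y)))"
      by (simp only: mult_ac)
    moreover have "(1 + 1 / y) * (y / (1 + y)) = 1"
      using elim by (simp add: divide_simps add.commute)
    ultimately show ?case by (simp only: mult_1_right)
  qed
  show "\<forall>\<^sub>F y in at_top. sqrt y * exp (y / 2) * measure std_normal_distribution {g. y < g\<^sup>2} \<le> sqrt (2 / pi)"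
    using eventually_gt_at_top[of 0]
  proof eventually_elim
    case (elim y)
    have "sqrt y * exp (y / 2) * measure std_normal_distribution {g. y < g\<^sup>2}
        \<le> sqrt y * exp (y / 2) * (sqrt (2 / pi) * exp (- y / 2) / sqrt y)"
      using elim std_normal_square_tail_le[OF elim] by (intro mult_left_mono) auto
    also have "\<dots> = sqrt (2 / pi)"
      using elim by (simp add: exp_minus field_simps)
    finally show ?case .
  qed
  have "((\<lambda>y::real. y / (1 + y)) \<longlongrightarrow> 1) at_top"
    by real_asymp
  from tendsto_mult[OF tendsto_const this]
  show "((\<lambda>y. sqrt (2 / pi) * (y / (1 + y))) \<longlongrightarrow> sqrt (2 / pi)) at_top"
    by simp
qed auto

text \<open>A bound for every real y, to be used at y = x - W, which may be negative. The constant 3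
  suffices in both regimes: 2 (1 + y) <= 9 pi y for y >= 1, and exp (1/2) * sqrt 2 <= 3 together
  with the trivial bound 1 for y < 1.\<close>

lemma std_normal_square_tail_bound:
  "measure std_normal_distribution {g. y < g\<^sup>2} \<le> 3 * exp (- y / 2) / sqrt (1 + max y 0)"
proof (cases "y \<ge> 1")
  case True
  have "measure std_normal_distribution {g. y < g\<^sup>2} \<le> sqrt (2 / pi) * exp (- y / 2) / sqrt y"
    using True by (intro std_normal_square_tail_le) simp
  also have "\<dots> = exp (- y / 2) * sqrt (2 / pi / y)"
    by (simp add: real_sqrt_divide real_sqrt_mult)
  also have "\<dots> \<le> exp (- y / 2) * sqrt (9 / (1 + y))"
  proof (intro mult_left_mono real_sqrt_le_mono)
    have "2 * (1 + y) \<le> 9 * y" using True by simp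
    also have "\<dots> \<le> 9 * (pi * y)" using True pi_gt3 by simp
    finally show "2 / pi / y \<le> 9 / (1 + y)" using True by (simp add: field_simps)
  qed auto
  also have "\<dots> = 3 * exp (- y / 2) / sqrt (1 + max y 0)"
    using True by (simp add: real_sqrt_divide)
  finally show ?thesis .
next
  case False
  interpret N: real_distribution std_normal_distribution by (rule real_dist_normal_dist)
  have "exp (1/2::real) * sqrt 2 \<le> 3"
  proof (rule power2_le_imp_le)
    have "(exp (1/2::real) * sqrt 2)\<^sup>2 = exp 1 * 2"
      by (simp add: power_mult_distrib exp_double[symmetric])
    also have "\<dots> \<le> 3\<^sup>2" using exp_le by simp
    finally show "(exp (1/2::real) * sqrt 2)\<^sup>2 \<le> 3\<^sup>2" .
  qed simp
  moreover have "exp (y / 2) * sqrt (1 + max y 0) \<le> exp (1/2) * sqrt 2"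
    using False by (intro mult_mono) auto
  ultimately have "exp (y / 2) * sqrt (1 + max y 0) \<le> 3" by linarith
  moreover have "0 < sqrt (1 + max y 0)" by simp
  ultimately have "1 \<le> 3 * exp (- y / 2) / sqrt (1 + max y 0)"
    by (simp add: exp_minus field_simps)
  then show ?thesis using N.prob_le_1 order_trans by blast
qed

text \<open>Dominated convergence after integrating out the normal variable. The exponent \<theta>
  must exceed 1/2 strictly: the ratio of sqrt x to sqrt (1 + max (x - W) 0) costs a factor of size 1
  + W, which is absorbed by exp ((\<theta> - 1/2) * W).\<close>

lemma (in prob_space) tail_normal_square_plus:
  assumes [measurable]: "W \<in> borel_measurable M" and nonneg: "AE \<omega> in M. 0 \<le> W \<omega>"
    and \<theta>: "1 / 2 < \<theta>" and int: "integrable M (\<lambda>\<omega>. exp (\<theta> * W \<omega>))"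
  shows "((\<lambda>x. sqrt x * exp (x / 2) *
            measure (M \<Otimes>\<^sub>M std_normal_distribution) {p\<in>space (M \<Otimes>\<^sub>M std_normal_distribution). x < (snd p)\<^sup>2 + W (fst p)})
          \<longlongrightarrow> sqrt (2 / pi) * expectation (\<lambda>\<omega>. exp (W \<omega> / 2))) at_top"
proof -
  let ?N = "std_normal_distribution"
  define Q where "Q y = measure ?N {g. y < g\<^sup>2}" for y
  interpret N: real_distribution ?N by (rule real_dist_normal_dist)
  interpret P: pair_prob_space M ?N ..
  have Q_meas[measurable]: "Q \<in> borel_measurable borel"
  proof -
    \<comment> \<open>Measurability of the tail function comes from its monotonicity.\<close>
    have "mono (\<lambda>y. - Q y)"
      unfolding Q_def by (intro monoI) (auto intro!: N.finite_measure_mono)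
    then have "(\<lambda>y. - Q y) \<in> borel_measurable borel" by (rule borel_measurable_mono)
    then have "(\<lambda>y. - (- Q y)) \<in> borel_measurable borel" by (rule borel_measurable_uminus)
    then show ?thesis by simp
  qed
  have prob: "measure (M \<Otimes>\<^sub>M ?N) {p\<in>space (M \<Otimes>\<^sub>M ?N). x < (snd p)\<^sup>2 + W (fst p)} = expectation (\<lambda>\<omega>. Q (x - W \<omega>))" for x
  proof -
    let ?A = "{p\<in>space (M \<Otimes>\<^sub>M ?N). x < (snd p)\<^sup>2 + W (fst p)}"
    have A: "?A \<in> sets (M \<Otimes>\<^sub>M ?N)" by measurable
    have "measure ?N (Pair \<omega> -` ?A) = Q (x - W \<omega>)" if "\<omega> \<in> space M" for \<omega>
      unfolding Q_def using that by (intro arg_cong[where f="measure ?N"]) (auto simp: space_pair_measure)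
    then have "expectation (\<lambda>\<omega>. measure ?N (Pair \<omega> -` ?A)) = expectation (\<lambda>\<omega>. Q (x - W \<omega>))"
      by (intro Bochner_Integration.integral_cong) auto
    moreover have "emeasure (M \<Otimes>\<^sub>M ?N) ?A = (\<integral>\<^sup>+\<omega>. ennreal (measure ?N (Pair \<omega> -` ?A)) \<partial>M)"
      unfolding N.emeasure_pair_measure_alt[OF A] by (simp add: N.emeasure_eq_measure)
    moreover have "(\<integral>\<^sup>+\<omega>. ennreal (measure ?N (Pair \<omega> -` ?A)) \<partial>M) = ennreal (expectation (\<lambda>\<omega>. Q (x - W \<omega>)))"
    proof -
      have "(\<integral>\<^sup>+\<omega>. ennreal (measure ?N (Pair \<omega> -` ?A)) \<partial>M) = (\<integral>\<^sup>+\<omega>. ennreal (Q (x - W \<omega>)) \<partial>M)"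
        using \<open>\<And>\<omega>. \<omega> \<in> space M \<Longrightarrow> measure ?N (Pair \<omega> -` ?A) = Q (x - W \<omega>)\<close> by (intro nn_integral_cong) auto
      also have "\<dots> = ennreal (expectation (\<lambda>\<omega>. Q (x - W \<omega>)))"
        by (intro nn_integral_eq_integral integrable_const_bound[where B=1]) (auto simp: Q_def)
      finally show ?thesis .
    qed
    ultimately show ?thesis
      by (simp add: measure_def Q_def integral_nonneg_AE)
  qed
  define \<epsilon> where "\<epsilon> = \<theta> - 1 / 2"
  have \<epsilon>: "\<epsilon> > 0" using \<theta> by (simp add: \<epsilon>_def)
  have "((\<lambda>x. expectation (\<lambda>\<omega>. sqrt x * exp (x / 2) * Q (x - W \<omega>)))
          \<longlongrightarrow> expectation (\<lambda>\<omega>. sqrt (2 / pi) * exp (W \<omega> / 2))) at_top"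
  proof (rule integral_dominated_convergence_at_top[where w="\<lambda>\<omega>. 3 * (1 + 1 / \<epsilon>) * exp (\<theta> * W \<omega>)"])
    show "integrable M (\<lambda>\<omega>. 3 * (1 + 1 / \<epsilon>) * exp (\<theta> * W \<omega>))" using int by simp
    show "AE \<omega> in M. ((\<lambda>x. sqrt x * exp (x / 2) * Q (x - W \<omega>)) \<longlongrightarrow> sqrt (2 / pi) * exp (W \<omega> / 2)) at_top"
    proof (rule AE_I2)
      fix \<omega>
      define w where "w = W \<omega>"
      have "((\<lambda>x. sqrt (x - w) * exp ((x - w) / 2) * Q (x - w)) \<longlongrightarrow> sqrt (2 / pi)) at_top"
        unfolding Q_def
        by (rule filterlim_compose[OF std_normal_square_tail_tendsto]) real_asymp
      moreover have "((\<lambda>x. sqrt x / sqrt (x - w) * exp (w / 2)) \<longlongrightarrow> exp (w / 2)) at_top"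
        by real_asymp
      ultimately have "((\<lambda>x. (sqrt (x - w) * exp ((x - w) / 2) * Q (x - w)) * (sqrt x / sqrt (x - w) * exp (w / 2)))
          \<longlongrightarrow> sqrt (2 / pi) * exp (w / 2)) at_top"
        by (rule tendsto_mult)
      moreover have "\<forall>\<^sub>F x in at_top. (sqrt (x - w) * exp ((x - w) / 2) * Q (x - w)) * (sqrt x / sqrt (x - w) * exp (w / 2))
          = sqrt x * exp (x / 2) * Q (x - w)"
        using eventually_gt_at_top[of w]
      proof eventually_elim
        case (elim x)
        have "exp ((x - w) / 2) * exp (w / 2) = exp (x / 2)" "sqrt (x - w) / sqrt (x - w) = 1"
          using elim by (simp_all add: exp_add[symmetric] add_divide_distrib[symmetric])
        moreover have "(sqrt (x - w) * exp ((x - w) / 2) * Q (x - w)) * (sqrt x / sqrt (x - w) * exp (w / 2))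
            = sqrt x * (exp ((x - w) / 2) * exp (w / 2)) * Q (x - w) * (sqrt (x - w) / sqrt (x - w))"
          by (simp only: divide_inverse mult_ac)
        ultimately show ?case by (simp only: mult_1_right)
      qed
      ultimately show "((\<lambda>x. sqrt x * exp (x / 2) * Q (x - W \<omega>)) \<longlongrightarrow> sqrt (2 / pi) * exp (W \<omega> / 2)) at_top"
        unfolding w_def[symmetric] by (rule Lim_transform_eventually)
    qed
    show "\<forall>\<^sub>F x in at_top. AE \<omega> in M. norm (sqrt x * exp (x / 2) * Q (x - W \<omega>)) \<le> 3 * (1 + 1 / \<epsilon>) * exp (\<theta> * W \<omega>)"
      using eventually_ge_at_top[of 0]
    proof eventually_elim
      case (elim x)
      show ?case using nonneg
      proof eventually_elim
        case (elim \<omega>)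
        define w where "w = W \<omega>"
        have w: "w \<ge> 0" using elim by (simp add: w_def)
        define m where "m = max (x - w) 0"
        have m: "m \<ge> 0" by (simp add: m_def)
        \<comment> \<open>If x >= w, the product expands to 1 + x + w (x - w); otherwise m = 0 and x
          < w.\<close>
        have "x \<le> (1 + w) * (1 + m)"
          using \<open>0 \<le> x\<close> w mult_left_mono[of w x w] by (cases "x \<ge> w") (auto simp: m_def algebra_simps add_increasing2)
        have "sqrt x \<le> sqrt (1 + w) * sqrt (1 + m)"
          unfolding real_sqrt_mult[symmetric] using \<open>x \<le> _\<close> by simp
        also have "sqrt (1 + w) \<le> 1 + w"
          using w by (simp add: sqrt_le_D real_le_lsqrt power2_eq_square algebra_simps)
        finally have "sqrt x \<le> (1 + w) * sqrt (1 + m)" using m by (simp add: mult_right_mono)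
        have "1 + \<epsilon> * w \<le> exp (\<epsilon> * w)" by (rule exp_ge_add_one_self)
        then have "\<epsilon> * w \<le> exp (\<epsilon> * w)" by linarith
        then have "w \<le> exp (\<epsilon> * w) / \<epsilon>" using \<epsilon> by (simp add: pos_le_divide_eq mult.commute)
        then have "1 + w \<le> exp (\<epsilon> * w) + exp (\<epsilon> * w) / \<epsilon>"
          using w \<epsilon> by (intro add_mono) auto
        then have ww: "1 + w \<le> (1 + 1 / \<epsilon>) * exp (\<epsilon> * w)" by (simp add: algebra_simps)
        have "sqrt x * exp (x / 2) * Q (x - w) \<le> sqrt x * exp (x / 2) * (3 * exp (- (x - w) / 2) / sqrt (1 + m))"
          unfolding Q_def m_def using \<open>0 \<le> x\<close> by (intro mult_left_mono std_normal_square_tail_bound) auto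
        also have "\<dots> \<le> ((1 + w) * sqrt (1 + m)) * exp (x / 2) * (3 * exp (- (x - w) / 2) / sqrt (1 + m))"
          using \<open>sqrt x \<le> (1 + w) * sqrt (1 + m)\<close> m by (intro mult_right_mono) auto
        also have "\<dots> = 3 * (1 + w) * (exp (x / 2) * exp (- (x - w) / 2)) * (sqrt (1 + m) / sqrt (1 + m))"
          by (simp only: divide_inverse mult_ac)
        also have "exp (x / 2) * exp (- (x - w) / 2) = exp (w / 2)"
          unfolding exp_add[symmetric] by (simp add: field_simps)
        also have "sqrt (1 + m) / sqrt (1 + m) = 1" using m by simp
        also have "3 * (1 + w) * exp (w / 2) * 1 = 3 * (1 + w) * exp (w / 2)" by simp
        also have "\<dots> \<le> 3 * ((1 + 1 / \<epsilon>) * exp (\<epsilon> * w)) * exp (w / 2)"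
          using ww by (intro mult_right_mono mult_left_mono) auto
        also have "\<dots> = 3 * (1 + 1 / \<epsilon>) * exp (\<theta> * w)"
          by (simp add: \<epsilon>_def mult.assoc exp_add[symmetric] left_diff_distrib)
        finally show ?case using \<open>0 \<le> x\<close> by (simp add: w_def Q_def)
      qed
    qed
  qed auto
  then show ?thesis by (simp add: prob)
qed

text \<open>Each factor is at most 1 / (1 - u k) = 1 + u k / (1 - u k), hence at most exp (u k / (1
  - q)). The point is uniformity in n, for Fatou's lemma below.\<close>

lemma prod_inverse_sqrt_le:
  fixes u :: "nat \<Rightarrow> real"
  assumes "\<And>k. 0 \<le> u k" "\<And>k. u k \<le> q" "q < 1" "summable u"
  shows "(\<Prod>k<n. 1 / sqrt (1 - u k)) \<le> exp (suminf u / (1 - q))"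
proof -
  have "1 / sqrt (1 - u k) \<le> exp (u k / (1 - q))" for k
  proof -
    have uk: "0 \<le> u k" "u k \<le> q" using assms by auto
    have "1 - u k \<le> sqrt (1 - u k)"
      using uk assms(3) by (intro real_le_rsqrt) (auto simp: power2_eq_square intro!: mult_left_le)
    then have "1 / sqrt (1 - u k) \<le> 1 / (1 - u k)"
      using uk assms(3) by (intro divide_left_mono) auto
    also have "\<dots> = 1 + u k / (1 - u k)" using uk assms(3) by (simp add: field_simps)
    also have "\<dots> \<le> 1 + u k / (1 - q)"
      using uk assms(3) by (intro add_left_mono divide_left_mono) auto
    also have "\<dots> \<le> exp (u k / (1 - q))" by (rule exp_ge_add_one_self)
    finally show ?thesis .
  qed
  moreover have "0 \<le> 1 / sqrt (1 - u k)" for k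
    using assms(2)[of k] assms(3) by simp
  ultimately have "(\<Prod>k<n. 1 / sqrt (1 - u k)) \<le> (\<Prod>k<n. exp (u k / (1 - q)))"
    by (intro prod_mono) auto
  also have "\<dots> = exp ((\<Sum>k<n. u k) / (1 - q))"
    by (simp add: exp_sum sum_divide_distrib)
  also have "\<dots> \<le> exp (suminf u / (1 - q))"
    using assms by (auto intro!: divide_right_mono sum_le_suminf)
  finally show ?thesis .
qed

context prob_space
begin

context
  fixes \<eta> :: "nat \<Rightarrow> 'a \<Rightarrow> real"
  assumes gf: "\<And>n. std_gaussian_family M \<eta> {..<n}"
begin

lemma std_gaussian_measurable: "\<eta> k \<in> borel_measurable M"
  using std_gaussian_familyD(1)[OF gf[of "Suc k"], of k] by simp

lemma std_gaussian_nn_square: "(\<integral>\<^sup>+\<omega>. ennreal ((\<eta> k \<omega>)\<^sup>2) \<partial>M) = 1"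
proof -
  note [measurable] = std_gaussian_measurable
  have g: "std_gaussian_family M \<eta> {k}"
    by (rule std_gaussian_family_subset[OF gf[of "Suc k"]]) auto
  show ?thesis
    using std_gaussian_family_char_scaled[OF g, where a="\<lambda>_. 1"]
    by (subst nn_expectation_square_gaussian[where v=1]) auto
qed

text \<open>The expected sum is \<open>suminf c\<close>, which is finite. Convergence has to be
  recorded because \<open>suminf\<close> of reals is meaningful only then.\<close>

lemma AE_summable_gaussian_squares:
  assumes "\<And>k. 0 \<le> c k" "summable c"
  shows "AE \<omega> in M. summable (\<lambda>k. c k * (\<eta> k \<omega>)\<^sup>2)"
proof -
  note [measurable] = std_gaussian_measurable
  have "(\<integral>\<^sup>+\<omega>. (\<Sum>k. ennreal (c k * (\<eta> k \<omega>)\<^sup>2)) \<partial>M) = (\<Sum>k. \<integral>\<^sup>+\<omega>. ennreal (c k * (\<eta> k \<omega>)\<^sup>2) \<partial>M)"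
    by (rule nn_integral_suminf) auto
  also have "\<dots> = (\<Sum>k. ennreal (c k))"
    using assms by (simp add: ennreal_mult nn_integral_cmult std_gaussian_nn_square)
  also have "\<dots> \<noteq> \<infinity>" using assms by (simp add: ennreal_suminf_neq_top)
  finally have "AE \<omega> in M. (\<Sum>k. ennreal (c k * (\<eta> k \<omega>)\<^sup>2)) \<noteq> \<infinity>"
    by (intro nn_integral_noteq_infinite) auto
  then show ?thesis
    by eventually_elim (use assms in \<open>auto intro!: summable_suminf_not_top\<close>)
qed

text \<open>Partial sums give finite products, and all integrands are bounded by 1. Stating the
  result as a limit of finite products avoids a separate discussion of the infinite product.\<close>

lemma laplace_gaussian_squares:
  assumes c: "\<And>k. 0 \<le> c k" "summable c" and m: "0 \<le> m"
  shows "(\<lambda>n. \<Prod>k<n. 1 / sqrt (1 + 2 * m * c k)) \<longlonglongrightarrow> expectation (\<lambda>\<omega>. exp (- (m * (\<Sum>k. c k * (\<eta> k \<omega>)\<^sup>2))))"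
proof -
  note [measurable] = std_gaussian_measurable
  have "(\<lambda>n. expectation (\<lambda>\<omega>. exp (- (m * (\<Sum>k<n. c k * (\<eta> k \<omega>)\<^sup>2)))))
      \<longlonglongrightarrow> expectation (\<lambda>\<omega>. exp (- (m * (\<Sum>k. c k * (\<eta> k \<omega>)\<^sup>2))))"
  proof (rule integral_dominated_convergence[where w="\<lambda>_. 1"])
    show "AE \<omega> in M. (\<lambda>n. exp (- (m * (\<Sum>k<n. c k * (\<eta> k \<omega>)\<^sup>2)))) \<longlonglongrightarrow> exp (- (m * (\<Sum>k. c k * (\<eta> k \<omega>)\<^sup>2)))"
      using AE_summable_gaussian_squares[OF c]
      by eventually_elim (auto intro!: tendsto_intros summable_LIMSEQ)
  qed (use c m in \<open>auto intro!: mult_nonneg_nonneg sum_nonneg\<close>)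
  moreover have "expectation (\<lambda>\<omega>. exp (- (m * (\<Sum>k<n. c k * (\<eta> k \<omega>)\<^sup>2)))) = (\<Prod>k<n. 1 / sqrt (1 + 2 * m * c k))" for n
    using expectation_exp_neg_squares[OF gf[of n], of "\<lambda>k. 2 * m * c k"] c m
    by (simp add: sum_distrib_left mult.assoc flip: sum_divide_distrib)
       (simp add: mult.assoc flip: sum_distrib_left)
  ultimately show ?thesis by simp
qed

text \<open>Fatou's lemma with the uniform product bound first shows that the exponential of the
  full sum is integrable; this variable then dominates the exponentials of the partial sums, which
  gives the exact value.\<close>

lemma exp_moment_gaussian_squares:
  assumes c: "\<And>k. 0 \<le> c k" "summable c" and \<theta>: "0 \<le> \<theta>" and q: "\<And>k. 2 * \<theta> * c k \<le> q" "q < 1"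
  shows "integrable M (\<lambda>\<omega>. exp (\<theta> * (\<Sum>k. c k * (\<eta> k \<omega>)\<^sup>2)))"
    and "(\<lambda>n. \<Prod>k<n. 1 / sqrt (1 - 2 * \<theta> * c k)) \<longlonglongrightarrow> expectation (\<lambda>\<omega>. exp (\<theta> * (\<Sum>k. c k * (\<eta> k \<omega>)\<^sup>2)))"
proof -
  note [measurable] = std_gaussian_measurable
  define S where "S n \<omega> = (\<Sum>k<n. c k * (\<eta> k \<omega>)\<^sup>2)" for n \<omega>
  define V where "V \<omega> = (\<Sum>k. c k * (\<eta> k \<omega>)\<^sup>2)" for \<omega>
  have [measurable]: "S n \<in> borel_measurable M" "V \<in> borel_measurable M" for n
    unfolding S_def[abs_def] V_def[abs_def] by measurable
  have lim: "AE \<omega> in M. (\<lambda>n. S n \<omega>) \<longlonglongrightarrow> V \<omega>"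
    using AE_summable_gaussian_squares[OF c]
    unfolding S_def V_def by eventually_elim (rule summable_LIMSEQ)
  have le: "AE \<omega> in M. \<forall>n. S n \<omega> \<le> V \<omega>"
    using AE_summable_gaussian_squares[OF c]
    unfolding S_def V_def by eventually_elim (use c in \<open>auto intro!: sum_le_suminf\<close>)
  define b where "b = exp ((\<Sum>k. 2 * \<theta> * c k) / (1 - q))"
  have S: "(\<integral>\<^sup>+\<omega>. ennreal (exp (\<theta> * S n \<omega>)) \<partial>M) = ennreal (\<Prod>k<n. 1 / sqrt (1 - 2 * \<theta> * c k))" for n
  proof -
    have "2 * \<theta> * c k < 1" for k using q(1)[of k] q(2) by linarith
    moreover have "\<theta> * S n \<omega> = (\<Sum>k<n. (2 * \<theta> * c k) * (\<eta> k \<omega>)\<^sup>2) / 2" for \<omega>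
      unfolding S_def by (simp add: sum_distrib_left sum_divide_distrib mult.assoc)
    ultimately show ?thesis
      using nn_expectation_exp_squares[OF gf[of n], of "\<lambda>k. 2 * \<theta> * c k"] c \<theta>
      by (simp only: mult_nonneg_nonneg zero_le_numeral finite_lessThan)
  qed
  have "(\<integral>\<^sup>+\<omega>. ennreal (exp (\<theta> * V \<omega>)) \<partial>M) = (\<integral>\<^sup>+\<omega>. liminf (\<lambda>n. ennreal (exp (\<theta> * S n \<omega>))) \<partial>M)"
  proof (rule nn_integral_cong_AE)
    show "AE \<omega> in M. ennreal (exp (\<theta> * V \<omega>)) = liminf (\<lambda>n. ennreal (exp (\<theta> * S n \<omega>)))"
      using lim
      by eventually_elim (auto intro!: lim_imp_Liminf[symmetric] tendsto_ennrealI tendsto_intros)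
  qed
  also have "\<dots> \<le> liminf (\<lambda>n. \<integral>\<^sup>+\<omega>. ennreal (exp (\<theta> * S n \<omega>)) \<partial>M)"
    by (rule nn_integral_liminf) auto
  also have "\<dots> \<le> ennreal b"
    unfolding S b_def
    by (intro Liminf_le always_eventually allI ennreal_leI prod_inverse_sqrt_le) (use c q \<theta> in \<open>auto intro!: summable_mult\<close>)
  finally have "(\<integral>\<^sup>+\<omega>. ennreal (exp (\<theta> * V \<omega>)) \<partial>M) < \<infinity>"
    using le_less_trans[OF _ ennreal_less_top] by (simp only: infinity_ennreal_def)
  then have int: "integrable M (\<lambda>\<omega>. exp (\<theta> * V \<omega>))"
    by (intro integrableI_bounded) auto
  then show "integrable M (\<lambda>\<omega>. exp (\<theta> * (\<Sum>k. c k * (\<eta> k \<omega>)\<^sup>2)))"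
    by (simp add: V_def)
  have "(\<lambda>n. expectation (\<lambda>\<omega>. exp (\<theta> * S n \<omega>))) \<longlonglongrightarrow> expectation (\<lambda>\<omega>. exp (\<theta> * V \<omega>))"
  proof (rule integral_dominated_convergence[where w="\<lambda>\<omega>. exp (\<theta> * V \<omega>)"])
    show "AE \<omega> in M. (\<lambda>n. exp (\<theta> * S n \<omega>)) \<longlonglongrightarrow> exp (\<theta> * V \<omega>)"
      using lim by eventually_elim (auto intro!: tendsto_intros)
    show "AE \<omega> in M. norm (exp (\<theta> * S n \<omega>)) \<le> exp (\<theta> * V \<omega>)" for n
      using le by eventually_elim (auto intro!: mult_left_mono \<theta>)
  qed (use int in auto)
  moreover have "expectation (\<lambda>\<omega>. exp (\<theta> * S n \<omega>)) = (\<Prod>k<n. 1 / sqrt (1 - 2 * \<theta> * c k))" for n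
  proof -
    have "2 * \<theta> * c k \<le> 1" for k using q(1)[of k] q(2) by linarith
    then have "0 \<le> (\<Prod>k<n. 1 / sqrt (1 - 2 * \<theta> * c k))" by (intro prod_nonneg) auto
    then show ?thesis by (subst integral_eq_nn_integral) (auto simp: S)
  qed
  ultimately show "(\<lambda>n. \<Prod>k<n. 1 / sqrt (1 - 2 * \<theta> * c k)) \<longlonglongrightarrow> expectation (\<lambda>\<omega>. exp (\<theta> * (\<Sum>k. c k * (\<eta> k \<omega>)\<^sup>2)))"
    by (simp add: V_def)
qed

end

lemma std_gaussian_family_Suc:
  assumes "std_gaussian_family M \<eta> {..<Suc n}"
  shows "std_gaussian_family M (\<lambda>k. \<eta> (Suc k)) {..<n}"
proof -
  have s: "std_gaussian_family M \<eta> (Suc ` {..<n})"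
    by (rule std_gaussian_family_subset[OF assms]) auto
  show ?thesis
    unfolding std_gaussian_family_def
  proof (intro conjI ballI allI)
    fix a
    show "(CLINT \<omega>|M. iexp (\<Sum>k<n. a k * \<eta> (Suc k) \<omega>)) = of_real (exp (- ((\<Sum>k<n. (a k)\<^sup>2) / 2)))"
      using std_gaussian_familyD(2)[OF s, where a="\<lambda>k. a (k - 1)"] by (simp add: sum.reindex)
  qed (use std_gaussian_familyD(1)[OF s] in auto)
qed

text \<open>Zolotarev's tail asymptotics.  By uniqueness of Laplace transforms the leading summand may be replaced
  by an independent one, and conditioning on the remaining sum gives the factor \<open>E exp (W / 2)\<close>.\<close>

theorem tail_gaussian_squares:
  fixes \<eta> :: "nat \<Rightarrow> 'a \<Rightarrow> real"
  assumes gf: "\<And>n. std_gaussian_family M \<eta> {..<n}"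
    and l: "\<And>k. 0 < l k" "summable l" "\<And>k. l (Suc k) \<le> l 1" "l 1 < l 0"
    and Y [measurable]: "Y \<in> borel_measurable M" and YS: "AE \<omega> in M. Y \<omega> = (\<Sum>k. l k * (\<eta> k \<omega>)\<^sup>2)"
    and L: "(\<lambda>n. \<Prod>k<n. 1 / sqrt (1 - l (Suc k) / l 0)) \<longlonglongrightarrow> L"
  shows "((\<lambda>x. sqrt x * exp (x / (2 * l 0)) * prob {\<omega>\<in>space M. x < Y \<omega>}) \<longlongrightarrow> sqrt (2 * l 0 / pi) * L) at_top"
proof -
  let ?N = "std_normal_distribution"
  interpret N: real_distribution ?N by (rule real_dist_normal_dist)
  interpret P: pair_prob_space M ?N ..
  have l0: "0 < l 0" by (rule l(1))
  \<comment> \<open>Normalising the leading weight to 1; the original scale returns at the end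
    through x / l 0.\<close>
  define c where "c k = l k / l 0" for k
  have c: "\<And>k. 0 \<le> c k" "summable c" "\<And>k. c (Suc k) \<le> c 1" "0 < c 1" "c 1 < 1" "c 0 = 1"
    using l(2-4) less_imp_le[OF l(1)] l(1)[of 1] l0 less_imp_neq[OF l0] unfolding c_def
    by (simp_all add: divide_right_mono summable_divide)
  have gf': "\<And>n. std_gaussian_family M (\<lambda>k. \<eta> (Suc k)) {..<n}"
    by (rule std_gaussian_family_Suc[OF gf])
  note [measurable] = std_gaussian_measurable[OF gf]
  have c': "\<And>k. 0 \<le> c (Suc k)" "summable (\<lambda>k. c (Suc k))"
    using c by (auto simp: summable_Suc_iff)
  define W where "W \<omega> = (\<Sum>k. c (Suc k) * (\<eta> (Suc k) \<omega>)\<^sup>2)" for \<omega>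
  have [measurable]: "W \<in> borel_measurable M" unfolding W_def[abs_def] by measurable
  have W0: "AE \<omega> in M. 0 \<le> W \<omega>"
    using AE_summable_gaussian_squares[OF gf' c']
    unfolding W_def by eventually_elim (use c' in \<open>auto intro!: suminf_nonneg\<close>)
  define Y' where "Y' \<omega> = Y \<omega> / l 0" for \<omega>
  have [measurable]: "Y' \<in> borel_measurable M" unfolding Y'_def[abs_def] by measurable
  have Y'S: "AE \<omega> in M. Y' \<omega> = (\<Sum>k. c k * (\<eta> k \<omega>)\<^sup>2)"
    using YS AE_summable_gaussian_squares[OF gf less_imp_le[OF l(1)] l(2)]
  proof eventually_elim
    case (elim \<omega>)
    then show ?case
      by (simp add: Y'_def c_def suminf_divide[symmetric])
  qed
  have Y'0: "AE \<omega> in M. 0 \<le> Y' \<omega>"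
    using AE_summable_gaussian_squares[OF gf c(1,2)] Y'S
    by eventually_elim (use c in \<open>auto intro!: suminf_nonneg\<close>)
  have W0': "AE p in M \<Otimes>\<^sub>M ?N. 0 \<le> W (fst p)"
  proof (rule P.AE_pair_measure)
    show "{p \<in> space (M \<Otimes>\<^sub>M ?N). 0 \<le> W (fst p)} \<in> sets (M \<Otimes>\<^sub>M ?N)" by measurable
    show "AE x in M. AE y in ?N. 0 \<le> W (fst (x, y))"
      using W0 by eventually_elim simp
  qed
  have laplace: "(\<integral>\<omega>. exp (- (m * Y' \<omega>)) \<partial>M) = (\<integral>p. exp (- (m * ((snd p)\<^sup>2 + W (fst p)))) \<partial>(M \<Otimes>\<^sub>M ?N))"
    if m: "0 \<le> m" for m :: real
  proof -
    have "(\<lambda>n. \<Prod>k<n. 1 / sqrt (1 + 2 * m * c k)) \<longlonglongrightarrow> expectation (\<lambda>\<omega>. exp (- (m * (\<Sum>k. c k * (\<eta> k \<omega>)\<^sup>2))))"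
      by (rule laplace_gaussian_squares[OF gf c(1,2) m])
    also have "expectation (\<lambda>\<omega>. exp (- (m * (\<Sum>k. c k * (\<eta> k \<omega>)\<^sup>2)))) = expectation (\<lambda>\<omega>. exp (- (m * Y' \<omega>)))"
    proof (rule integral_cong_AE)
      show "AE \<omega> in M. exp (- (m * (\<Sum>k. c k * (\<eta> k \<omega>)\<^sup>2))) = exp (- (m * Y' \<omega>))"
        using Y'S by eventually_elim simp
    qed measurable
    \<comment> \<open>With \<open>Suc n\<close> factors the one for k = 0, where c 0 = 1, can be
      split off. It is the Laplace transform of the square of a single standard normal
      variable.\<close>
    finally have 1: "(\<lambda>n. \<Prod>k<Suc n. 1 / sqrt (1 + 2 * m * c k)) \<longlonglongrightarrow> expectation (\<lambda>\<omega>. exp (- (m * Y' \<omega>)))"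
      by (rule LIMSEQ_Suc)
    have "(\<lambda>n. 1 / sqrt (1 + 2 * m) * (\<Prod>k<n. 1 / sqrt (1 + 2 * m * c (Suc k))))
        \<longlonglongrightarrow> 1 / sqrt (1 + 2 * m) * expectation (\<lambda>\<omega>. exp (- (m * W \<omega>)))"
      unfolding W_def by (intro tendsto_mult tendsto_const laplace_gaussian_squares[OF gf' c' m])
    then have "(\<lambda>n. \<Prod>k<Suc n. 1 / sqrt (1 + 2 * m * c k))
        \<longlonglongrightarrow> 1 / sqrt (1 + 2 * m) * expectation (\<lambda>\<omega>. exp (- (m * W \<omega>)))"
      unfolding prod.lessThan_Suc_shift by (simp add: c(6))
    from LIMSEQ_unique[OF 1 this]
    have 2: "expectation (\<lambda>\<omega>. exp (- (m * Y' \<omega>))) = 1 / sqrt (1 + 2 * m) * expectation (\<lambda>\<omega>. exp (- (m * W \<omega>)))" .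
    have "integrable (M \<Otimes>\<^sub>M ?N) (\<lambda>p. exp (- (m * ((snd p)\<^sup>2 + W (fst p)))))"
    proof (rule P.integrable_const_bound[where B=1])
      show "AE p in M \<Otimes>\<^sub>M ?N. norm (exp (- (m * ((snd p)\<^sup>2 + W (fst p))))) \<le> 1"
        using W0' by eventually_elim (use m in auto)
    qed measurable
    then have "(\<integral>p. exp (- (m * ((snd p)\<^sup>2 + W (fst p)))) \<partial>(M \<Otimes>\<^sub>M ?N))
        = (\<integral>\<omega>. (\<integral>g. exp (- (m * (g\<^sup>2 + W \<omega>))) \<partial>?N) \<partial>M)"
      using P.integral_fst'[of "\<lambda>p. exp (- (m * ((snd p)\<^sup>2 + W (fst p))))"] by simp
    also have "\<dots> = (\<integral>\<omega>. exp (- (m * W \<omega>)) * (\<integral>g. exp (- ((2 * m) * g\<^sup>2 / 2)) \<partial>?N) \<partial>M)"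
      by (simp add: distrib_left exp_add[symmetric] add.commute flip: integral_mult_right_zero)
    also have "\<dots> = 1 / sqrt (1 + 2 * m) * expectation (\<lambda>\<omega>. exp (- (m * W \<omega>)))"
      using m by (subst integral_std_normal_exp_quadratic) auto
    finally show ?thesis using 2 by simp
  qed
  have tail: "prob {\<omega>\<in>space M. x < Y' \<omega>} = measure (M \<Otimes>\<^sub>M ?N) {p\<in>space (M \<Otimes>\<^sub>M ?N). x < (snd p)\<^sup>2 + W (fst p)}" for x
  proof (rule tail_eq_of_laplace_eq)
    show "AE p in M \<Otimes>\<^sub>M ?N. 0 \<le> (snd p)\<^sup>2 + W (fst p)"
      using W0' by eventually_elim auto
    show "prob_space M" "prob_space (M \<Otimes>\<^sub>M ?N)" by unfold_locales
  qed (use Y'0 laplace in auto)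
  \<comment> \<open>The midpoint of 1/2 and 1 / (2 * c 1). The first is the exponent that domination
    must exceed, the second the threshold below which the exponential moment is under control;
    \<open>l 1 < l 0\<close> makes the gap nonempty.\<close>
  define \<theta> where "\<theta> = (1 + 1 / c 1) / 4"
  have \<theta>: "1 / 2 < \<theta>" "2 * \<theta> * c 1 < 1"
    using c by (simp_all add: \<theta>_def field_simps)
  have int: "integrable M (\<lambda>\<omega>. exp (\<theta> * W \<omega>))"
    unfolding W_def
    by (rule exp_moment_gaussian_squares[OF gf' c', where q="2 * \<theta> * c 1"])
       (use \<theta> c in \<open>auto intro!: mult_left_mono\<close>)
  have "(\<lambda>n. \<Prod>k<n. 1 / sqrt (1 - 2 * (1/2) * c (Suc k))) \<longlonglongrightarrow> expectation (\<lambda>\<omega>. exp (1/2 * W \<omega>))"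
    unfolding W_def
    by (rule exp_moment_gaussian_squares[OF gf' c', where q="c 1"]) (use c in auto)
  then have EL: "expectation (\<lambda>\<omega>. exp (W \<omega> / 2)) = L"
    using L by (simp add: c_def LIMSEQ_unique)
  have lim: "((\<lambda>x. sqrt x * exp (x / 2) * prob {\<omega>\<in>space M. x < Y' \<omega>}) \<longlongrightarrow> sqrt (2 / pi) * L) at_top"
    unfolding tail EL[symmetric] by (rule tail_normal_square_plus[OF _ W0 \<theta>(1) int]) simp
  have inf: "filterlim (\<lambda>x. x / l 0) at_top at_top"
    using l(1)[of 0] by real_asymp
  have "((\<lambda>x. sqrt (l 0) * (sqrt (x / l 0) * exp (x / l 0 / 2) * prob {\<omega>\<in>space M. x / l 0 < Y' \<omega>}))
      \<longlongrightarrow> sqrt (l 0) * (sqrt (2 / pi) * L)) at_top"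
    by (rule tendsto_mult[OF tendsto_const filterlim_compose[OF lim inf]])
  moreover have "sqrt (l 0) * (sqrt (x / l 0) * exp (x / l 0 / 2) * prob {\<omega>\<in>space M. x / l 0 < Y' \<omega>})
      = sqrt x * exp (x / (2 * l 0)) * prob {\<omega>\<in>space M. x < Y \<omega>}" for x
    using l(1)[of 0] by (simp add: Y'_def divide_less_cancel real_sqrt_divide mult.commute)
  moreover have "sqrt (l 0) * (sqrt (2 / pi) * L) = sqrt (2 * l 0 / pi) * L"
    by (simp add: real_sqrt_mult real_sqrt_divide)
  ultimately show ?thesis by simp
qed

end

section \<open>The Bessel function as an entire function\<close>

text \<open>Coefficients of the powers of w = x^2 in Gamma (\<nu> + 1) (x/2)^(-\<nu>) J_\<nu>(x).
  The quotient of Gamma values becomes a Pochhammer symbol, which makes the recurrences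
  algebraic.\<close>

definition bessel_coeff :: "real \<Rightarrow> nat \<Rightarrow> real" where
  "bessel_coeff \<nu> k = (-1) ^ k / (4 ^ k * fact k * pochhammer (\<nu> + 1) k)"

text \<open>The entire function with \<open>J\<^sub>\<nu>(x) = (x/2)\<^sup>\<nu> / \<Gamma>(\<nu>+1) \<cdot> bessel_entire \<nu> (x\<^sup>2)\<close>; its order of growth is \<open>1/2\<close>.\<close>

definition bessel_entire :: "real \<Rightarrow> 'a \<Rightarrow> 'a::{real_normed_field,banach}" where
  "bessel_entire \<nu> w = (\<Sum>k. of_real (bessel_coeff \<nu> k) * w ^ k)"

text \<open>At \<nu> = -1/2 there is equality, since 4^k k! (1/2)(3/2)...(k - 1/2) = (2k)!, and the
  Pochhammer symbol grows with \<nu>.\<close>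

lemma bessel_coeff_bound:
  assumes \<nu>: "- 1 / 2 < \<nu>"
  shows "\<bar>bessel_coeff \<nu> k\<bar> \<le> 1 / fact (2 * k)"
proof -
  have pos: "0 < pochhammer (\<nu> + 1) k" for k using \<nu> by (intro pochhammer_pos) auto
  have "fact (2 * k) \<le> 4 ^ k * fact k * pochhammer (\<nu> + 1) k"
  proof (induction k)
    case (Suc k)
    have "(fact (2 * Suc k) :: real) = fact (2 * k) * (real (2 * k + 1) * real (2 * k + 2))"
      by (simp add: algebra_simps)
    also have "\<dots> \<le> (4 ^ k * fact k * pochhammer (\<nu> + 1) k) * (4 * (real k + 1) * (\<nu> + 1 + real k))"
    proof (rule mult_mono)
      have "real (2 * k + 1) * real (2 * k + 2) = 4 * (real k + 1) * (1 / 2 + real k)"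
        by (simp add: algebra_simps)
      also have "\<dots> \<le> 4 * (real k + 1) * (\<nu> + 1 + real k)"
        using \<nu> by (intro mult_left_mono) auto
      finally show "real (2 * k + 1) * real (2 * k + 2) \<le> 4 * (real k + 1) * (\<nu> + 1 + real k)" .
    qed (use Suc pos in \<open>auto simp: less_imp_le\<close>)
    also have "\<dots> = 4 ^ Suc k * fact (Suc k) * pochhammer (\<nu> + 1) (Suc k)"
      by (simp add: pochhammer_Suc algebra_simps)
    finally show ?case .
  qed simp
  moreover have "0 < (fact (2 * k) :: real)" by simp
  ultimately have "1 / (4 ^ k * fact k * pochhammer (\<nu> + 1) k) \<le> 1 / fact (2 * k)"
    by (intro divide_left_mono) (auto simp: pos)
  then show ?thesis
    unfolding bessel_coeff_def using pos[of k] by (simp add: abs_mult power_abs)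
qed

lemma summable_power_over_fact_double: "summable (\<lambda>k. (x::real) ^ k / fact (2 * k))"
proof (rule summable_comparison_test')
  show "summable (\<lambda>k. \<bar>x\<bar> ^ k / fact k)"
    using summable_exp_generic[of "\<bar>x\<bar>"] by (simp add: divide_inverse mult.commute)
  show "norm (x ^ k / fact (2 * k)) \<le> \<bar>x\<bar> ^ k / fact k" for k
    by (auto simp: power_abs intro!: divide_left_mono fact_mono)
qed

lemma norm_bessel_term_le:
  assumes "- 1 / 2 < \<nu>"
  shows "norm (of_real (bessel_coeff \<nu> k) * w ^ k :: 'a::{real_normed_field,banach}) \<le> norm w ^ k / fact (2 * k)"
  using mult_right_mono[OF bessel_coeff_bound[OF assms, of k], of "norm w ^ k"]
  by (simp add: norm_mult norm_power)

lemma summable_bessel_entire: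
  fixes w :: "'a::{real_normed_field,banach}"
  assumes "- 1 / 2 < \<nu>"
  shows "summable (\<lambda>k. of_real (bessel_coeff \<nu> k) * w ^ k)"
  by (rule summable_comparison_test'[OF summable_power_over_fact_double norm_bessel_term_le[OF assms]])

text \<open>The majorant is cosh (sqrt (norm w)), the even part of the exponential series. This is
  the growth of order 1/2 that later excludes an exponential factor in the product formula.\<close>

lemma norm_bessel_entire_le:
  fixes w :: "'a::{real_normed_field,banach}"
  assumes "- 1 / 2 < \<nu>"
  shows "norm (bessel_entire \<nu> w) \<le> exp (sqrt (norm w))"
proof -
  have "norm (bessel_entire \<nu> w) \<le> (\<Sum>k. norm w ^ k / fact (2 * k))"
    unfolding bessel_entire_def
    by (rule norm_suminf_le[OF norm_bessel_term_le[OF assms] summable_power_over_fact_double]) 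
  also have "\<dots> \<le> exp (sqrt (norm w))"
  proof (rule suminf_le_const[OF summable_power_over_fact_double])
    fix n
    let ?s = "sqrt (norm w)"
    have "?s ^ (2 * k) = norm w ^ k" for k by (simp add: power_mult)
    then have "(\<Sum>k<n. norm w ^ k / fact (2 * k)) = (\<Sum>k<n. ?s ^ (2 * k) /\<^sub>R fact (2 * k))"
      by (simp only: divide_inverse mult.commute real_scaleR_def)
    also have "\<dots> = (\<Sum>j\<in>(\<lambda>k. 2 * k) ` {..<n}. ?s ^ j /\<^sub>R fact j)"
      by (subst sum.reindex) (auto simp: inj_on_def)
    also have "\<dots> \<le> exp ?s"
      unfolding exp_def by (rule sum_le_suminf[OF summable_exp_generic]) auto
    finally show "(\<Sum>k<n. norm w ^ k / fact (2 * k)) \<le> exp ?s" .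
  qed
  finally show ?thesis .
qed

lemma bessel_entire_0 [simp]: "bessel_entire \<nu> 0 = 1"
  unfolding bessel_entire_def
  by (subst powser_zero) (simp add: bessel_coeff_def)

lemma bessel_entire_of_real:
  assumes "- 1 / 2 < \<nu>"
  shows "bessel_entire \<nu> (of_real x) = (of_real (bessel_entire \<nu> x) :: 'a::{real_normed_field,banach})"
proof -
  have "(\<lambda>k. of_real (of_real (bessel_coeff \<nu> k) * x ^ k) :: 'a) sums of_real (bessel_entire \<nu> x)"
    unfolding bessel_entire_def by (intro sums_of_real summable_sums summable_bessel_entire assms)
  then show ?thesis
    unfolding bessel_entire_def[of _ "of_real x"] by (simp add: sums_iff)
qed

lemma bessel_entire_cnj:
  assumes "- 1 / 2 < \<nu>"
  shows "bessel_entire \<nu> (cnj w) = cnj (bessel_entire \<nu> w)"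
proof -
  have "(\<lambda>k. cnj (of_real (bessel_coeff \<nu> k) * w ^ k)) sums cnj (bessel_entire \<nu> w)"
    unfolding sums_cnj bessel_entire_def using summable_bessel_entire[OF assms] by (rule summable_sums)
  then show ?thesis
    unfolding bessel_entire_def[of _ "cnj w"] by (simp add: sums_iff)
qed

lemma bessel_coeff_Suc:
  assumes "- 1 / 2 < \<nu>"
  shows "real (Suc k) * bessel_coeff \<nu> (Suc k) = - (1 / (4 * (\<nu> + 1))) * bessel_coeff (\<nu> + 1) k"
proof -
  have "pochhammer (\<nu> + 1) (Suc k) = (\<nu> + 1) * pochhammer (\<nu> + 1 + 1) k"
    by (rule pochhammer_rec)
  moreover have "0 < pochhammer (\<nu> + 1 + 1) k" using assms by (intro pochhammer_pos) auto
  ultimately show ?thesis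
    using assms by (simp add: bessel_coeff_def divide_simps)
qed

text \<open>The classical rule that x^(-\<nu>) J_\<nu> has derivative -x^(-\<nu>) J_(\<nu>+1),
  written in the variable w = x^2.\<close>

lemma has_field_derivative_bessel_entire:
  fixes w :: "'a::{real_normed_field,banach}"
  assumes "- 1 / 2 < \<nu>"
  shows "(bessel_entire \<nu> has_field_derivative - of_real (1 / (4 * (\<nu> + 1))) * bessel_entire (\<nu> + 1) w) (at w within A)"
proof -
  let ?c = "\<lambda>k. of_real (bessel_coeff \<nu> k) :: 'a"
  have "((\<lambda>x. \<Sum>n. ?c n * x ^ n) has_field_derivative (\<Sum>n. diffs ?c n * w ^ n)) (at w)"
    by (rule termdiffs_strong_converges_everywhere) (rule summable_bessel_entire[OF assms])
  moreover have "diffs ?c n = - of_real (1 / (4 * (\<nu> + 1))) * of_real (bessel_coeff (\<nu> + 1) n)" for n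
  proof -
    have "diffs ?c n = of_real (real (Suc n) * bessel_coeff \<nu> (Suc n))"
      by (simp add: diffs_def)
    then show ?thesis unfolding bessel_coeff_Suc[OF assms] by simp
  qed
  ultimately show ?thesis
    using summable_bessel_entire[of "\<nu> + 1" w] assms
    by (simp add: bessel_entire_def[abs_def] mult.assoc suminf_mult suminf_minus has_field_derivative_at_within
             del: of_real_divide)
qed

text \<open>The three-term recurrence J_\<nu>(x) + J_(\<nu>+2)(x) = (2 (\<nu> + 1) / x)
  J_(\<nu>+1)(x) after removal of the powers of x, proved by comparing coefficients.\<close>

lemma bessel_entire_recurrence:
  fixes w :: "'a::{real_normed_field,banach}"
  assumes "- 1 / 2 < \<nu>"
  shows "bessel_entire \<nu> w
    = bessel_entire (\<nu> + 1) w - of_real (1 / (4 * (\<nu> + 1) * (\<nu> + 2))) * w * bessel_entire (\<nu> + 2) w"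
proof -
  define q where "q = 1 / (4 * (\<nu> + 1) * (\<nu> + 2))"
  have coeff: "bessel_coeff (\<nu> + 1) (Suc k) - bessel_coeff \<nu> (Suc k) = q * bessel_coeff (\<nu> + 2) k" for k
  proof -
    have p: "0 < pochhammer (\<nu> + 3) k" using assms by (intro pochhammer_pos) auto
    have 1: "pochhammer (\<nu> + 2) (Suc k) = (\<nu> + 2) * pochhammer (\<nu> + 3) k"
      using pochhammer_rec[of "\<nu> + 2" k] by (simp add: add.assoc)
    have 2: "pochhammer (\<nu> + 1) (Suc k) * (\<nu> + 2 + real k) = (\<nu> + 1) * pochhammer (\<nu> + 2) (Suc k)"
      using pochhammer_rec[of "\<nu> + 1" "Suc k"] pochhammer_Suc[of "\<nu> + 1" "Suc k"]
      by (simp add: algebra_simps)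
    have n: "\<nu> + 1 \<noteq> 0" "\<nu> + 2 \<noteq> 0" "\<nu> + 2 + real k \<noteq> 0" using assms by auto
    have "0 < pochhammer (\<nu> + 1) (Suc k)" using assms by (intro pochhammer_pos) auto
    then have 3: "1 / pochhammer (\<nu> + 1) (Suc k) = (\<nu> + 2 + real k) / ((\<nu> + 1) * ((\<nu> + 2) * pochhammer (\<nu> + 3) k))"
      using 2 n p unfolding 1 by (simp add: divide_simps mult.commute)
    define A where "A = (-1) ^ k / (4 ^ k * fact k :: real)"
    have A: "(-1) ^ Suc k / (4 ^ Suc k * fact (Suc k) :: real) = - A / (4 * (real k + 1))"
      by (simp add: A_def divide_simps)
    have "bessel_coeff (\<nu> + 1) (Suc k) = - A / (4 * (real k + 1)) * (1 / ((\<nu> + 2) * pochhammer (\<nu> + 3) k))"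
      unfolding bessel_coeff_def A[symmetric] 1[symmetric] by (simp add: add.assoc)
    moreover have "bessel_coeff \<nu> (Suc k)
        = - A / (4 * (real k + 1)) * ((\<nu> + 2 + real k) / ((\<nu> + 1) * ((\<nu> + 2) * pochhammer (\<nu> + 3) k)))"
      unfolding bessel_coeff_def A[symmetric] 3[symmetric] by simp
    moreover have "q * bessel_coeff (\<nu> + 2) k = A / (4 * (\<nu> + 1) * (\<nu> + 2) * pochhammer (\<nu> + 3) k)"
      by (simp add: q_def bessel_coeff_def A_def add.assoc)
    moreover have "- A / (4 * (real k + 1)) * (1 / ((\<nu> + 2) * P))
         - (- A / (4 * (real k + 1)) * ((\<nu> + 2 + real k) / ((\<nu> + 1) * ((\<nu> + 2) * P))))
         = A / (4 * (\<nu> + 1) * (\<nu> + 2) * P)" if "P > 0" for P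
    proof -
      have "real k + 1 \<noteq> 0" using of_nat_0_le_iff[of k, where 'a=real] by linarith
      then show ?thesis using n(1,2) that
        by (simp add: divide_simps) (simp add: algebra_simps)
    qed
    ultimately show ?thesis using p by metis
  qed
  have s: "summable (\<lambda>k. of_real (bessel_coeff (\<nu> + 1) k) * w ^ k)"
      "summable (\<lambda>k. of_real (bessel_coeff \<nu> k) * w ^ k)"
      "summable (\<lambda>k. of_real (bessel_coeff (\<nu> + 2) k) * w ^ k)"
    using assms by (auto intro!: summable_bessel_entire)
  define d where "d k = of_real (bessel_coeff (\<nu> + 1) k) * w ^ k - of_real (bessel_coeff \<nu> k) * w ^ k" for k
  have sd: "summable d" unfolding d_def using s by (intro summable_diff)
  have "bessel_entire (\<nu> + 1) w - bessel_entire \<nu> w = suminf d"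
    unfolding bessel_entire_def d_def using s by (intro suminf_diff)
  \<comment> \<open>Both constant terms are 1 and cancel, which frees the factor w.\<close>
  also have "\<dots> = (\<Sum>k. d (Suc k))"
    using suminf_split_head[OF sd] by (simp add: d_def bessel_coeff_def)
  also have "(\<lambda>k. d (Suc k)) = (\<lambda>k. (of_real q * w) * (of_real (bessel_coeff (\<nu> + 2) k) * w ^ k))"
  proof
    fix k
    have "d (Suc k) = of_real (bessel_coeff (\<nu> + 1) (Suc k) - bessel_coeff \<nu> (Suc k)) * (w * w ^ k)"
      by (simp add: d_def algebra_simps)
    then show "d (Suc k) = (of_real q * w) * (of_real (bessel_coeff (\<nu> + 2) k) * w ^ k)"
      unfolding coeff by simp
  qed
  also have "suminf \<dots> = (of_real q * w) * bessel_entire (\<nu> + 2) w"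
    unfolding bessel_entire_def by (rule suminf_mult[OF s(3)])
  finally show ?thesis by (simp add: q_def algebra_simps)
qed

text \<open>Since the Pochhammer symbol is at least (\<nu> + n + 1)^k, the series without its
  constant term is dominated by exp (norm w / (\<nu> + n + 1)) - 1.\<close>

lemma bessel_entire_shift_tendsto_1:
  fixes w :: "'a::{real_normed_field,banach}"
  assumes "- 1 / 2 < \<nu>"
  shows "(\<lambda>n. bessel_entire (\<nu> + real n) w) \<longlonglongrightarrow> 1"
proof -
  have le: "norm (bessel_entire (\<nu> + real n) w - 1) \<le> exp (norm w / (\<nu> + real n + 1)) - 1" for n
  proof -
    define \<mu> where "\<mu> = \<nu> + real n"
    have \<mu>: "- 1 / 2 < \<mu>" using assms by (simp add: \<mu>_def)
    let ?x = "norm w / (\<mu> + 1)"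
    have t: "norm (of_real (bessel_coeff \<mu> k) * w ^ k) \<le> ?x ^ k /\<^sub>R fact k" for k
    proof -
      have "(\<mu> + 1) ^ k \<le> pochhammer (\<mu> + 1) k"
      proof (induction k)
        case (Suc k)
        have "(\<mu> + 1) ^ k * (\<mu> + 1) \<le> pochhammer (\<mu> + 1) k * (\<mu> + 1 + real k)"
          using Suc \<mu> by (intro mult_mono) (auto intro!: pochhammer_nonneg)
        then show ?case by (simp add: pochhammer_Suc mult.commute)
      qed simp
      moreover have "(1::real) \<le> 4 ^ k" by simp
      ultimately have "1 * fact k * (\<mu> + 1) ^ k \<le> 4 ^ k * fact k * pochhammer (\<mu> + 1) k"
        using \<mu> by (intro mult_mono) auto
      then have "1 / (4 ^ k * fact k * pochhammer (\<mu> + 1) k) \<le> 1 / (fact k * (\<mu> + 1) ^ k)"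
        using \<mu> by (intro divide_left_mono) (auto intro!: mult_pos_pos pochhammer_pos)
      moreover have "\<bar>bessel_coeff \<mu> k\<bar> = 1 / (4 ^ k * fact k * pochhammer (\<mu> + 1) k)"
        using \<mu> pochhammer_pos[of "\<mu> + 1" k] by (simp add: bessel_coeff_def abs_mult power_abs)
      ultimately have "\<bar>bessel_coeff \<mu> k\<bar> * norm w ^ k \<le> 1 / (fact k * (\<mu> + 1) ^ k) * norm w ^ k"
        by (intro mult_right_mono) auto
      then show ?thesis by (simp add: norm_mult norm_power power_divide divide_inverse power_mult_distrib power_inverse mult_ac)
    qed
    have s: "summable (\<lambda>k. of_real (bessel_coeff \<mu> k) * w ^ k)" by (rule summable_bessel_entire[OF \<mu>])
    have "bessel_entire \<mu> w - 1 = (\<Sum>k. of_real (bessel_coeff \<mu> (Suc k)) * w ^ Suc k)"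
      unfolding bessel_entire_def using suminf_split_head[OF s] by (simp add: bessel_coeff_def)
    also have "norm \<dots> \<le> (\<Sum>k. ?x ^ Suc k /\<^sub>R fact (Suc k))"
      by (rule norm_suminf_le[OF t]) (simp only: summable_Suc_iff[of "\<lambda>k. ?x ^ k /\<^sub>R fact k"] summable_exp_generic)
    also have "\<dots> = exp ?x - 1"
      unfolding exp_def using suminf_split_head[OF summable_exp_generic[of ?x]] by simp
    finally show ?thesis by (simp add: \<mu>_def)
  qed
  have "(\<lambda>n. exp (norm w / (\<nu> + real n + 1)) - 1) \<longlonglongrightarrow> 0"
    by real_asymp
  then have "(\<lambda>n. bessel_entire (\<nu> + real n) w - 1) \<longlonglongrightarrow> 0"
    by (rule Lim_null_comparison[OF always_eventually[OF allI[OF le]]])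
  then show ?thesis by (simp add: LIM_zero_iff)
qed

text \<open>By the recurrence a common zero would be a zero for all orders \<open>\<nu> + n\<close>, while the values tend to \<open>1\<close>.\<close>

lemma bessel_entire_no_common_zero:
  fixes w :: "'a::{real_normed_field,banach}"
  assumes \<nu>: "- 1 / 2 < \<nu>" and 0: "bessel_entire \<nu> w = 0"
  shows "bessel_entire (\<nu> + 1) w \<noteq> 0"
proof
  assume 1: "bessel_entire (\<nu> + 1) w = 0"
  have w: "w \<noteq> 0" using 0 by auto
  have "bessel_entire (\<nu> + real n) w = 0 \<and> bessel_entire (\<nu> + real n + 1) w = 0" for n
  proof (induction n)
    case (Suc n)
    define \<mu> where "\<mu> = \<nu> + real n"
    have \<mu>: "- 1 / 2 < \<mu>" using \<nu> by (simp add: \<mu>_def)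
    have "\<mu> + 1 \<noteq> 0" "\<mu> + 2 \<noteq> 0" using \<mu> by auto
    then have "of_real (1 / (4 * (\<mu> + 1) * (\<mu> + 2))) \<noteq> (0::'a)"
      by (simp only: of_real_eq_0_iff) simp
    moreover have "bessel_entire \<mu> w = 0" "bessel_entire (\<mu> + 1) w = 0"
      using Suc by (auto simp: \<mu>_def)
    ultimately have "bessel_entire (\<mu> + 2) w = 0"
      using bessel_entire_recurrence[OF \<mu>, of w] w by (simp del: of_real_divide)
    moreover have "\<mu> + 1 = \<nu> + real (Suc n)" "\<mu> + 2 = \<nu> + real (Suc n) + 1" by (auto simp: \<mu>_def)
    ultimately show ?case using \<open>bessel_entire (\<mu> + 1) w = 0\<close> by (simp only:)
  qed (use 0 1 in auto)
  then have "(\<lambda>n. bessel_entire (\<nu> + real n) w) = (\<lambda>n. 0)" by auto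
  with bessel_entire_shift_tendsto_1[OF \<nu>, of w] show False
    by (simp add: LIMSEQ_const_iff)
qed

lemma bessel_J_eq_bessel_entire:
  assumes \<nu>: "- 1 / 2 < \<nu>" and x: "0 < x"
  shows "bessel_J \<nu> x = (x / 2) powr \<nu> / Gamma (\<nu> + 1) * bessel_entire \<nu> (x\<^sup>2)"
proof -
  have "(-1) ^ k / (fact k * Gamma (real k + \<nu> + 1)) * (x / 2) powr (2 * real k + \<nu>)
      = (x / 2) powr \<nu> / Gamma (\<nu> + 1) * (of_real (bessel_coeff \<nu> k) * (x\<^sup>2) ^ k)" for k
  proof -
    have nz: "\<nu> + 1 \<notin> \<int>\<^sub>\<le>\<^sub>0" using \<nu> by (auto elim!: nonpos_Ints_cases)
    have Gp: "0 < Gamma (\<nu> + 1)" using \<nu> by (intro Gamma_real_pos) auto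
    have G: "Gamma (real k + \<nu> + 1) = pochhammer (\<nu> + 1) k * Gamma (\<nu> + 1)"
      using pochhammer_Gamma[OF nz, of k] Gp by (simp add: add_ac)
    have "(x / 2) powr (2 * real k + \<nu>) = (x / 2) ^ (2 * k) * (x / 2) powr \<nu>"
      using x powr_realpow[of "x / 2" "2 * k"] by (simp add: powr_add)
    also have "(x / 2) ^ (2 * k) = (x\<^sup>2) ^ k / 4 ^ k"
      by (simp add: power_mult power_divide)
    finally show ?thesis unfolding G bessel_coeff_def by (simp only:) (simp add: field_simps)
  qed
  then have "bessel_J \<nu> x = (\<Sum>k. (x / 2) powr \<nu> / Gamma (\<nu> + 1) * (of_real (bessel_coeff \<nu> k) * (x\<^sup>2) ^ k))"
    unfolding bessel_J_def by (simp only:)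
  also have "\<dots> = (x / 2) powr \<nu> / Gamma (\<nu> + 1) * bessel_entire \<nu> (x\<^sup>2)"
    unfolding bessel_entire_def by (rule suminf_mult[OF summable_bessel_entire[OF \<nu>]])
  finally show ?thesis .
qed

section \<open>Product formula for entire functions of order 1/2 with positive simple zeros\<close>

text \<open>A real part below A means that L w is closer to 0 than to 2 * A, so L / (2 A - L) maps
  the disc into the unit disc and fixes 0; Schwarz's lemma bounds it and the estimate is solved for
  L.\<close>

lemma Borel_Caratheodory:
  fixes L :: "complex \<Rightarrow> complex"
  assumes hol: "L holomorphic_on ball 0 R" and L0: "L 0 = 0"
    and re: "\<And>w. norm w < R \<Longrightarrow> Re (L w) < A" and w: "norm w < R"
  shows "norm (L w) \<le> 2 * A * norm w / (R - norm w)"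
proof -
  have R: "0 < R" using w norm_ge_zero[of w] by linarith
  have A: "0 < A" using re[of 0] R L0 by simp
  have lt: "norm (L z) < norm (of_real (2 * A) - L z)" if "norm z < R" for z
  proof -
    have "0 < 4 * A * (A - Re (L z))" using re[OF that] A by simp
    then have "(norm (L z))\<^sup>2 < (norm (of_real (2 * A) - L z))\<^sup>2"
      unfolding cmod_power2 by (simp add: power2_eq_square algebra_simps)
    then show ?thesis by (rule power2_less_imp_less) simp
  qed
  have nz: "of_real (2 * A) - L z \<noteq> 0" if "norm z < R" for z
    using lt[OF that] by (metis less_le_not_le norm_ge_zero norm_zero)
  define \<phi> where "\<phi> z = L (of_real R * z) / (of_real (2 * A) - L (of_real R * z))" for z
  have in_ball: "norm (of_real R * z) < R" if "norm z < 1" for z :: complex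
    using that R by (simp add: norm_mult)
  have hol': "(\<lambda>z. L (of_real R * z)) holomorphic_on ball 0 1"
  proof -
    have "(L \<circ> (\<lambda>z. of_real R * z)) holomorphic_on ball 0 1"
    proof (rule holomorphic_on_compose_gen[OF _ hol])
      show "(\<lambda>z::complex. of_real R * z) ` ball 0 1 \<subseteq> ball 0 R"
      proof (rule image_subsetI)
        fix z :: complex assume "z \<in> ball 0 1"
        then show "of_real R * z \<in> ball 0 R" using in_ball[of z] by simp
      qed
    qed (intro holomorphic_intros)
    then show ?thesis by (simp add: o_def)
  qed
  have "\<phi> holomorphic_on ball 0 1"
    unfolding \<phi>_def[abs_def] by (intro holomorphic_intros hol') (use nz in_ball in auto)
  moreover have "\<phi> 0 = 0" by (simp add: \<phi>_def L0)
  moreover have "norm (\<phi> z) < 1" if "norm z < 1" for z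
    using lt[OF in_ball[OF that]] nz[OF in_ball[OF that]] by (simp add: \<phi>_def norm_divide divide_less_eq)
  moreover have "norm (w / of_real R) < 1" using w R by (simp add: norm_divide)
  ultimately have "norm (\<phi> (w / of_real R)) \<le> norm (w / of_real R)"
    by (rule Schwarz_Lemma(1))
  then have "norm (L w) / norm (of_real (2 * A) - L w) \<le> norm w / R"
    using R by (simp add: \<phi>_def norm_divide)
  then have "R * norm (L w) \<le> norm w * norm (of_real (2 * A) - L w)"
    using R nz[OF w] by (simp add: field_simps)
  also have "\<dots> \<le> norm w * (2 * A + norm (L w))"
    using norm_triangle_ineq4[of "of_real (2 * A)" "L w"] A by (intro mult_left_mono) auto
  finally have "norm (L w) * (R - norm w) \<le> 2 * A * norm w"
    by (simp add: algebra_simps)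
  then show ?thesis using w by (simp add: pos_le_divide_eq)
qed

text \<open>The difference quotient extends over its removable singularity. The factor is normalised
  as 1 - w / c so that values at 0 are preserved.\<close>

lemma entire_factor_zero:
  fixes h :: "complex \<Rightarrow> complex"
  assumes hol: "h holomorphic_on UNIV" and c: "h c = 0" "c \<noteq> 0"
  obtains g where "g holomorphic_on UNIV" "\<And>w. h w = (1 - w / c) * g w"
proof
  let ?F = "\<lambda>z. if z = c then deriv h c else (h z - h c) / (z - c)"
  show "(\<lambda>z. - c * ?F z) holomorphic_on UNIV"
    using pole_lemma[OF hol, of c] by (intro holomorphic_intros) auto
  show "h w = (1 - w / c) * (- c * ?F w)" for w
    using c by (cases "w = c") (auto simp: divide_simps, simp add: algebra_simps)
qed

text \<open>The properties of \<open>bessel_entire \<nu>\<close> that the product formula rests on.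
  Simplicity of the zeros lets a strictly increasing enumeration stand for the zeros with
  multiplicity.\<close>

locale entire_positive_zeros =
  fixes f :: "complex \<Rightarrow> complex" and a :: "nat \<Rightarrow> real"
  assumes hol: "f holomorphic_on UNIV" and f0: "f 0 = 1"
    and growth: "\<And>w. norm (f w) \<le> exp (sqrt (norm w))"
    and zeros: "\<And>w. f w = 0 \<longleftrightarrow> (\<exists>k. w = of_real (a k))"
    and simple: "\<And>k. deriv f (of_real (a k)) \<noteq> 0"
    and mono: "strict_mono a" and pos: "\<And>k. 0 < a k"
begin

text \<open>A bounded sequence would put infinitely many zeros into a compact disc.\<close>

lemma zeros_at_top: "filterlim a at_top sequentially"
proof (rule ccontr)
  assume n: "\<not> filterlim a at_top sequentially"
  have "\<exists>C. \<forall>k. a k \<le> C"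
  proof (rule ccontr)
    assume "\<nexists>C. \<forall>k. a k \<le> C"
    then have "\<exists>k. C \<le> a k" for C by (meson linear)
    then have "\<forall>\<^sub>F k in sequentially. C \<le> a k" for C
      using strict_mono_leD[OF mono] unfolding eventually_sequentially by (meson order_trans)
    then show False using n unfolding filterlim_at_top by blast
  qed
  then obtain C where C: "\<And>k. a k \<le> C" by blast
  have "finite {z\<in>cball 0 C. f z = 0}"
  proof (rule holomorphic_compact_finite_zeros[OF hol])
    show "\<not> f constant_on UNIV"
      using f0 zeros[of "of_real (a 0)"] unfolding constant_on_def by (metis UNIV_I zero_neq_one)
  qed auto
  moreover have "(\<lambda>k. of_real (a k)) ` UNIV \<subseteq> {z\<in>cball 0 C. f z = 0}"
    using C pos zeros by (auto simp: less_imp_le)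
  moreover have "inj (\<lambda>k. complex_of_real (a k))"
    using strict_mono_eq[OF mono] by (auto simp: inj_on_def)
  ultimately show False by (meson finite_imageD finite_subset infinite_UNIV_nat)
qed

lemma ex_cofactor: "\<exists>g. g holomorphic_on UNIV \<and> (\<forall>w. f w = (\<Prod>k<n. 1 - w / of_real (a k)) * g w)"
proof (induction n)
  case (Suc n)
  then obtain g where g: "g holomorphic_on UNIV" "\<And>w. f w = (\<Prod>k<n. 1 - w / of_real (a k)) * g w" by blast
  have "(\<Prod>k<n. 1 - of_real (a n) / of_real (a k)) \<noteq> (0::complex)"
  proof -
    have "complex_of_real (a n) / of_real (a k) \<noteq> 1" if "k < n" for k
      using strict_mono_less[OF mono, of k n] that pos[of k] by (simp add: divide_eq_1_iff)
    then show ?thesis by auto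
  qed
  moreover have "f (of_real (a n)) = 0" using zeros by blast
  ultimately have "g (of_real (a n)) = 0" using g(2)[of "of_real (a n)"] by auto
  moreover have "complex_of_real (a n) \<noteq> 0" using pos[of n] by simp
  ultimately obtain h where "h holomorphic_on UNIV" "\<And>w. g w = (1 - w / of_real (a n)) * h w"
    using entire_factor_zero[OF g(1)] by metis
  then show ?case using g(2) by (auto simp: mult.assoc)
qed (use hol in auto)

text \<open>The quotient of f by its first n zero factors; the product formula is the statement that
  these quotients tend to 1.\<close>

definition cofactor :: "nat \<Rightarrow> complex \<Rightarrow> complex" where
  "cofactor n = (SOME g. g holomorphic_on UNIV \<and> (\<forall>w. f w = (\<Prod>k<n. 1 - w / of_real (a k)) * g w))"

lemma cofactor:
  shows "cofactor n holomorphic_on UNIV" "f w = (\<Prod>k<n. 1 - w / of_real (a k)) * cofactor n w"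
proof -
  have c: "cofactor n holomorphic_on UNIV \<and> (\<forall>w. f w = (\<Prod>k<n. 1 - w / of_real (a k)) * cofactor n w)"
    unfolding cofactor_def by (rule someI_ex[OF ex_cofactor])
  from c show "cofactor n holomorphic_on UNIV" ..
  from c show "f w = (\<Prod>k<n. 1 - w / of_real (a k)) * cofactor n w" by blast
qed

text \<open>In the product rule only the term that differentiates the vanishing factor survives. The
  formula serves twice: for the nonvanishing of the cofactor at the removed zeros, and with j = 0
  for the value of the product at the first zero.\<close>

lemma deriv_at_zero:
  assumes "j < n"
  shows "deriv f (of_real (a j)) = - (1 / of_real (a j)) * (\<Prod>k\<in>{..<n} - {j}. 1 - of_real (a j) / of_real (a k)) * cofactor n (of_real (a j))"
proof -
  define h where "h w = (\<Prod>k\<in>{..<n} - {j}. 1 - w / of_real (a k)) * cofactor n w" for w :: complex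
  have "h holomorphic_on UNIV"
    unfolding h_def[abs_def] using pos by (intro holomorphic_intros cofactor) (auto simp: less_le)
  then have h: "(h has_field_derivative deriv h w) (at w)" for w
    using holomorphic_derivI open_UNIV by blast
  have f: "f = (\<lambda>w. (1 - w / of_real (a j)) * h w)"
  proof (rule ext)
    fix w :: complex
    have "(\<Prod>k<n. 1 - w / of_real (a k)) = (1 - w / of_real (a j)) * (\<Prod>k\<in>{..<n} - {j}. 1 - w / of_real (a k))"
      using assms by (intro prod.remove) auto
    then show "f w = (1 - w / of_real (a j)) * h w"
      unfolding h_def using cofactor(2)[of w n] by (simp only: mult.assoc)
  qed
  have "(f has_field_derivative - (1 / of_real (a j)) * h (of_real (a j))) (at (of_real (a j)))"
    unfolding f using h pos[of j] by (auto intro!: derivative_eq_intros simp: less_le)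
  then show ?thesis unfolding h_def by (simp add: DERIV_imp_deriv mult.assoc)
qed

text \<open>A zero of the cofactor is a zero \<open>a j\<close> of f with j < n, and f would vanish
  there to second order, against \<open>simple\<close>.\<close>

lemma cofactor_nonzero:
  assumes "norm w < a n"
  shows "cofactor n w \<noteq> 0"
proof
  assume 0: "cofactor n w = 0"
  then have "f w = 0" using cofactor(2)[of w n] by simp
  then obtain j where j: "w = of_real (a j)" using zeros by blast
  have "a j < a n" using assms pos[of j] by (simp add: j)
  then have "j < n" using strict_mono_less[OF mono] by blast
  from deriv_at_zero[OF this] simple[of j] 0 show False by (simp add: j)
qed

text \<open>On the circle of radius 2 * a n every removed factor has modulus at least 2 - 1 = 1, so
  there the cofactor is no larger than f; the maximum principle carries the bound inside.\<close>

lemma cofactor_le: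
  assumes "norm w \<le> 2 * a n"
  shows "norm (cofactor n w) \<le> exp (sqrt (2 * a n))"
proof (rule maximum_modulus_frontier[of "cofactor n" "cball 0 (2 * a n)"])
  show "cofactor n holomorphic_on interior (cball 0 (2 * a n))" "continuous_on (closure (cball 0 (2 * a n))) (cofactor n)"
    using cofactor(1) by (auto intro: holomorphic_on_subset holomorphic_on_imp_continuous_on)
  show "norm (cofactor n z) \<le> exp (sqrt (2 * a n))" if "z \<in> frontier (cball 0 (2 * a n))" for z
  proof -
    have z: "norm z = 2 * a n" using that pos[of n] by (simp add: frontier_cball dist_norm)
    have "1 \<le> (\<Prod>k<n. norm (1 - z / of_real (a k)))"
    proof (rule prod_ge_1)
      fix k assume "k \<in> {..<n}"
      then have "a k < a n" using strict_mono_less[OF mono] by auto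
      then have "2 \<le> norm (z / of_real (a k))"
        using pos[of k] z by (simp add: norm_divide pos_le_divide_eq)
      then show "1 \<le> norm (1 - z / of_real (a k))"
        using norm_triangle_ineq2[of "z / of_real (a k)" 1] by (simp add: norm_minus_commute)
    qed
    then have "norm (cofactor n z) \<le> (\<Prod>k<n. norm (1 - z / of_real (a k))) * norm (cofactor n z)"
      using mult_right_mono[of 1 _ "norm (cofactor n z)"] by simp
    also have "\<dots> = norm (f z)" by (subst cofactor(2)[of z n]) (simp add: norm_mult prod_norm)
    also have "\<dots> \<le> exp (sqrt (norm z))" by (rule growth)
    finally show ?thesis by (simp add: z)
  qed
qed (use assms in auto)

lemma cofactor_0: "cofactor n 0 = 1"
  using cofactor(2)[of 0 n] f0 by simp

text \<open>The logarithm of the cofactor is bounded above by \<open>O(a\<^sub>n\<^sup>1\<^sup>/\<^sup>2)\<close> on the disc of radius \<open>a\<^sub>n\<close>,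
  so it tends to \<open>0\<close> locally uniformly.\<close>

lemma ex_log_cofactor:
  obtains L where "L holomorphic_on ball 0 (a n)" "L 0 = 0" "\<And>w. norm w < a n \<Longrightarrow> cofactor n w = exp (L w)"
    "\<And>w. norm w < a n \<Longrightarrow> norm (L w) \<le> 2 * (sqrt (2 * a n) + 1) * norm w / (a n - norm w)"
proof -
  have hol_ball: "cofactor n holomorphic_on ball 0 (a n)"
    using cofactor(1) by (rule holomorphic_on_subset) auto
  obtain g where g: "g holomorphic_on ball 0 (a n)" "\<And>w. w \<in> ball 0 (a n) \<Longrightarrow> exp (g w) = cofactor n w"
    by (rule holomorphic_logarithm_exists[OF convex_ball open_ball hol_ball, of 0])
       (use cofactor_nonzero pos[of n] in auto)
  define L where "L w = g w - g 0" for w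
  have L: "L holomorphic_on ball 0 (a n)" "L 0 = 0"
    unfolding L_def[abs_def] by (auto intro!: holomorphic_intros g)
  have eg0: "exp (g 0) = 1" using g(2)[of 0] cofactor_0[of n] pos[of n] by simp
  have e: "cofactor n w = exp (L w)" if "norm w < a n" for w
    using g(2)[of w] that eg0 by (simp add: L_def exp_diff)
  \<comment> \<open>The summand 1 turns the weak bound on the modulus into the strict one that
    \<open>Borel_Caratheodory\<close> asks for.\<close>
  have "Re (L w) < sqrt (2 * a n) + 1" if "norm w < a n" for w
  proof -
    have "exp (Re (L w)) \<le> exp (sqrt (2 * a n))"
      using cofactor_le[of w n] e[OF that] that pos[of n] by (simp add: norm_exp_eq_Re)
    then show ?thesis by simp
  qed
  then show ?thesis
    using that[OF L e] Borel_Caratheodory[OF L] by blast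
qed

lemma cofactor_tendsto_1: "(\<lambda>n. cofactor n w) \<longlonglongrightarrow> 1"
proof -
  have "\<exists>L. \<forall>n. norm w < a n \<longrightarrow> cofactor n w = exp (L n) \<and> norm (L n) \<le> 2 * (sqrt (2 * a n) + 1) * norm w / (a n - norm w)"
    by (rule choice) (metis ex_log_cofactor)
  then obtain L where L: "\<And>n. norm w < a n \<Longrightarrow> cofactor n w = exp (L n)"
    "\<And>n. norm w < a n \<Longrightarrow> norm (L n) \<le> 2 * (sqrt (2 * a n) + 1) * norm w / (a n - norm w)" by blast
  have ev: "\<forall>\<^sub>F n in sequentially. norm w < a n"
    using zeros_at_top unfolding filterlim_at_top_dense by blast
  have "((\<lambda>x. 2 * (sqrt (2 * x) + 1) * norm w / (x - norm w)) \<longlongrightarrow> 0) at_top"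
    by real_asymp
  from filterlim_compose[OF this zeros_at_top]
  have "(\<lambda>n. 2 * (sqrt (2 * a n) + 1) * norm w / (a n - norm w)) \<longlonglongrightarrow> 0" .
  then have "L \<longlonglongrightarrow> 0"
    by (rule Lim_null_comparison[rotated]) (use ev L(2) in \<open>auto elim!: eventually_mono\<close>)
  then have "(\<lambda>n. exp (L n)) \<longlonglongrightarrow> exp 0" by (rule tendsto_exp)
  then have "(\<lambda>n. exp (L n)) \<longlonglongrightarrow> 1" by simp
  moreover have "\<forall>\<^sub>F n in sequentially. exp (L n) = cofactor n w"
    using ev by eventually_elim (simp add: L(1))
  ultimately show ?thesis by (rule Lim_transform_eventually)
qed

text \<open>As the cofactor is 1 at 0, its derivative there equals that of its logarithm, and
  Cauchy's estimate on the unit circle applies to the latter.\<close>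

lemma deriv_cofactor_tendsto_0: "(\<lambda>n. deriv (cofactor n) 0) \<longlonglongrightarrow> 0"
proof (rule Lim_null_comparison)
  have "\<forall>\<^sub>F n in sequentially. 1 < a n"
    using zeros_at_top unfolding filterlim_at_top_dense by blast
  then show "\<forall>\<^sub>F n in sequentially. norm (deriv (cofactor n) 0) \<le> 2 * (sqrt (2 * a n) + 1) / (a n - 1)"
  proof eventually_elim
    case (elim n)
    obtain L where L: "L holomorphic_on ball 0 (a n)" "L 0 = 0" "\<And>w. norm w < a n \<Longrightarrow> cofactor n w = exp (L w)"
      "\<And>w. norm w < a n \<Longrightarrow> norm (L w) \<le> 2 * (sqrt (2 * a n) + 1) * norm w / (a n - norm w)"
      using ex_log_cofactor[of n] by metis
    have "(L has_field_derivative deriv L 0) (at 0)"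
      using holomorphic_derivI[OF L(1) open_ball] pos[of n] by simp
    then have "((\<lambda>w. exp (L w)) has_field_derivative exp (L 0) * deriv L 0) (at 0)"
      by (rule DERIV_chain2[OF DERIV_exp])
    then have "(cofactor n has_field_derivative exp (L 0) * deriv L 0) (at 0)"
      by (rule has_field_derivative_transform_within_open[OF _ open_ball[of 0 "a n"]])
         (use pos[of n] in \<open>auto simp: L(3)\<close>)
    then have "deriv (cofactor n) 0 = deriv L 0" by (simp add: DERIV_imp_deriv L(2))
    also have "norm (deriv L 0) \<le> 2 * (sqrt (2 * a n) + 1) / (a n - 1)"
    proof -
      have "norm ((deriv ^^ 1) L 0) \<le> fact 1 * (2 * (sqrt (2 * a n) + 1) / (a n - 1)) / 1 ^ 1"
      proof (rule Cauchy_inequality)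
        show "L holomorphic_on ball 0 1" "continuous_on (cball 0 1) L"
          using elim L(1) by (auto intro!: holomorphic_on_imp_continuous_on holomorphic_on_subset[OF L(1)])
        show "norm (L x) \<le> 2 * (sqrt (2 * a n) + 1) / (a n - 1)" if "norm (0 - x) = 1" for x
          using L(4)[of x] that elim by simp
      qed simp
      then show ?thesis by simp
    qed
    finally show ?case .
  qed
  have "((\<lambda>x::real. 2 * (sqrt (2 * x) + 1) / (x - 1)) \<longlongrightarrow> 0) at_top"
    by real_asymp
  from filterlim_compose[OF this zeros_at_top]
  show "(\<lambda>n. 2 * (sqrt (2 * a n) + 1) / (a n - 1)) \<longlonglongrightarrow> 0" .
qed

text \<open>The logarithmic derivative at 0 of finite product times cofactor: deriv f 0 is minus the
  partial sum plus the vanishing term \<open>deriv (cofactor n) 0\<close>.\<close>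

lemma sums_inverse_zeros: "(\<lambda>k. 1 / of_real (a k)) sums (- deriv f 0)"
proof -
  have "deriv f 0 = deriv (cofactor n) 0 - (\<Sum>k<n. 1 / of_real (a k))" for n
  proof -
    have g: "(cofactor n has_field_derivative deriv (cofactor n) 0) (at 0)"
      using holomorphic_derivI[OF cofactor(1) open_UNIV] by blast
    have p: "((\<lambda>w. \<Prod>k<n. 1 - w / of_real (a k)) has_field_derivative - (\<Sum>k<n. 1 / of_real (a k))) (at 0)"
    proof (induction n)
      case (Suc n)
      then show ?case using pos[of n] by (auto intro!: derivative_eq_intros simp: less_le)
    qed auto
    have "((\<lambda>w. (\<Prod>k<n. 1 - w / of_real (a k)) * cofactor n w) has_field_derivative
        deriv (cofactor n) 0 - (\<Sum>k<n. 1 / of_real (a k))) (at 0)"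
      using DERIV_mult[OF p g] by (simp add: cofactor_0)
    moreover have "(\<lambda>w. (\<Prod>k<n. 1 - w / of_real (a k)) * cofactor n w) = f"
      using cofactor(2)[of _ n] by (auto simp: fun_eq_iff)
    ultimately show ?thesis by (simp add: DERIV_imp_deriv)
  qed
  then have "(\<Sum>k<n. 1 / of_real (a k)) = deriv (cofactor n) 0 - deriv f 0" for n
    by (metis add_diff_cancel_left' diff_add_cancel diff_diff_eq2)
  moreover have "(\<lambda>n. deriv (cofactor n) 0 - deriv f 0) \<longlonglongrightarrow> 0 - deriv f 0"
    by (intro tendsto_intros deriv_cofactor_tendsto_0)
  ultimately show ?thesis by (simp add: sums_def)
qed

text \<open>\<open>deriv_at_zero\<close> with j = 0, solved for the product. Removing index 0 from
  \<open>Suc n\<close> factors leaves n of them, and the cofactor in the denominator tends to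
  1.\<close>

lemma product_at_first_zero:
  "(\<lambda>n. \<Prod>k<n. 1 - of_real (a 0) / of_real (a (Suc k))) \<longlonglongrightarrow> - of_real (a 0) * deriv f (of_real (a 0))"
proof -
  have "(\<Prod>k<n. 1 - of_real (a 0) / of_real (a (Suc k)))
      = - of_real (a 0) * deriv f (of_real (a 0)) / cofactor (Suc n) (of_real (a 0))" for n
  proof -
    have "cofactor (Suc n) (of_real (a 0)) \<noteq> 0"
      by (rule cofactor_nonzero) (use pos[of 0] strict_mono_less[OF mono] in auto)
    moreover have "{..<Suc n} - {0} = Suc ` {..<n}"
      by (auto simp: image_iff lessThan_Suc_eq_insert_0)
    then have "(\<Prod>k\<in>{..<Suc n} - {0}. 1 - of_real (a 0) / of_real (a k))
        = (\<Prod>k<n. 1 - of_real (a 0) / complex_of_real (a (Suc k)))"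
      by (simp add: prod.reindex)
    moreover have "complex_of_real (a 0) \<noteq> 0" using pos[of 0] by simp
    moreover have "- A * (- (1 / A) * Q * C) / C = Q" if "A \<noteq> 0" "C \<noteq> 0" for A Q C :: complex
      using that by simp
    ultimately show ?thesis
      using deriv_at_zero[of 0 "Suc n"] by simp
  qed
  moreover have "(\<lambda>n. - of_real (a 0) * deriv f (of_real (a 0)) / cofactor (Suc n) (of_real (a 0)))
      \<longlonglongrightarrow> - of_real (a 0) * deriv f (of_real (a 0)) / 1"
    by (intro tendsto_divide tendsto_const LIMSEQ_Suc[OF cofactor_tendsto_1]) auto
  ultimately show ?thesis by simp
qed

end

section \<open>Green's identity, the zeros and the orthogonal modes\<close>

lemma continuous_on_bessel_entire:
  fixes g :: "'b::topological_space \<Rightarrow> 'a::{real_normed_field,banach}"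
  assumes "- 1 / 2 < \<nu>" "continuous_on A g"
  shows "continuous_on A (\<lambda>x. bessel_entire \<nu> (g x))"
proof -
  have "continuous_on UNIV (bessel_entire \<nu> :: 'a \<Rightarrow> 'a)"
    using has_field_derivative_bessel_entire[OF assms(1)] DERIV_continuous
    by (intro continuous_at_imp_continuous_on ballI) blast
  then show ?thesis
    by (rule continuous_on_compose2[OF _ assms(2)]) auto
qed

lemma has_vector_derivative_bessel_entire_square:
  fixes c :: "'a::{real_normed_field,banach}"
  assumes "- 1 / 2 < \<nu>"
  shows "((\<lambda>r. bessel_entire \<nu> (c * of_real (r\<^sup>2))) has_vector_derivative
     - of_real (r / (2 * (\<nu> + 1))) * c * bessel_entire (\<nu> + 1) (c * of_real (r\<^sup>2))) (at r)"
proof -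
  have "((\<lambda>r. c * of_real (r\<^sup>2)) has_vector_derivative c * of_real (2 * r)) (at r)"
  proof -
    have "((\<lambda>r. r\<^sup>2) has_real_derivative 2 * r) (at r)" by (auto intro!: derivative_eq_intros)
    then show ?thesis
      by (intro has_vector_derivative_mult_right has_vector_derivative_of_real)
  qed
  from field_vector_diff_chain_at[OF this has_field_derivative_bessel_entire[OF assms]]
  have "((\<lambda>r. bessel_entire \<nu> (c * of_real (r\<^sup>2))) has_vector_derivative
      c * of_real (2 * r) * (- of_real (1 / (4 * (\<nu> + 1))) * bessel_entire (\<nu> + 1) (c * of_real (r\<^sup>2)))) (at r)"
    by (simp only: o_def)
  moreover have "of_real (r / (2 * (\<nu> + 1))) = (of_real (2 * r) * of_real (1 / (4 * (\<nu> + 1))) :: 'a)"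
    unfolding of_real_mult[symmetric] by (rule arg_cong[where f=of_real]) (use assms in \<open>simp add: field_simps\<close>)
  ultimately show ?thesis by (simp only: mult_ac mult_minus_right mult_minus_left)
qed

text \<open>The right side is the boundary value of r^(2\<nu>+2) times the functions of order
  \<nu>+1 and \<nu>. Differentiating it produces order \<nu>+2, which the recurrence trades for
  order \<nu>. The general field covers both uses: complex w and its conjugate for the reality of
  the zeros, real parameters for orthogonality.\<close>

lemma bessel_entire_green:
  fixes a b :: "'a::{real_normed_field,banach}"
  assumes \<nu>: "- 1 / 2 < \<nu>" and R: "0 \<le> R"
  defines "\<kappa> \<equiv> \<nu> + 1"
  shows "((\<lambda>r. of_real (2 * \<kappa> * r powr (2 * \<nu> + 1)) * (bessel_entire \<nu> (a * of_real (r\<^sup>2)) * bessel_entire \<nu> (b * of_real (r\<^sup>2)))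
              - of_real (r powr (2 * \<nu> + 3) / (2 * \<kappa>)) * b * (bessel_entire \<kappa> (a * of_real (r\<^sup>2)) * bessel_entire \<kappa> (b * of_real (r\<^sup>2))))
      has_integral of_real (R powr (2 * \<nu> + 2)) * (bessel_entire \<kappa> (a * of_real (R\<^sup>2)) * bessel_entire \<nu> (b * of_real (R\<^sup>2)))) {0..R}"
    (is "(?f has_integral ?I) _")
proof -
  define H where "H r = of_real (r powr (2 * \<nu> + 2)) * (bessel_entire \<kappa> (a * of_real (r\<^sup>2)) * bessel_entire \<nu> (b * of_real (r\<^sup>2)))" for r
  have \<kappa>: "- 1 / 2 < \<kappa>" "0 < \<kappa>" "0 < \<kappa> + 1" using \<nu> by (auto simp: \<kappa>_def)
  \<comment> \<open>Real powers are differentiated only at r > 0, so the version of the fundamental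
    theorem with mere continuity at the end points is taken.\<close>
  have "(?f has_integral H R - H 0) {0..R}"
  proof (rule fundamental_theorem_of_calculus_interior[OF R])
    show "continuous_on {0..R} H"
      unfolding H_def[abs_def]
      by (intro continuous_intros continuous_on_bessel_entire continuous_on_powr' \<kappa> \<nu>) (use \<nu> in auto)
    fix r assume "r \<in> {0<..<R}"
    then have r: "0 < r" by simp
    define p where "p = r powr (2 * \<nu> + 1)"
    define A where "A \<mu> = bessel_entire \<mu> (a * of_real (r\<^sup>2))" for \<mu>
    define B where "B \<mu> = bessel_entire \<mu> (b * of_real (r\<^sup>2))" for \<mu>
    have p2: "r powr (2 * \<nu> + 2) = p * r" and p3: "r powr (2 * \<nu> + 3) = p * r\<^sup>2"
      using r powr_add[of r "2 * \<nu> + 1" 1] powr_add[of r "2 * \<nu> + 1" 2] by (simp_all add: p_def add.commute)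
    have "((\<lambda>r. r powr (2 * \<nu> + 2)) has_real_derivative (2 * \<nu> + 2) * r powr (2 * \<nu> + 2 - 1)) (at r)"
      using r by (rule has_real_derivative_powr)
    then have "((\<lambda>r. r powr (2 * \<nu> + 2)) has_real_derivative 2 * \<kappa> * p) (at r)"
      by (simp add: p_def \<kappa>_def algebra_simps)
    then have dp: "((\<lambda>r. of_real (r powr (2 * \<nu> + 2)) :: 'a) has_vector_derivative of_real (2 * \<kappa> * p)) (at r)"
      by (rule has_vector_derivative_of_real)
    have "(H has_vector_derivative
        of_real (p * r) * (A \<kappa> * (- of_real (r / (2 * \<kappa>)) * b * B \<kappa>) + (- of_real (r / (2 * (\<kappa> + 1))) * a * A (\<kappa> + 1)) * B \<nu>)
        + of_real (2 * \<kappa> * p) * (A \<kappa> * B \<nu>)) (at r)"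
      unfolding H_def[abs_def]
      using has_vector_derivative_mult[OF dp has_vector_derivative_mult[OF
          has_vector_derivative_bessel_entire_square[OF \<kappa>(1), of a] has_vector_derivative_bessel_entire_square[OF \<nu>, of b]]]
      unfolding p2 A_def[symmetric] B_def[symmetric] \<kappa>_def[symmetric] .
    \<comment> \<open>The recurrence, solved for order \<kappa>; it will absorb the term of order
      \<kappa> + 1 in the derivative.\<close>
    moreover have "A \<kappa> = A \<nu> + of_real (1 / (4 * \<kappa> * (\<kappa> + 1))) * (a * of_real (r\<^sup>2)) * A (\<kappa> + 1)"
      using bessel_entire_recurrence[OF \<nu>, of "a * of_real (r\<^sup>2)"] by (simp add: A_def \<kappa>_def add.assoc)
    moreover have "of_real (p * r) * (X * (- of_real (r / (2 * \<kappa>)) * b * Y) + (- of_real (r / (2 * (\<kappa> + 1))) * a * U) * V)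
        + of_real (2 * \<kappa> * p) * (X * V)
      = of_real (2 * \<kappa> * p) * (Z * V) - of_real (p * r\<^sup>2 / (2 * \<kappa>)) * b * (X * Y)"
      if X: "X = Z + of_real (1 / (4 * \<kappa> * (\<kappa> + 1))) * (a * of_real (r\<^sup>2)) * U" for X Y Z U V :: 'a
    proof -
      define k where "k = (of_real \<kappa> :: 'a)"
      define l where "l = (of_real (\<kappa> + 1) :: 'a)"
      have kl: "k \<noteq> 0" "l \<noteq> 0" using \<kappa> by (auto simp: k_def l_def simp del: of_real_add)
      have e: "of_real (r / (2 * \<kappa>)) = of_real r / (2 * k)" "of_real (r / (2 * (\<kappa> + 1))) = of_real r / (2 * l)"
        "of_real (2 * \<kappa> * p) = 2 * k * of_real p" "of_real (p * r\<^sup>2 / (2 * \<kappa>)) = of_real p * (of_real r)\<^sup>2 / (2 * k)"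
        "of_real (1 / (4 * \<kappa> * (\<kappa> + 1))) = 1 / (4 * k * l)"
        by (simp_all add: k_def l_def)
      have X': "X = Z + 1 / (4 * k * l) * (a * (of_real r)\<^sup>2) * U"
        unfolding X e by simp
      have Zz: "Z = X - 1 / (4 * k * l) * (a * (of_real r)\<^sup>2) * U" unfolding X' by simp
      show ?thesis
        unfolding e Zz using kl by (simp add: field_simps power2_eq_square)
    qed
    ultimately have "(H has_vector_derivative of_real (2 * \<kappa> * p) * (A \<nu> * B \<nu>) - of_real (p * r\<^sup>2 / (2 * \<kappa>)) * b * (A \<kappa> * B \<kappa>)) (at r)"
      by metis
    then show "(H has_vector_derivative ?f r) (at r)"
      unfolding p_def[symmetric] A_def[symmetric] B_def[symmetric] p3 .
  qed
  moreover have "H 0 = 0" using \<nu> by (simp add: H_def)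
  ultimately show ?thesis by (simp add: H_def)
qed

text \<open>Green's identity for \<open>w\<close> and \<open>cnj w\<close> writes \<open>cnj w\<close> as a quotient of two norms.\<close>

lemma bessel_entire_zero_positive_real:
  fixes w :: complex
  assumes \<nu>: "- 1 / 2 < \<nu>" and 0: "bessel_entire \<nu> w = 0"
  obtains x where "0 < x" "w = of_real x"
proof -
  define \<kappa> where "\<kappa> = \<nu> + 1"
  have \<kappa>: "- 1 / 2 < \<kappa>" "0 < \<kappa>" using \<nu> by (auto simp: \<kappa>_def)
  define p where "p r = r powr (2 * \<nu> + 1) * (norm (bessel_entire \<nu> (w * of_real (r\<^sup>2))))\<^sup>2" for r
  define q where "q r = r powr (2 * \<nu> + 3) * (norm (bessel_entire \<kappa> (w * of_real (r\<^sup>2))))\<^sup>2" for r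
  have contp: "continuous_on {0..1} p" unfolding p_def[abs_def]
    by (intro continuous_intros continuous_on_bessel_entire continuous_on_powr' \<nu>) (use \<nu> in auto)
  have contq: "continuous_on {0..1} q" unfolding q_def[abs_def]
    by (intro continuous_intros continuous_on_bessel_entire continuous_on_powr' \<kappa>) (use \<nu> in auto)
  define P where "P = integral {0..1} p"
  define Q where "Q = integral {0..1} q"
  have P: "(p has_integral P) {0..1}" and Q: "(q has_integral Q) {0..1}"
    unfolding P_def Q_def using contp contq integrable_continuous_interval by blast+
  have nn: "bessel_entire \<mu> (w * of_real s) * bessel_entire \<mu> (cnj w * of_real s) = of_real ((norm (bessel_entire \<mu> (w * of_real s)))\<^sup>2)"
    if "- 1 / 2 < \<mu>" for \<mu> s
    using bessel_entire_cnj[OF that, of "w * of_real s"] by (simp add: complex_norm_square del: of_real_power)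
  have "((\<lambda>r. of_real (2 * \<kappa>) * of_real (p r) - of_real (1 / (2 * \<kappa>)) * cnj w * of_real (q r)) has_integral
     of_real (2 * \<kappa>) * of_real P - of_real (1 / (2 * \<kappa>)) * cnj w * of_real Q) {0..1}"
    by (intro has_integral_diff has_integral_mult_right has_integral_of_real P Q)
  moreover have "((\<lambda>r. of_real (2 * \<kappa>) * of_real (p r) - of_real (1 / (2 * \<kappa>)) * cnj w * of_real (q r)) has_integral 0) {0..1}"
  proof -
    have c0: "bessel_entire \<nu> (cnj w) = 0" using bessel_entire_cnj[OF \<nu>, of w] 0 by simp
    have "of_real (2 * \<kappa> * r powr (2 * \<nu> + 1)) * (bessel_entire \<nu> (w * of_real (r\<^sup>2)) * bessel_entire \<nu> (cnj w * of_real (r\<^sup>2)))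
          - of_real (r powr (2 * \<nu> + 3) / (2 * \<kappa>)) * cnj w * (bessel_entire \<kappa> (w * of_real (r\<^sup>2)) * bessel_entire \<kappa> (cnj w * of_real (r\<^sup>2)))
        = of_real (2 * \<kappa>) * of_real (p r) - of_real (1 / (2 * \<kappa>)) * cnj w * of_real (q r)" for r
      unfolding nn[OF \<nu>] nn[OF \<kappa>(1)] p_def q_def by simp
    with bessel_entire_green[OF \<nu>, of 1 w "cnj w"] show ?thesis
      unfolding \<kappa>_def[symmetric] using c0 by simp
  qed
  ultimately have "of_real (2 * \<kappa>) * of_real P - of_real (1 / (2 * \<kappa>)) * cnj w * of_real Q = 0"
    by (rule has_integral_unique)
  then have eq: "cnj w * of_real Q = of_real (4 * \<kappa>\<^sup>2 * P)"
    using \<kappa> by (simp add: field_simps power2_eq_square)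
  have "0 \<le> P" unfolding P_def by (rule integral_nonneg) (use P in \<open>auto simp: p_def\<close>)
  have "0 \<le> Q" unfolding Q_def by (rule integral_nonneg) (use Q in \<open>auto simp: q_def\<close>)
  \<comment> \<open>Otherwise the continuous nonnegative integrand vanishes identically, and its
    value at r = 1 exhibits a common zero of orders \<nu> and \<nu> + 1.\<close>
  moreover have "Q \<noteq> 0"
  proof
    assume "Q = 0"
    then have "\<forall>r\<in>{0..1}. q r = 0"
      unfolding Q_def by (subst (asm) integral_eq_0_iff[OF contq]) (auto simp: q_def)
    then have "q 1 = 0" by simp
    then show False
      using bessel_entire_no_common_zero[OF \<nu> 0] by (simp add: q_def \<kappa>_def)
  qed
  ultimately have "0 < Q" by simp
  define x where "x = 4 * \<kappa>\<^sup>2 * P / Q"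
  have "cnj w = of_real x" using eq \<open>0 < Q\<close> by (simp add: x_def field_simps)
  then have w: "w = of_real x" by (metis complex_cnj_cnj complex_cnj_complex_of_real)
  moreover have "0 \<le> x" using \<open>0 \<le> P\<close> \<open>0 < Q\<close> by (simp add: x_def)
  moreover have "x \<noteq> 0" using 0 w by auto
  ultimately show ?thesis using that by (simp add: less_le)
qed

text \<open>The product formula is applied with \<open>a k = (z (Suc k))^2\<close>, zero-based where
  z starts at 1. That z lists all complex zeros follows from their being positive reals, and
  simplicity from the absence of common zeros with order \<nu> + 1, since the derivative is a
  multiple of that function.\<close>

lemma
  fixes z :: "nat \<Rightarrow> real"
  assumes \<nu>: "- 1 / 2 < \<nu>" and mono: "strict_mono_on {1..} z"
    and zeros: "z ` {1..} = {x. 0 < x \<and> bessel_J \<nu> x = 0}"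
  shows bessel_zeros_pos: "0 < z (Suc k)"
    and bessel_entire_zeros: "bessel_entire \<nu> ((z (Suc k))\<^sup>2) = 0"
    and sums_inverse_bessel_zeros: "(\<lambda>k. 1 / (z (Suc k))\<^sup>2) sums (1 / (4 * (\<nu> + 1)))"
    and bessel_zeros_product: "(\<lambda>n. \<Prod>k<n. 1 - (z 1)\<^sup>2 / (z (k + 2))\<^sup>2)
        \<longlonglongrightarrow> (z 1)\<^sup>2 / (4 * (\<nu> + 1)) * bessel_entire (\<nu> + 1) ((z 1)\<^sup>2)"
proof -
  have mem: "0 < z (Suc k) \<and> bessel_J \<nu> (z (Suc k)) = 0" for k
  proof -
    have "z (Suc k) \<in> z ` {1..}" by auto
    then show ?thesis unfolding zeros by simp
  qed
  show pos: "0 < z (Suc k)" for k using mem by blast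
  have iff: "bessel_J \<nu> x = 0 \<longleftrightarrow> bessel_entire \<nu> (x\<^sup>2) = 0" if "0 < x" for x
  proof -
    have "0 < Gamma (\<nu> + 1)" using \<nu> by (intro Gamma_real_pos) auto
    then show ?thesis unfolding bessel_J_eq_bessel_entire[OF \<nu> that] using that by auto
  qed
  show zero: "bessel_entire \<nu> ((z (Suc k))\<^sup>2) = 0" for k
    using mem iff by blast
  define a where "a k = (z (Suc k))\<^sup>2" for k
  interpret entire_positive_zeros "bessel_entire \<nu>" a
  proof
    show "bessel_entire \<nu> holomorphic_on UNIV"
      unfolding holomorphic_on_def field_differentiable_def
      using has_field_derivative_bessel_entire[OF \<nu>] by blast
    show "norm (bessel_entire \<nu> w) \<le> exp (sqrt (norm w))" for w :: complex
      by (rule norm_bessel_entire_le[OF \<nu>])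
    show "strict_mono a"
    proof (rule strict_monoI)
      fix i j :: nat assume "i < j"
      then have "z (Suc i) < z (Suc j)" using strict_mono_onD[OF mono] by auto
      then show "a i < a j" unfolding a_def using pos[of i] by (intro power_strict_mono) auto
    qed
    show "0 < a k" for k using pos[of k] by (simp add: a_def)
    show zc: "bessel_entire \<nu> w = 0 \<longleftrightarrow> (\<exists>k. w = of_real (a k))" for w :: complex
    proof
      assume 0: "bessel_entire \<nu> w = 0"
      then obtain x where x: "0 < x" "w = of_real x" by (rule bessel_entire_zero_positive_real[OF \<nu>])
      have "bessel_entire \<nu> x = 0" using 0 x bessel_entire_of_real[OF \<nu>, of x, where 'a=complex] by simp
      then have "sqrt x \<in> z ` {1..}" unfolding zeros using x iff[of "sqrt x"] by simp
      then obtain j where j: "1 \<le> j" "sqrt x = z j" by auto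
      then have "x = a (j - 1)" using x by (auto simp: a_def j(2)[symmetric])
      then show "\<exists>k. w = of_real (a k)" using x by blast
    next
      assume "\<exists>k. w = of_real (a k)"
      then show "bessel_entire \<nu> w = 0"
        using zero bessel_entire_of_real[OF \<nu>, where 'a=complex] by (auto simp: a_def simp del: of_real_power)
    qed
    show "deriv (bessel_entire \<nu>) (of_real (a k)) \<noteq> (0::complex)" for k
    proof -
      have "bessel_entire (\<nu> + 1) (complex_of_real (a k)) \<noteq> 0"
        by (rule bessel_entire_no_common_zero[OF \<nu>]) (use zc in blast)
      moreover have "complex_of_real (1 / (4 * (\<nu> + 1))) \<noteq> 0"
        unfolding of_real_eq_0_iff using \<nu> by simp
      ultimately show ?thesis
        using DERIV_imp_deriv[OF has_field_derivative_bessel_entire[OF \<nu>, of "complex_of_real (a k)" UNIV]] by simp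
    qed
  qed auto
  have d: "deriv (bessel_entire \<nu>) (complex_of_real x) = of_real (- (1 / (4 * (\<nu> + 1))) * bessel_entire (\<nu> + 1) x)" for x
    using DERIV_imp_deriv[OF has_field_derivative_bessel_entire[OF \<nu>, of "complex_of_real x" UNIV]]
      bessel_entire_of_real[of "\<nu> + 1" x, where 'a=complex] \<nu> by simp
  have "(\<lambda>k. complex_of_real (1 / a k)) sums of_real (1 / (4 * (\<nu> + 1)))"
    using sums_inverse_zeros d[of 0] by simp
  then show "(\<lambda>k. 1 / (z (Suc k))\<^sup>2) sums (1 / (4 * (\<nu> + 1)))"
    unfolding sums_of_real_iff a_def .
  have "(\<lambda>n. complex_of_real (\<Prod>k<n. 1 - a 0 / a (Suc k)))
      \<longlonglongrightarrow> of_real (a 0 / (4 * (\<nu> + 1)) * bessel_entire (\<nu> + 1) (a 0))"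
    using product_at_first_zero unfolding d by simp
  then show "(\<lambda>n. \<Prod>k<n. 1 - (z 1)\<^sup>2 / (z (k + 2))\<^sup>2)
        \<longlonglongrightarrow> (z 1)\<^sup>2 / (4 * (\<nu> + 1)) * bessel_entire (\<nu> + 1) ((z 1)\<^sup>2)"
    unfolding tendsto_of_real_iff by (simp add: a_def)
qed

text \<open>For c > 0 a multiple of sqrt r * J_\<nu>(sqrt c * r). The exponent \<nu> + 1/2 is
  \<alpha>, the exponent in the kernel of the bridge.\<close>

definition bessel_mode :: "real \<Rightarrow> real \<Rightarrow> real \<Rightarrow> real" where
  "bessel_mode \<nu> c r = r powr (\<nu> + 1 / 2) * bessel_entire \<nu> (c * r\<^sup>2)"

text \<open>For c > 0 a multiple of sqrt r * J_(\<nu>+1)(sqrt c * r). The divisor is chosen so that,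
  in \<open>integral_powr_bessel_mode\<close>, it is the image of the mode without further
  constant.\<close>

definition bessel_comode :: "real \<Rightarrow> real \<Rightarrow> real \<Rightarrow> real" where
  "bessel_comode \<nu> c r = r powr (\<nu> + 3 / 2) * bessel_entire (\<nu> + 1) (c * r\<^sup>2) / (2 * (\<nu> + 1))"

context
  fixes \<nu> :: real
  assumes \<nu>: "- 1 / 2 < \<nu>"
begin

lemma continuous_on_bessel_mode: "continuous_on {0..} (bessel_mode \<nu> c)"
  unfolding bessel_mode_def[abs_def]
  by (intro continuous_intros continuous_on_bessel_entire continuous_on_powr' \<nu>) (use \<nu> in auto)

lemma continuous_on_bessel_comode: "continuous_on {0..} (bessel_comode \<nu> c)"
  unfolding bessel_comode_def[abs_def]
  by (intro continuous_intros continuous_on_bessel_entire continuous_on_powr') (use \<nu> in auto)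

lemma set_integrable_Icc_if_continuous:
  fixes f :: "real \<Rightarrow> real"
  assumes "continuous_on {0..} f"
  shows "set_integrable lborel {0..R} f"
  by (rule borel_integrable_atLeastAtMost') (rule continuous_on_subset[OF assms], auto)

lemma bessel_mode_green:
  assumes R: "0 \<le> R"
  shows "(LINT r:{0..R}|lborel. bessel_mode \<nu> a r * bessel_mode \<nu> b r)
       = R powr (2 * \<nu> + 2) * bessel_entire (\<nu> + 1) (a * R\<^sup>2) * bessel_entire \<nu> (b * R\<^sup>2) / (2 * (\<nu> + 1))
         + b * (LINT r:{0..R}|lborel. bessel_comode \<nu> a r * bessel_comode \<nu> b r)"
proof -
  define \<kappa> where "\<kappa> = \<nu> + 1"
  have \<kappa>: "0 < \<kappa>" using \<nu> by (simp add: \<kappa>_def)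
  have cont: "continuous_on {0..} (\<lambda>r. bessel_mode \<nu> a r * bessel_mode \<nu> b r)"
    "continuous_on {0..} (\<lambda>r. bessel_comode \<nu> a r * bessel_comode \<nu> b r)"
    by (intro continuous_intros continuous_on_bessel_mode continuous_on_bessel_comode)+
  have m: "((\<lambda>r. bessel_mode \<nu> a r * bessel_mode \<nu> b r) has_integral
      (LINT r:{0..R}|lborel. bessel_mode \<nu> a r * bessel_mode \<nu> b r)) {0..R}"
    and c: "((\<lambda>r. bessel_comode \<nu> a r * bessel_comode \<nu> b r) has_integral
      (LINT r:{0..R}|lborel. bessel_comode \<nu> a r * bessel_comode \<nu> b r)) {0..R}"
    using set_borel_integral_eq_integral[OF set_integrable_Icc_if_continuous[OF cont(1)]]
      set_borel_integral_eq_integral[OF set_integrable_Icc_if_continuous[OF cont(2)]] integrable_integral by metis+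
  have "((\<lambda>r. 2 * \<kappa> * (bessel_mode \<nu> a r * bessel_mode \<nu> b r) - 2 * \<kappa> * b * (bessel_comode \<nu> a r * bessel_comode \<nu> b r)) has_integral
      2 * \<kappa> * (LINT r:{0..R}|lborel. bessel_mode \<nu> a r * bessel_mode \<nu> b r)
      - 2 * \<kappa> * b * (LINT r:{0..R}|lborel. bessel_comode \<nu> a r * bessel_comode \<nu> b r)) {0..R}"
    by (intro has_integral_diff has_integral_mult_right m c)
  moreover have "2 * \<kappa> * (bessel_mode \<nu> a r * bessel_mode \<nu> b r) - 2 * \<kappa> * b * (bessel_comode \<nu> a r * bessel_comode \<nu> b r)
      = 2 * \<kappa> * r powr (2 * \<nu> + 1) * (bessel_entire \<nu> (a * r\<^sup>2) * bessel_entire \<nu> (b * r\<^sup>2))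
              - r powr (2 * \<nu> + 3) / (2 * \<kappa>) * b * (bessel_entire \<kappa> (a * r\<^sup>2) * bessel_entire \<kappa> (b * r\<^sup>2))" for r
  proof -
    have "r powr (2 * \<nu> + 1) = r powr (\<nu> + 1 / 2) * r powr (\<nu> + 1 / 2)"
      "r powr (2 * \<nu> + 3) = r powr (\<nu> + 3 / 2) * r powr (\<nu> + 3 / 2)"
      unfolding powr_add[symmetric] by simp_all
    then show ?thesis
      using \<kappa> unfolding bessel_mode_def bessel_comode_def \<kappa>_def[symmetric] by (simp only:) (simp add: field_simps)
  qed
  ultimately have 1: "((\<lambda>r. 2 * \<kappa> * r powr (2 * \<nu> + 1) * (bessel_entire \<nu> (a * r\<^sup>2) * bessel_entire \<nu> (b * r\<^sup>2))
              - r powr (2 * \<nu> + 3) / (2 * \<kappa>) * b * (bessel_entire \<kappa> (a * r\<^sup>2) * bessel_entire \<kappa> (b * r\<^sup>2))) has_integral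
      2 * \<kappa> * (LINT r:{0..R}|lborel. bessel_mode \<nu> a r * bessel_mode \<nu> b r)
      - 2 * \<kappa> * b * (LINT r:{0..R}|lborel. bessel_comode \<nu> a r * bessel_comode \<nu> b r)) {0..R}"
    by simp
  have "((\<lambda>r. 2 * \<kappa> * r powr (2 * \<nu> + 1) * (bessel_entire \<nu> (a * r\<^sup>2) * bessel_entire \<nu> (b * r\<^sup>2))
              - r powr (2 * \<nu> + 3) / (2 * \<kappa>) * b * (bessel_entire \<kappa> (a * r\<^sup>2) * bessel_entire \<kappa> (b * r\<^sup>2)))
      has_integral R powr (2 * \<nu> + 2) * (bessel_entire \<kappa> (a * R\<^sup>2) * bessel_entire \<nu> (b * R\<^sup>2))) {0..R}"
    using bessel_entire_green[OF \<nu> R, of a b] by (simp add: \<kappa>_def)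
  from has_integral_unique[OF 1 this] show ?thesis
    using \<kappa> unfolding \<kappa>_def[symmetric] by (simp add: field_simps)
qed

text \<open>The case b = 0 of Green's identity, where one mode degenerates to the pure power
  r^(\<nu>+1/2). With r = T - t this computes the adjoint of the bridge kernel on a mode.\<close>

lemma integral_powr_bessel_mode:
  assumes "0 \<le> R"
  shows "(LINT r:{0..R}|lborel. r powr (\<nu> + 1 / 2) * bessel_mode \<nu> c r) = R powr (\<nu> + 1 / 2) * bessel_comode \<nu> c R"
proof -
  have "R powr (2 * \<nu> + 2) = R powr (\<nu> + 1 / 2) * R powr (\<nu> + 3 / 2)"
    unfolding powr_add[symmetric] by simp
  then show ?thesis
    using bessel_mode_green[OF assms, of c 0] by (simp add: bessel_mode_def bessel_comode_def mult.commute)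
qed

lemma bessel_mode_eq_comode_integral:
  assumes "0 \<le> R" "bessel_entire \<nu> (b * R\<^sup>2) = 0"
  shows "(LINT r:{0..R}|lborel. bessel_mode \<nu> a r * bessel_mode \<nu> b r)
       = b * (LINT r:{0..R}|lborel. bessel_comode \<nu> a r * bessel_comode \<nu> b r)"
  using bessel_mode_green[OF assms(1), of a b] assms(2) by simp

text \<open>With vanishing boundary terms the mode integral equals b times the comode integral and,
  by symmetry, also a times it; as a and b differ, both integrals vanish.\<close>

lemma bessel_mode_orthogonal:
  assumes "0 \<le> R" "bessel_entire \<nu> (a * R\<^sup>2) = 0" "bessel_entire \<nu> (b * R\<^sup>2) = 0" "a \<noteq> b"
  shows "(LINT r:{0..R}|lborel. bessel_comode \<nu> a r * bessel_comode \<nu> b r) = 0"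
    and "(LINT r:{0..R}|lborel. bessel_mode \<nu> a r * bessel_mode \<nu> b r) = 0"
proof -
  let ?C = "LINT r:{0..R}|lborel. bessel_comode \<nu> a r * bessel_comode \<nu> b r"
  have "b * ?C = a * ?C"
    using bessel_mode_eq_comode_integral[OF assms(1,3), of a] bessel_mode_eq_comode_integral[OF assms(1,2), of b]
    by (simp add: mult.commute)
  then show "?C = 0" using assms(4) by simp
  then show "(LINT r:{0..R}|lborel. bessel_mode \<nu> a r * bessel_mode \<nu> b r) = 0"
    using bessel_mode_eq_comode_integral[OF assms(1,3), of a] by simp
qed

text \<open>The squared norm is a times that of the comode, and the comode is nonzero at R because
  orders \<nu> and \<nu> + 1 have no common zero.\<close>

lemma bessel_mode_norm_pos:
  assumes R: "0 < R" and 0: "bessel_entire \<nu> (a * R\<^sup>2) = 0" and a: "0 < a"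
  shows "0 < (LINT r:{0..R}|lborel. bessel_mode \<nu> a r * bessel_mode \<nu> a r)"
proof -
  have cont: "continuous_on {0..} (\<lambda>r. bessel_comode \<nu> a r * bessel_comode \<nu> a r)"
    by (intro continuous_intros continuous_on_bessel_comode)
  then have contR: "continuous_on {0..R} (\<lambda>r. bessel_comode \<nu> a r * bessel_comode \<nu> a r)"
    by (rule continuous_on_subset) auto
  have eq: "(LINT r:{0..R}|lborel. bessel_comode \<nu> a r * bessel_comode \<nu> a r)
      = integral {0..R} (\<lambda>r. bessel_comode \<nu> a r * bessel_comode \<nu> a r)"
    by (rule set_borel_integral_eq_integral(2)[OF set_integrable_Icc_if_continuous[OF cont]])
  have "integral {0..R} (\<lambda>r. bessel_comode \<nu> a r * bessel_comode \<nu> a r) \<noteq> 0"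
  proof
    assume "integral {0..R} (\<lambda>r. bessel_comode \<nu> a r * bessel_comode \<nu> a r) = 0"
    then have "\<forall>r\<in>{0..R}. bessel_comode \<nu> a r * bessel_comode \<nu> a r = 0"
      by (subst (asm) integral_eq_0_iff[OF contR]) (use R in auto)
    then have "bessel_comode \<nu> a R = 0" using R by auto
    then show False
      using bessel_entire_no_common_zero[OF \<nu> 0] R \<nu> by (simp add: bessel_comode_def)
  qed
  moreover have "0 \<le> integral {0..R} (\<lambda>r. bessel_comode \<nu> a r * bessel_comode \<nu> a r)"
    by (rule integral_nonneg) (use contR integrable_continuous_interval in auto)
  ultimately show ?thesis
    using bessel_mode_eq_comode_integral[OF less_imp_le[OF R] 0, of a] a by (simp add: eq less_le)
qed

end

section \<open>Wiener integrals and linear functionals of the bridge\<close>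

lemma (in prob_space) char_centered_normal:
  assumes D: "distributed M lborel X (normal_density 0 \<sigma>)" and \<sigma>: "0 < \<sigma>"
  shows "(CLINT \<omega>|M. iexp (c * X \<omega>)) = of_real (exp (- (c\<^sup>2 * \<sigma>\<^sup>2 / 2)))"
proof -
  have D': "distributed M lborel (\<lambda>\<omega>. X \<omega> / \<sigma>) std_normal_density"
    using D normal_standard_normal_convert[OF \<sigma>, of X 0] by simp
  have [measurable]: "X \<in> borel_measurable M" using distributed_measurable[OF D] by simp
  have eq: "distr M lborel (\<lambda>\<omega>. X \<omega> / \<sigma>) = std_normal_distribution"
    using D' by (simp add: distributed_def)
  have "(CLINT \<omega>|M. iexp (c * X \<omega>)) = (CLINT \<omega>|M. iexp ((c * \<sigma>) * (X \<omega> / \<sigma>)))"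
    using \<sigma> by simp
  also have "\<dots> = (CLINT x|distr M lborel (\<lambda>\<omega>. X \<omega> / \<sigma>). iexp ((c * \<sigma>) * x))"
    by (subst integral_distr) auto
  also have "\<dots> = of_real (exp (- (c\<^sup>2 * \<sigma>\<^sup>2 / 2)))"
    unfolding eq using fun_cong[OF char_std_normal_distribution, of "c * \<sigma>"]
    by (simp add: char_def power_mult_distrib)
  finally show ?thesis .
qed

lemma square_of_disjoint_step:
  fixes p \<gamma> :: "nat \<Rightarrow> real"
  assumes "\<And>i j. i < j \<Longrightarrow> j < n \<Longrightarrow> p (Suc i) \<le> p j"
  shows "(\<Sum>i<n. \<gamma> i * indicator {p i<..p (Suc i)} s)\<^sup>2 = (\<Sum>i<n. (\<gamma> i)\<^sup>2 * indicator {p i<..p (Suc i)} s)"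
proof -
  have z: "indicator {p i<..p (Suc i)} s * (indicator {p j<..p (Suc j)} s :: real) = (if i = j then indicator {p i<..p (Suc i)} s else 0)"
    if "i < n" "j < n" for i j
    using assms[of i j] assms[of j i] that by (cases i j rule: linorder_cases) (auto simp: indicator_def)
  have "(\<Sum>i<n. \<gamma> i * indicator {p i<..p (Suc i)} s)\<^sup>2
      = (\<Sum>i<n. \<Sum>j<n. \<gamma> i * \<gamma> j * (indicator {p i<..p (Suc i)} s * indicator {p j<..p (Suc j)} s))"
    unfolding power2_eq_square sum_product by (intro sum.cong) (auto simp: mult_ac)
  also have "\<dots> = (\<Sum>i<n. \<Sum>j<n. if i = j then (\<gamma> i)\<^sup>2 * indicator {p i<..p (Suc i)} s else 0)"
    by (intro sum.cong refl) (auto simp: z power2_eq_square)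
  finally show ?thesis by simp
qed

text \<open>Refining all end points to one increasing sequence makes the increments independent.\<close>

lemma wiener_increments_char:
  assumes W: "wiener_process M B" and J: "finite J"
    and uv: "\<And>j. j \<in> J \<Longrightarrow> 0 \<le> u j" "\<And>j. j \<in> J \<Longrightarrow> u j \<le> v j"
  shows "(CLINT \<omega>|M. iexp (\<Sum>j\<in>J. d j * (B (v j) \<omega> - B (u j) \<omega>)))
       = of_real (exp (- ((LINT s|lborel. (\<Sum>j\<in>J. d j * indicator {u j<..v j} s)\<^sup>2) / 2)))"
    and "integrable lborel (\<lambda>s. (\<Sum>j\<in>J. d j * indicator {u j<..v j} s)\<^sup>2)"
proof -
  interpret prob_space M using W by (simp add: wiener_process_def)
  \<comment> \<open>The point 0 makes the set of grid points nonempty even for empty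
    \<open>J\<close>.\<close>
  define Q where "Q = insert 0 (u ` J \<union> v ` J)"
  define q where "q = sorted_list_of_set Q"
  define n where "n = length q - 1"
  define p where "p i = q ! i" for i
  have Q: "finite Q" "Q \<noteq> {}" "\<And>x. x \<in> Q \<Longrightarrow> 0 \<le> x"
    using J uv order_trans[OF uv] by (auto simp: Q_def)
  have q: "sorted_wrt (<) q" "set q = Q" using Q by (auto simp: q_def)
  have len: "length q = Suc n" using Q q by (cases q) (auto simp: n_def)
  have p_less: "p i < p j" if "i < j" "j \<le> n" for i j
    using sorted_wrt_nth_less[OF q(1), of i j] that len by (simp add: p_def)
  have p_le: "p i \<le> p j" if "i \<le> j" "j \<le> n" for i j
    using p_less[of i j] that by (cases "i = j") auto
  have p_nonneg: "0 \<le> p i" if "i \<le> n" for i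
    using Q(3)[of "p i"] q(2) len that nth_mem[of i q] by (simp add: p_def)
  have p_ex: "\<exists>i\<le>n. x = p i" if "x \<in> Q" for x
    using that len unfolding q(2)[symmetric] in_set_conv_nth p_def by (auto simp: less_Suc_eq_le)
  \<comment> \<open>Marks the grid cells i contained in the interval j.\<close>
  define \<iota> where "\<iota> j i = (if u j \<le> p i \<and> p (Suc i) \<le> v j then 1 else (0 :: real))" for j i
  have tele: "h (v j) - h (u j) = (\<Sum>i<n. \<iota> j i * (h (p (Suc i)) - h (p i)))" if j: "j \<in> J" for j and h :: "real \<Rightarrow> real"
  proof -
    obtain k l where kl: "k \<le> n" "u j = p k" "l \<le> n" "v j = p l"
      using p_ex[of "u j"] p_ex[of "v j"] j by (auto simp: Q_def)
    have "k \<le> l" using uv(2)[OF j] p_less[of l k] kl by (metis leD le_less_linear)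
    have chi: "\<iota> j i = (if i \<in> {k..<l} then 1 else 0)" if "i < n" for i
    proof -
      have "p k \<le> p i \<longleftrightarrow> k \<le> i" using p_le[of k i] p_less[of i k] kl that by (metis leD le_less_linear less_imp_le)
      moreover have "p (Suc i) \<le> p l \<longleftrightarrow> Suc i \<le> l"
        using p_le[of "Suc i" l] p_less[of l "Suc i"] kl that by (metis Suc_leI leD le_less_linear)
      ultimately show ?thesis by (auto simp: \<iota>_def kl)
    qed
    have "(\<Sum>i<n. \<iota> j i * (h (p (Suc i)) - h (p i))) = (\<Sum>i\<in>{k..<l}. h (p (Suc i)) - h (p i))"
      using kl by (intro sum.mono_neutral_cong_right) (auto simp: chi)
    also have "\<dots> = h (p l) - h (p k)"
      using \<open>k \<le> l\<close> by (rule sum_Suc_diff')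
    finally show ?thesis by (simp add: kl)
  qed
  define \<gamma> where "\<gamma> i = (\<Sum>j\<in>J. d j * \<iota> j i)" for i
  have comb: "(\<Sum>j\<in>J. d j * (h (v j) - h (u j))) = (\<Sum>i<n. \<gamma> i * (h (p (Suc i)) - h (p i)))" for h :: "real \<Rightarrow> real"
    unfolding \<gamma>_def sum_distrib_right
    by (subst sum.swap) (simp add: tele sum_distrib_left mult.assoc)
  have ind: "indicator {a<..b} s = (indicator {s..} b - indicator {s..} a :: real)" if "a \<le> b" for a b s :: real
    using that by (auto simp: indicator_def)
  \<comment> \<open>The telescoping identity \<open>comb\<close> holds for every function of time.
    Applied to \<open>indicator {s..}\<close> it rewrites the step function exactly as it rewrites
    the increments of B.\<close>
  have g: "(\<Sum>j\<in>J. d j * indicator {u j<..v j} s) = (\<Sum>i<n. \<gamma> i * indicator {p i<..p (Suc i)} s)" for s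
    using comb[of "indicator {s..}"] uv p_le by (simp add: ind)
  have g2: "(\<Sum>j\<in>J. d j * indicator {u j<..v j} s)\<^sup>2 = (\<Sum>i<n. (\<gamma> i)\<^sup>2 * indicator {p i<..p (Suc i)} s)" for s
    unfolding g by (rule square_of_disjoint_step) (use p_le in auto)
  show "integrable lborel (\<lambda>s. (\<Sum>j\<in>J. d j * indicator {u j<..v j} s)\<^sup>2)"
    unfolding g2 by (intro Bochner_Integration.integrable_sum integrable_mult_right) (auto simp: p_le)
  have int: "(LINT s|lborel. (\<Sum>j\<in>J. d j * indicator {u j<..v j} s)\<^sup>2) = (\<Sum>i<n. (\<gamma> i)\<^sup>2 * (p (Suc i) - p i))"
    unfolding g2 using p_le
    by (subst Bochner_Integration.integral_sum) (auto simp: p_le)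
  define X where "X i \<omega> = B (p (Suc i)) \<omega> - B (p i) \<omega>" for i \<omega>
  have "indep_vars (\<lambda>_. borel) X {..<n}"
    using W p_nonneg[of 0] p_le unfolding wiener_process_def X_def[abs_def] by auto
  then have "indep_vars (\<lambda>_. borel) (\<lambda>i \<omega>. \<gamma> i * X i \<omega>) {..<n}"
    by (rule indep_vars_compose2[where Y="\<lambda>i x. \<gamma> i * x"]) auto
  note char_sum = char_distr_sum[OF this, of 1]
  have "(CLINT \<omega>|M. iexp (\<Sum>i<n. \<gamma> i * X i \<omega>)) = (\<Prod>i<n. CLINT \<omega>|M. iexp (\<gamma> i * X i \<omega>))"
  proof -
    have [measurable]: "X i \<in> borel_measurable M" if "i < n" for i
      using W p_nonneg[of i] p_nonneg[of "Suc i"] that unfolding wiener_process_def X_def[abs_def]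
      by (intro borel_measurable_diff) auto
    have s: "Characteristic_Functions.char (distr M borel (\<lambda>\<omega>. \<Sum>i<n. \<gamma> i * X i \<omega>)) 1 = (CLINT \<omega>|M. iexp (\<Sum>i<n. \<gamma> i * X i \<omega>))"
      unfolding char_def by (subst integral_distr) auto
    have "Characteristic_Functions.char (distr M borel (\<lambda>\<omega>. \<gamma> i * X i \<omega>)) 1 = (CLINT \<omega>|M. iexp (\<gamma> i * X i \<omega>))" if "i < n" for i
      unfolding char_def using that by (subst integral_distr) auto
    then show ?thesis
      using char_sum unfolding s by simp
  qed
  also have "\<dots> = (\<Prod>i<n. of_real (exp (- ((\<gamma> i)\<^sup>2 * (p (Suc i) - p i) / 2))))"
  proof (intro prod.cong refl)
    fix i assume "i \<in> {..<n}"
    then have i: "0 \<le> p i" "p i < p (Suc i)" using p_nonneg p_less[of i "Suc i"] by auto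
    then have "distributed M lborel (X i) (normal_density 0 (sqrt (p (Suc i) - p i)))"
      using W unfolding wiener_process_def X_def[abs_def] by auto
    from char_centered_normal[OF this, of "\<gamma> i"] i
    show "(CLINT \<omega>|M. iexp (\<gamma> i * X i \<omega>)) = of_real (exp (- ((\<gamma> i)\<^sup>2 * (p (Suc i) - p i) / 2)))"
      by simp
  qed
  also have "\<dots> = of_real (exp (- ((\<Sum>i<n. (\<gamma> i)\<^sup>2 * (p (Suc i) - p i)) / 2)))"
    by (simp add: exp_sum[symmetric] sum_negf sum_divide_distrib del: of_real_exp flip: of_real_prod)
  finally show "(CLINT \<omega>|M. iexp (\<Sum>j\<in>J. d j * (B (v j) \<omega> - B (u j) \<omega>)))
       = of_real (exp (- ((LINT s|lborel. (\<Sum>j\<in>J. d j * indicator {u j<..v j} s)\<^sup>2) / 2)))"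
    unfolding int X_def comb[of "\<lambda>t. B t \<omega>" for \<omega>] .
qed

text \<open>Convergence of squared norms rests on the pointwise bound of |x^2 - y^2| by (1 +
  1/\<epsilon>) (x - y)^2 + \<epsilon> y^2, so no normed space of square-integrable functions is set
  up.\<close>

lemma L2_limit_norm:
  fixes g :: "'a \<Rightarrow> real"
  assumes [measurable]: "\<And>m. h m \<in> borel_measurable N" "g \<in> borel_measurable N"
    and int: "\<And>m::nat. integrable N (\<lambda>s. (h m s)\<^sup>2)"
    and lim: "(\<lambda>m. \<integral>\<^sup>+s. ennreal ((h m s - g s)\<^sup>2) \<partial>N) \<longlonglongrightarrow> 0"
  shows "(\<lambda>m. LINT s|N. (h m s)\<^sup>2) \<longlonglongrightarrow> (LINT s|N. (g s)\<^sup>2)"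
proof -
  have "\<forall>\<^sub>F m in sequentially. (\<integral>\<^sup>+s. ennreal ((h m s - g s)\<^sup>2) \<partial>N) < 1"
    using lim by (rule order_tendstoD) simp
  then have fin: "\<forall>\<^sub>F m in sequentially. integrable N (\<lambda>s. (h m s - g s)\<^sup>2)"
  proof eventually_elim
    case (elim m)
    have "(1::ennreal) < \<infinity>" by simp
    from less_trans[OF elim this] show ?case by (intro integrableI_bounded) auto
  qed
  then obtain m0 where m0: "integrable N (\<lambda>s. (h m0 s - g s)\<^sup>2)"
    by (auto simp: eventually_sequentially)
  have "integrable N (\<lambda>s. 2 * (h m0 s - g s)\<^sup>2 + 2 * (h m0 s)\<^sup>2)"
    using m0 int by simp
  then have ig: "integrable N (\<lambda>s. (g s)\<^sup>2)"
  proof (rule Bochner_Integration.integrable_bound)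
    have "x\<^sup>2 \<le> 2 * (y - x)\<^sup>2 + 2 * y\<^sup>2" for x y :: real
      using sum_squares_bound[of "y - x" y] zero_le_power2[of "2 * y - x"]
      by (simp add: power2_eq_square algebra_simps)
    then show "AE s in N. norm ((g s)\<^sup>2) \<le> norm (2 * (h m0 s - g s)\<^sup>2 + 2 * (h m0 s)\<^sup>2)"
      by auto
  qed simp
  define D where "D m = (LINT s|N. (h m s - g s)\<^sup>2)" for m
  define G where "G = (LINT s|N. (g s)\<^sup>2)"
  have G: "0 \<le> G" by (simp add: G_def)
  have D: "D \<longlonglongrightarrow> 0"
  proof -
    have "\<forall>\<^sub>F m in sequentially. (\<integral>\<^sup>+s. ennreal ((h m s - g s)\<^sup>2) \<partial>N) = ennreal (D m)"
      using fin by eventually_elim (simp add: D_def nn_integral_eq_integral)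
    then have "(\<lambda>m. ennreal (D m)) \<longlonglongrightarrow> ennreal 0"
      using lim by (simp add: tendsto_cong)
    then show ?thesis by (rule tendsto_ennrealD) (auto simp: D_def)
  qed
  show "(\<lambda>m. LINT s|N. (h m s)\<^sup>2) \<longlonglongrightarrow> (LINT s|N. (g s)\<^sup>2)"
    unfolding G_def[symmetric]
  proof (rule LIMSEQ_I)
    fix r :: real assume r: "0 < r"
    \<comment> \<open>G + 1 instead of G covers G = 0 and makes \<epsilon> * G strictly smaller than
      r / 2.\<close>
    define \<epsilon> where "\<epsilon> = r / (2 * (G + 1))"
    have \<epsilon>: "0 < \<epsilon>" "\<epsilon> * G < r / 2" using r G by (simp_all add: \<epsilon>_def field_simps)
    have "(\<lambda>m. (1 + 1 / \<epsilon>) * D m) \<longlonglongrightarrow> (1 + 1 / \<epsilon>) * 0"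
      by (intro tendsto_intros D)
    then have "\<forall>\<^sub>F m in sequentially. (1 + 1 / \<epsilon>) * D m < r / 2"
      by (rule order_tendstoD) (use r in simp)
    with fin have "\<forall>\<^sub>F m in sequentially. norm ((LINT s|N. (h m s)\<^sup>2) - G) < r"
    proof eventually_elim
      case (elim m)
      have pt: "\<bar>x\<^sup>2 - y\<^sup>2\<bar> \<le> (1 + 1 / \<epsilon>) * (x - y)\<^sup>2 + \<epsilon> * y\<^sup>2" for x y :: real
      proof -
        have "2 * \<bar>x - y\<bar> * (\<epsilon> * \<bar>y\<bar>) \<le> (x - y)\<^sup>2 + (\<epsilon> * \<bar>y\<bar>)\<^sup>2"
          using sum_squares_bound[of "\<bar>x - y\<bar>" "\<epsilon> * \<bar>y\<bar>"] by simp
        also have "(\<epsilon> * \<bar>y\<bar>)\<^sup>2 = \<epsilon> * (\<epsilon> * y\<^sup>2)"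
          by (simp add: power_mult_distrib power2_eq_square)
        finally have "(2 * \<bar>x - y\<bar> * (\<epsilon> * \<bar>y\<bar>)) / \<epsilon> \<le> ((x - y)\<^sup>2 + \<epsilon> * (\<epsilon> * y\<^sup>2)) / \<epsilon>"
          using \<epsilon> by (intro divide_right_mono) auto
        then have "2 * \<bar>(x - y) * y\<bar> \<le> (x - y)\<^sup>2 / \<epsilon> + \<epsilon> * y\<^sup>2"
          using \<epsilon> by (simp add: add_divide_distrib abs_mult)
        moreover have "x\<^sup>2 - y\<^sup>2 = (x - y)\<^sup>2 + 2 * ((x - y) * y)"
          by (simp add: power2_eq_square algebra_simps)
        moreover have "(1 + 1 / \<epsilon>) * (x - y)\<^sup>2 = (x - y)\<^sup>2 + (x - y)\<^sup>2 / \<epsilon>"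
          by (simp add: algebra_simps)
        ultimately show ?thesis using zero_le_power2[of "x - y"] by linarith
      qed
      have "(LINT s|N. (h m s)\<^sup>2) - G = (LINT s|N. (h m s)\<^sup>2 - (g s)\<^sup>2)"
        unfolding G_def by (rule Bochner_Integration.integral_diff[OF int ig, symmetric])
      also have "norm \<dots> \<le> (LINT s|N. norm ((h m s)\<^sup>2 - (g s)\<^sup>2))"
        by (rule integral_norm_bound)
      also have "\<dots> \<le> (LINT s|N. (1 + 1 / \<epsilon>) * (h m s - g s)\<^sup>2 + \<epsilon> * (g s)\<^sup>2)"
        by (rule integral_mono) (use int[of m] ig elim(1) pt in auto)
      also have "\<dots> = (1 + 1 / \<epsilon>) * D m + \<epsilon> * G"
        unfolding D_def G_def using elim(1) ig by simp
      finally show ?case using elim(2) \<epsilon>(2) by linarith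
    qed
    then show "\<exists>no. \<forall>n\<ge>no. norm ((LINT s|N. (h n s)\<^sup>2) - G) < r"
      by (simp add: eventually_sequentially)
  qed
qed

lemma L2_limit_sum:
  fixes h :: "'i \<Rightarrow> nat \<Rightarrow> 'a \<Rightarrow> real"
  assumes "finite I"
    and "\<And>i m. i \<in> I \<Longrightarrow> h i m \<in> borel_measurable N" "\<And>i. i \<in> I \<Longrightarrow> g i \<in> borel_measurable N"
    and "\<And>i. i \<in> I \<Longrightarrow> (\<lambda>m. \<integral>\<^sup>+s. ennreal ((h i m s - g i s)\<^sup>2) \<partial>N) \<longlonglongrightarrow> 0"
  shows "(\<lambda>m. \<integral>\<^sup>+s. ennreal (((\<Sum>i\<in>I. a i * h i m s) - (\<Sum>i\<in>I. a i * g i s))\<^sup>2) \<partial>N) \<longlonglongrightarrow> 0"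
  using assms
proof (induction I rule: finite_induct)
  case (insert j I)
  have [measurable]: "\<And>m. h j m \<in> borel_measurable N" "g j \<in> borel_measurable N"
    "\<And>i m. i \<in> I \<Longrightarrow> h i m \<in> borel_measurable N" "\<And>i. i \<in> I \<Longrightarrow> g i \<in> borel_measurable N"
    using insert.prems by auto
  let ?A = "\<lambda>m. \<integral>\<^sup>+s. ennreal ((h j m s - g j s)\<^sup>2) \<partial>N"
  let ?B = "\<lambda>m. \<integral>\<^sup>+s. ennreal (((\<Sum>i\<in>I. a i * h i m s) - (\<Sum>i\<in>I. a i * g i s))\<^sup>2) \<partial>N"
  have "?A \<longlonglongrightarrow> 0" "?B \<longlonglongrightarrow> 0"
    using insert by auto
  then have "(\<lambda>m. ennreal (2 * (a j)\<^sup>2) * ?A m + ennreal 2 * ?B m) \<longlonglongrightarrow> ennreal (2 * (a j)\<^sup>2) * 0 + ennreal 2 * 0"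
    by (intro tendsto_add ennreal_tendsto_cmult) auto
  then have lim: "(\<lambda>m. ennreal (2 * (a j)\<^sup>2) * ?A m + ennreal 2 * ?B m) \<longlonglongrightarrow> 0" by simp
  have le: "(\<integral>\<^sup>+s. ennreal (((\<Sum>i\<in>insert j I. a i * h i m s) - (\<Sum>i\<in>insert j I. a i * g i s))\<^sup>2) \<partial>N)
      \<le> ennreal (2 * (a j)\<^sup>2) * ?A m + ennreal 2 * ?B m" for m
  proof -
    have pt: "(x + y)\<^sup>2 \<le> 2 * x\<^sup>2 + 2 * y\<^sup>2" for x y :: real
      using sum_squares_bound[of x y] by (simp add: power2_eq_square algebra_simps)
    have "(\<integral>\<^sup>+s. ennreal (((\<Sum>i\<in>insert j I. a i * h i m s) - (\<Sum>i\<in>insert j I. a i * g i s))\<^sup>2) \<partial>N)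
       \<le> (\<integral>\<^sup>+s. ennreal (2 * (a j)\<^sup>2) * ennreal ((h j m s - g j s)\<^sup>2)
            + ennreal 2 * ennreal (((\<Sum>i\<in>I. a i * h i m s) - (\<Sum>i\<in>I. a i * g i s))\<^sup>2) \<partial>N)"
    proof (rule nn_integral_mono)
      fix s
      have "((\<Sum>i\<in>insert j I. a i * h i m s) - (\<Sum>i\<in>insert j I. a i * g i s))\<^sup>2
          = (a j * (h j m s - g j s) + ((\<Sum>i\<in>I. a i * h i m s) - (\<Sum>i\<in>I. a i * g i s)))\<^sup>2"
        using insert(1,2) by (simp add: algebra_simps)
      also have "\<dots> \<le> 2 * (a j)\<^sup>2 * (h j m s - g j s)\<^sup>2 + 2 * ((\<Sum>i\<in>I. a i * h i m s) - (\<Sum>i\<in>I. a i * g i s))\<^sup>2"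
        using pt[of "a j * (h j m s - g j s)"] by (simp only: power_mult_distrib mult.assoc)
      finally show "ennreal (((\<Sum>i\<in>insert j I. a i * h i m s) - (\<Sum>i\<in>insert j I. a i * g i s))\<^sup>2)
          \<le> ennreal (2 * (a j)\<^sup>2) * ennreal ((h j m s - g j s)\<^sup>2)
            + ennreal 2 * ennreal (((\<Sum>i\<in>I. a i * h i m s) - (\<Sum>i\<in>I. a i * g i s))\<^sup>2)"
        by (subst ennreal_mult[symmetric], simp, simp, subst ennreal_mult[symmetric], simp, simp,
            subst ennreal_plus[symmetric], simp, simp) (rule ennreal_leI)
    qed
    also have "\<dots> = ennreal (2 * (a j)\<^sup>2) * ?A m + ennreal 2 * ?B m"
      by (subst nn_integral_add) (auto simp: nn_integral_cmult)
    finally show ?thesis .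
  qed
  show ?case
  proof (rule tendsto_sandwich[OF _ _ tendsto_const lim])
    show "\<forall>\<^sub>F m in sequentially. (\<integral>\<^sup>+s. ennreal (((\<Sum>i\<in>insert j I. a i * h i m s) - (\<Sum>i\<in>insert j I. a i * g i s))\<^sup>2) \<partial>N)
        \<le> ennreal (2 * (a j)\<^sup>2) * ?A m + ennreal 2 * ?B m"
      by (intro always_eventually allI le)
  qed simp
qed simp

lemma (in prob_space) char_L2_limit:
  assumes [measurable]: "\<And>m. S m \<in> borel_measurable M" "Y \<in> borel_measurable M"
    and lim: "(\<lambda>m. \<integral>\<^sup>+\<omega>. ennreal ((S m \<omega> - Y \<omega>)\<^sup>2) \<partial>M) \<longlonglongrightarrow> 0"
  shows "(\<lambda>m. CLINT \<omega>|M. iexp (S m \<omega>)) \<longlonglongrightarrow> (CLINT \<omega>|M. iexp (Y \<omega>))"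
proof (rule LIMSEQ_I)
  fix r :: real assume r: "0 < r"
  \<comment> \<open>The Lipschitz bound |x - y| is split by the inequality of arithmetic and
    geometric means, weighted so that a mean square distance below r^2 gives a total below
    r.\<close>
  have pt: "norm (iexp x - iexp y) \<le> r / 2 + (x - y)\<^sup>2 / (2 * r)" for x y
  proof -
    have "iexp y * iexp (x - y) = iexp x"
      unfolding exp_add[symmetric] by (simp add: algebra_simps)
    then have "iexp x - iexp y = iexp y * (iexp (x - y) - 1)"
      by (simp only: right_diff_distrib mult_1_right)
    then have "norm (iexp x - iexp y) = norm (iexp (x - y) - 1)"
      by (simp add: norm_mult)
    also have "\<dots> \<le> \<bar>x - y\<bar>"
      using iexp_approx1[of "x - y" 0] by simp
    also have "\<dots> \<le> r / 2 + (x - y)\<^sup>2 / (2 * r)"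
      using sum_squares_bound[of "\<bar>x - y\<bar>" r] r by (simp add: field_simps power2_eq_square)
    finally show ?thesis .
  qed
  have "\<forall>\<^sub>F m in sequentially. (\<integral>\<^sup>+\<omega>. ennreal ((S m \<omega> - Y \<omega>)\<^sup>2) \<partial>M) < ennreal (r\<^sup>2)"
    using lim by (rule order_tendstoD) (use r in simp)
  then have "\<forall>\<^sub>F m in sequentially. norm ((CLINT \<omega>|M. iexp (S m \<omega>)) - (CLINT \<omega>|M. iexp (Y \<omega>))) < r"
  proof eventually_elim
    case (elim m)
    have int: "integrable M (\<lambda>\<omega>. (S m \<omega> - Y \<omega>)\<^sup>2)"
      using less_trans[OF elim ennreal_less_top] by (intro integrableI_bounded) auto
    then have lt: "expectation (\<lambda>\<omega>. (S m \<omega> - Y \<omega>)\<^sup>2) < r\<^sup>2"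
      using elim r by (simp add: nn_integral_eq_integral ennreal_less_iff)
    have i: "integrable M (\<lambda>\<omega>. iexp (S m \<omega>))" "integrable M (\<lambda>\<omega>. iexp (Y \<omega>))"
      by (auto intro!: integrable_iexp)
    have "norm ((CLINT \<omega>|M. iexp (S m \<omega>)) - (CLINT \<omega>|M. iexp (Y \<omega>))) = norm (CLINT \<omega>|M. iexp (S m \<omega>) - iexp (Y \<omega>))"
      using i by simp
    also have "\<dots> \<le> expectation (\<lambda>\<omega>. norm (iexp (S m \<omega>) - iexp (Y \<omega>)))"
      by (rule integral_norm_bound)
    also have "\<dots> \<le> expectation (\<lambda>\<omega>. r / 2 + (S m \<omega> - Y \<omega>)\<^sup>2 / (2 * r))"
      by (rule integral_mono) (use i int pt in auto)
    also have "\<dots> = r / 2 + expectation (\<lambda>\<omega>. (S m \<omega> - Y \<omega>)\<^sup>2) / (2 * r)"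
      using int by (simp add: prob_space)
    also have "\<dots> < r / 2 + r\<^sup>2 / (2 * r)"
      using lt r by (intro add_strict_left_mono divide_strict_right_mono) auto
    also have "\<dots> = r" using r by (simp add: power2_eq_square)
    finally show ?case .
  qed
  then show "\<exists>no. \<forall>n\<ge>no. norm ((CLINT \<omega>|M. iexp (S n \<omega>)) - (CLINT \<omega>|M. iexp (Y \<omega>))) < r"
    by (simp add: eventually_sequentially)
qed

lemma step_function_measurable [measurable]: "step_function n p c \<in> borel_measurable borel"
  unfolding step_function_def[abs_def] by measurable

lemma mono_partition:
  fixes p :: "nat \<Rightarrow> real"
  assumes "\<And>i. i < n \<Longrightarrow> p i \<le> p (Suc i)" "i \<le> j" "j \<le> n"
  shows "p i \<le> p j"
  using assms(2,3)
proof (induction j)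
  case (Suc j)
  then show ?case using assms(1)[of j] by (cases "i = Suc j") auto
qed auto

text \<open>A linear combination of step integrals is again a weighted sum of increments, so its law
  is explicit and both sides pass to the L2 limit. Joint laws at several times require this for
  different horizons \<open>u i\<close> at once; extension by zero places all integrands on one
  line.\<close>

lemma wiener_integral_char:
  assumes W: "wiener_process M B" and I: "finite I"
    and int: "\<And>i. i \<in> I \<Longrightarrow> is_wiener_integral M B (u i) (f i) (X i)"
  shows "(CLINT \<omega>|M. iexp (\<Sum>i\<in>I. a i * X i \<omega>))
       = of_real (exp (- ((LINT s|lborel. (\<Sum>i\<in>I. a i * (indicator {0..u i} s * f i s))\<^sup>2) / 2)))"
proof -
  interpret prob_space M using W by (simp add: wiener_process_def)
  define F where "F i s = indicator {0..u i} s * f i s" for i s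
  have [measurable]: "F i \<in> borel_measurable borel" "X i \<in> borel_measurable M" if "i \<in> I" for i
    using int[OF that] unfolding is_wiener_integral_def set_borel_measurable_def F_def[abs_def] by auto
  define approx where "approx i n p c \<longleftrightarrow> (\<forall>m. 0 \<le> p m 0 \<and> (\<forall>j<n m. p m j \<le> p m (Suc j)) \<and> p m (n m) \<le> u i) \<and>
        ((\<lambda>m. \<integral>\<^sup>+s\<in>{0..u i}. ennreal ((f i s - step_function (n m) (p m) (c m) s)\<^sup>2) \<partial>lborel) \<longlonglongrightarrow> 0) \<and>
        ((\<lambda>m. \<integral>\<^sup>+\<omega>. ennreal ((X i \<omega> - step_integral B (n m) (p m) (c m) \<omega>)\<^sup>2) \<partial>M) \<longlonglongrightarrow> 0)"
    for i and n :: "nat \<Rightarrow> nat" and p c :: "nat \<Rightarrow> nat \<Rightarrow> real"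
  have "\<forall>i\<in>I. \<exists>n p c. approx i n p c"
    using int unfolding is_wiener_integral_def approx_def by blast
  then obtain n where "\<forall>i\<in>I. \<exists>p c. approx i (n i) p c" using bchoice by meson
  then obtain p where "\<forall>i\<in>I. \<exists>c. approx i (n i) (p i) c" using bchoice by meson
  then obtain c where "\<forall>i\<in>I. approx i (n i) (p i) (c i)" using bchoice by meson
  then have npc: "\<And>i m. i \<in> I \<Longrightarrow> 0 \<le> p i m 0 \<and> (\<forall>j<n i m. p i m j \<le> p i m (Suc j)) \<and> p i m (n i m) \<le> u i"
      "\<And>i. i \<in> I \<Longrightarrow> (\<lambda>m. \<integral>\<^sup>+s\<in>{0..u i}. ennreal ((f i s - step_function (n i m) (p i m) (c i m) s)\<^sup>2) \<partial>lborel) \<longlonglongrightarrow> 0"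
      "\<And>i. i \<in> I \<Longrightarrow> (\<lambda>m. \<integral>\<^sup>+\<omega>. ennreal ((X i \<omega> - step_integral B (n i m) (p i m) (c i m) \<omega>)\<^sup>2) \<partial>M) \<longlonglongrightarrow> 0"
    unfolding approx_def by blast+
  have p_le: "p i m j \<le> p i m k" if "i \<in> I" "j \<le> k" "k \<le> n i m" for i j k m
    using mono_partition[of "n i m" "p i m"] npc(1)[of i m] that by auto
  have p_nonneg: "0 \<le> p i m j" if "i \<in> I" "j \<le> n i m" for i j m
    using p_le[of i 0 j m] npc(1)[of i m] that by auto
  have p_u: "p i m j \<le> u i" if "i \<in> I" "j \<le> n i m" for i j m
    using p_le[of i j "n i m" m] npc(1)[of i m] that by auto
  define h where "h i m = step_function (n i m) (p i m) (c i m)" for i m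
  define S where "S i m = step_integral B (n i m) (p i m) (c i m)" for i m
  have [measurable]: "h i m \<in> borel_measurable borel" for i m unfolding h_def by measurable
  have [measurable]: "S i m \<in> borel_measurable M" if "i \<in> I" for i m
    using W p_nonneg[OF that] unfolding S_def step_integral_def[abs_def] wiener_process_def
    by (intro borel_measurable_sum borel_measurable_times borel_measurable_diff) auto
  \<comment> \<open>The partitions stay inside {0..u i}, so the step functions vanish outside and
    approximate the integrand extended by zero on the whole line.\<close>
  have hlim: "(\<lambda>m. \<integral>\<^sup>+s. ennreal ((h i m s - F i s)\<^sup>2) \<partial>lborel) \<longlonglongrightarrow> 0" if i: "i \<in> I" for i
  proof -
    have "ennreal ((f i s - h i m s)\<^sup>2) * indicator {0..u i} s = ennreal ((h i m s - F i s)\<^sup>2)" for s m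
    proof (cases "s \<in> {0..u i}")
      case False
      have "indicator {p i m j<..p i m (Suc j)} s = (0::real)" if "j < n i m" for j
        using False p_nonneg[OF i, of j m] p_u[OF i, of "Suc j" m] that by (auto simp: indicator_def)
      then have "h i m s = 0" by (simp add: h_def step_function_def)
      then show ?thesis using False by (simp add: F_def)
    qed (simp add: F_def power2_commute)
    then show ?thesis using npc(2)[OF i] by (simp add: h_def)
  qed
  have Slim: "(\<lambda>m. \<integral>\<^sup>+\<omega>. ennreal ((S i m \<omega> - X i \<omega>)\<^sup>2) \<partial>M) \<longlonglongrightarrow> 0" if "i \<in> I" for i
    using npc(3)[OF that] by (simp add: S_def power2_commute)
  \<comment> \<open>All cells of all partitions are indexed together; they may overlap for different
    i, which \<open>wiener_increments_char\<close> permits.\<close>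
  define J where "J m = Sigma I (\<lambda>i. {..<n i m})" for m
  define d where "d m = (\<lambda>(i, l). a i * c i m l)" for m
  define U where "U m = (\<lambda>(i, l). p i m l)" for m
  define V where "V m = (\<lambda>(i, l). p i m (Suc l))" for m
  have J: "finite (J m)" for m using I by (simp add: J_def)
  have UV: "0 \<le> U m j" "U m j \<le> V m j" if "j \<in> J m" for j m
    using that p_nonneg p_le by (auto simp: J_def U_def V_def)
  have Ssum: "(\<Sum>i\<in>I. a i * S i m \<omega>) = (\<Sum>j\<in>J m. d m j * (B (V m j) \<omega> - B (U m j) \<omega>))" for m \<omega>
  proof -
    have "(\<Sum>i\<in>I. a i * S i m \<omega>) = (\<Sum>i\<in>I. \<Sum>l<n i m. a i * c i m l * (B (p i m (Suc l)) \<omega> - B (p i m l) \<omega>))"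
      by (simp add: S_def step_integral_def sum_distrib_left mult.assoc)
    also have "\<dots> = (\<Sum>(i, l)\<in>J m. a i * c i m l * (B (p i m (Suc l)) \<omega> - B (p i m l) \<omega>))"
      unfolding J_def by (rule sum.Sigma) (use I in auto)
    finally show ?thesis by (simp add: d_def U_def V_def case_prod_beta')
  qed
  have hsum: "(\<Sum>i\<in>I. a i * h i m s) = (\<Sum>j\<in>J m. d m j * indicator {U m j<..V m j} s)" for m s
  proof -
    have "(\<Sum>i\<in>I. a i * h i m s) = (\<Sum>i\<in>I. \<Sum>l<n i m. a i * c i m l * indicator {p i m l<..p i m (Suc l)} s)"
      by (simp only: h_def step_function_def sum_distrib_left mult.assoc)
    also have "\<dots> = (\<Sum>(i, l)\<in>J m. a i * c i m l * indicator {p i m l<..p i m (Suc l)} s)"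
      unfolding J_def by (rule sum.Sigma) (use I in auto)
    finally show ?thesis by (simp add: d_def U_def V_def case_prod_beta')
  qed
  have char: "(CLINT \<omega>|M. iexp (\<Sum>i\<in>I. a i * S i m \<omega>)) = of_real (exp (- ((LINT s|lborel. (\<Sum>i\<in>I. a i * h i m s)\<^sup>2) / 2)))" for m
    unfolding Ssum hsum by (rule wiener_increments_char(1)[OF W J UV])
  have "(\<lambda>m. LINT s|lborel. (\<Sum>i\<in>I. a i * h i m s)\<^sup>2) \<longlonglongrightarrow> (LINT s|lborel. (\<Sum>i\<in>I. a i * F i s)\<^sup>2)"
  proof (rule L2_limit_norm)
    show "integrable lborel (\<lambda>s. (\<Sum>i\<in>I. a i * h i m s)\<^sup>2)" for m
      unfolding hsum by (rule wiener_increments_char(2)[OF W J UV])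
    show "(\<lambda>m. \<integral>\<^sup>+s. ennreal (((\<Sum>i\<in>I. a i * h i m s) - (\<Sum>i\<in>I. a i * F i s))\<^sup>2) \<partial>lborel) \<longlonglongrightarrow> 0"
      by (rule L2_limit_sum[OF I _ _ hlim]) auto
  qed measurable
  then have "(\<lambda>m. complex_of_real (exp (- ((LINT s|lborel. (\<Sum>i\<in>I. a i * h i m s)\<^sup>2) / 2))))
      \<longlonglongrightarrow> of_real (exp (- ((LINT s|lborel. (\<Sum>i\<in>I. a i * F i s)\<^sup>2) / 2)))"
    by (intro tendsto_intros) auto
  moreover have "(\<lambda>m. CLINT \<omega>|M. iexp (\<Sum>i\<in>I. a i * S i m \<omega>)) \<longlonglongrightarrow> (CLINT \<omega>|M. iexp (\<Sum>i\<in>I. a i * X i \<omega>))"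
  proof (rule char_L2_limit)
    show "(\<lambda>m. \<integral>\<^sup>+\<omega>. ennreal (((\<Sum>i\<in>I. a i * S i m \<omega>) - (\<Sum>i\<in>I. a i * X i \<omega>))\<^sup>2) \<partial>M) \<longlonglongrightarrow> 0"
      by (rule L2_limit_sum[OF I _ _ Slim]) auto
  qed measurable
  ultimately show ?thesis
    unfolding char F_def by (intro LIMSEQ_unique)
qed

section \<open>Riemann sums and functionals of the path on compact subintervals\<close>

lemma integrable_indicator_Icc: "integrable lborel (indicator {a..b} :: real \<Rightarrow> real)"
  by (rule integrable_real_indicator) (auto simp: emeasure_lborel_Icc_eq)

text \<open>Continuity is only required almost everywhere because the kernel of the bridge jumps.\<close>

lemma riemann_sum_tendsto:
  fixes g :: "real \<Rightarrow> real"
  assumes b: "0 < b" and bound: "\<And>t. t \<in> {0..b} \<Longrightarrow> \<bar>g t\<bar> \<le> C"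
    and cont: "AE t in lborel. t \<in> {0<..<b} \<longrightarrow> isCont g t"
    and meas: "set_borel_measurable lborel {0..b} g"
  shows "(\<lambda>n. \<Sum>i<Suc n. b / real (Suc n) * g (real i * b / real (Suc n))) \<longlonglongrightarrow> (LINT t:{0..b}|lborel. g t)"
proof -
  define x where "x n i = real i * b / real (Suc n)" for n i
  define F where "F n t = (\<Sum>i<Suc n. g (x n i) * indicator {x n i..<x n (Suc i)} t)" for n t
  have len: "x n (Suc i) - x n i = b / real (Suc n)" for n i
    by (simp add: x_def diff_divide_distrib[symmetric] algebra_simps)
  have x_le: "x n i \<le> x n (Suc i)" for n i
    using b by (auto simp: x_def intro!: divide_right_mono mult_right_mono)
  have x_mem: "x n i \<in> {0..b}" if "i < Suc n" for n i
  proof -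
    have "real i * b \<le> real (Suc n) * b" using b that by (intro mult_right_mono) auto
    then show ?thesis using b by (simp add: x_def divide_le_eq mult.commute)
  qed
  have int_F: "(LINT t|lborel. F n t) = (\<Sum>i<Suc n. b / real (Suc n) * g (x n i))" for n
  proof -
    have "(LINT t|lborel. F n t) = (\<Sum>i<Suc n. g (x n i) * (x n (Suc i) - x n i))"
      unfolding F_def using x_le by (subst Bochner_Integration.integral_sum) auto
    then show ?thesis unfolding len by (simp only: mult.commute)
  qed
  \<comment> \<open>A point of [0,b) lies in exactly one half-open cell, whose number is the
    rounded-down quotient; the step function takes the value of g at the left end of this
    cell.\<close>
  have F_eq: "F n t = g (x n (nat \<lfloor>t * real (Suc n) / b\<rfloor>))" "nat \<lfloor>t * real (Suc n) / b\<rfloor> < Suc n" if t: "t \<in> {0..<b}" for n t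
  proof -
    define k where "k = nat \<lfloor>t * real (Suc n) / b\<rfloor>"
    have nn: "0 \<le> t * real (Suc n) / b" using t b by simp
    have k: "real k \<le> t * real (Suc n) / b" "t * real (Suc n) / b < real k + 1"
    proof -
      have "real k = of_int \<lfloor>t * real (Suc n) / b\<rfloor>" using nn by (simp add: k_def)
      then show "real k \<le> t * real (Suc n) / b" "t * real (Suc n) / b < real k + 1" by linarith+
    qed
    have "t * real (Suc n) < b * real (Suc n)" using t by (intro mult_strict_right_mono) auto
    then have "t * real (Suc n) / b < real (Suc n)" using b by (simp only: pos_divide_less_eq mult.commute)
    then have kn: "k < Suc n" using k(1) by linarith
    have iff: "t \<in> {x n i..<x n (Suc i)} \<longleftrightarrow> i = k" for i
    proof -
      have "x n i \<le> t \<longleftrightarrow> real i \<le> t * real (Suc n) / b" "t < x n (Suc i) \<longleftrightarrow> t * real (Suc n) / b < real i + 1"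
        using b by (simp_all add: x_def pos_divide_le_eq pos_le_divide_eq pos_less_divide_eq pos_divide_less_eq algebra_simps)
      then have "t \<in> {x n i..<x n (Suc i)} \<longleftrightarrow> real i \<le> t * real (Suc n) / b \<and> t * real (Suc n) / b < real i + 1"
        by simp
      also have "\<dots> \<longleftrightarrow> i = k" using k by (auto; linarith)
      finally show ?thesis .
    qed
    have "F n t = (\<Sum>i<Suc n. if i = k then g (x n i) else 0)"
      unfolding F_def by (intro sum.cong) (auto simp: indicator_def iff simp del: atLeastLessThan_iff)
    then show "F n t = g (x n (nat \<lfloor>t * real (Suc n) / b\<rfloor>))" "nat \<lfloor>t * real (Suc n) / b\<rfloor> < Suc n"
      using kn by (simp_all add: k_def)
  qed
  have F_0: "F n t = 0" if "t \<notin> {0..<b}" for n t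
  proof -
    have "indicator {x n i..<x n (Suc i)} t = (0::real)" if "i < Suc n" for i
    proof -
      have "x n (Suc i) \<le> b"
      proof -
        have "real (Suc i) * b \<le> real (Suc n) * b" using b that by (intro mult_right_mono) auto
        then show ?thesis using b by (simp add: x_def divide_le_eq mult.commute)
      qed
      moreover have "0 \<le> x n i" using x_mem[OF that] by simp
      ultimately show ?thesis using \<open>t \<notin> {0..<b}\<close> by (auto simp: indicator_def)
    qed
    then show ?thesis by (simp add: F_def)
  qed
  have "(\<lambda>n. LINT t|lborel. F n t) \<longlonglongrightarrow> (LINT t|lborel. indicator {0..b} t *\<^sub>R g t)"
  proof (rule integral_dominated_convergence[where w="\<lambda>t. C * indicator {0..b} t"])
    show "(\<lambda>t. indicator {0..b} t *\<^sub>R g t) \<in> borel_measurable lborel"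
      using meas by (simp add: set_borel_measurable_def)
    show "F n \<in> borel_measurable lborel" for n unfolding F_def[abs_def] by measurable
    show "AE t in lborel. norm (F n t) \<le> C * indicator {0..b} t" for n
    proof (rule AE_I2)
      fix t
      show "norm (F n t) \<le> C * indicator {0..b} t"
      proof (cases "t \<in> {0..<b}")
        case True
        then show ?thesis using F_eq[OF True, of n] bound x_mem[of _ n] by (auto simp: indicator_def)
      next
        case False
        have "0 \<le> C" using bound[of 0] b by auto
        then show ?thesis using F_0[OF False, of n] by simp
      qed
    qed
    \<comment> \<open>The end points are discarded as null: continuity is given only inside, and at
      b the step functions vanish.\<close>
    show "AE t in lborel. (\<lambda>n. F n t) \<longlonglongrightarrow> indicator {0..b} t *\<^sub>R g t"
      using cont AE_lborel_singleton[of 0] AE_lborel_singleton[of b]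
    proof eventually_elim
      case (elim t)
      consider "t \<in> {0<..<b}" | "t \<notin> {0..b}" using elim by (cases "t \<in> {0..b}") auto
      then show ?case
      proof cases
        case 1
        then have c: "isCont g t" using elim by blast
        have "(\<lambda>n. x n (nat \<lfloor>t * real (Suc n) / b\<rfloor>)) \<longlonglongrightarrow> t"
        proof (rule tendsto_sandwich[where f="\<lambda>n. t - b / real (Suc n)" and h="\<lambda>n. t"])
          have bd: "t - b / real (Suc n) \<le> x n (nat \<lfloor>t * real (Suc n) / b\<rfloor>) \<and> x n (nat \<lfloor>t * real (Suc n) / b\<rfloor>) \<le> t" for n
          proof -
            define y where "y = t * real (Suc n) / b"
            have y: "0 \<le> y" using 1 b by (simp add: y_def)
            have k: "real (nat \<lfloor>y\<rfloor>) \<le> y" "y - 1 \<le> real (nat \<lfloor>y\<rfloor>)" 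
            proof -
              have "real (nat \<lfloor>y\<rfloor>) = of_int \<lfloor>y\<rfloor>" using y by simp
              then show "real (nat \<lfloor>y\<rfloor>) \<le> y" "y - 1 \<le> real (nat \<lfloor>y\<rfloor>)" by linarith+
            qed
            have "y * b / real (Suc n) = t" using b by (simp add: y_def)
            moreover have "real (nat \<lfloor>y\<rfloor>) * b / real (Suc n) \<le> y * b / real (Suc n)"
              using k b by (intro divide_right_mono mult_right_mono) auto
            moreover have "(y - 1) * b / real (Suc n) \<le> real (nat \<lfloor>y\<rfloor>) * b / real (Suc n)"
              using k b by (intro divide_right_mono mult_right_mono) auto
            ultimately show ?thesis unfolding y_def[symmetric] x_def
              by (simp add: left_diff_distrib diff_divide_distrib)
          qed
          show "\<forall>\<^sub>F n in sequentially. t - b / real (Suc n) \<le> x n (nat \<lfloor>t * real (Suc n) / b\<rfloor>)"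
            "\<forall>\<^sub>F n in sequentially. x n (nat \<lfloor>t * real (Suc n) / b\<rfloor>) \<le> t"
            using bd by (auto intro!: always_eventually)
          show "(\<lambda>n. t - b / real (Suc n)) \<longlonglongrightarrow> t" by real_asymp
        qed simp
        from isCont_tendsto_compose[OF c this]
        show ?thesis using 1 F_eq(1)[of t] by (simp add: indicator_def)
      next
        case 2
        then have "F n t = 0" for n by (intro F_0) auto
        then show ?thesis using 2 by simp
      qed
    qed
  qed (simp add: integrable_indicator_Icc)
  then show ?thesis
    unfolding int_F set_lebesgue_integral_def x_def .
qed

lemma continuous_on_Icc_bound:
  fixes f :: "real \<Rightarrow> real"
  assumes "continuous_on {a..b} f"
  obtains C where "\<And>t. t \<in> {a..b} \<Longrightarrow> \<bar>f t\<bar> \<le> C"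
proof -
  have "bounded (f ` {a..b})"
    by (intro compact_imp_bounded compact_continuous_image assms) simp
  then obtain C where "\<forall>x\<in>f ` {a..b}. norm x \<le> C" by (auto simp: bounded_iff)
  then show ?thesis by (intro that) auto
qed

lemma riemann_sum_tendsto_continuous:
  fixes g :: "real \<Rightarrow> real"
  assumes b: "0 < b" and cont: "continuous_on {0..b} g"
  shows "(\<lambda>n. \<Sum>i<Suc n. b / real (Suc n) * g (real i * b / real (Suc n))) \<longlonglongrightarrow> (LINT t:{0..b}|lborel. g t)"
proof -
  obtain C where C: "\<And>t. t \<in> {0..b} \<Longrightarrow> \<bar>g t\<bar> \<le> C"
    using continuous_on_Icc_bound[OF cont] by blast
  show ?thesis
  proof (rule riemann_sum_tendsto[OF b C])
    show "AE t in lborel. t \<in> {0<..<b} \<longrightarrow> isCont g t"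
      using continuous_on_interior[OF cont] by (intro AE_I2) (auto simp: interior_atLeastAtMost_real)
    show "set_borel_measurable lborel {0..b} g"
      using borel_measurable_continuous_on_indicator[OF _ cont]
      by (simp add: set_borel_measurable_def indicator_def if_distrib)
  qed
qed

text \<open>The integrand of \<open>X t\<close>, extended by zero beyond t, so that values of X at
  different times are represented over the same domain.\<close>

definition bridge_kernel :: "real \<Rightarrow> real \<Rightarrow> real \<Rightarrow> real \<Rightarrow> real" where
  "bridge_kernel \<alpha> T t s = indicator {0..t} s * ((T - t) / (T - s)) powr \<alpha>"

lemma bridge_kernel_measurable [measurable]:
  "(\<lambda>s. bridge_kernel \<alpha> T t s) \<in> borel_measurable borel"
  "(\<lambda>t. bridge_kernel \<alpha> T t s) \<in> borel_measurable borel"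
proof -
  show "(\<lambda>s. bridge_kernel \<alpha> T t s) \<in> borel_measurable borel"
    unfolding bridge_kernel_def by measurable
  have "(\<lambda>t. bridge_kernel \<alpha> T t s) = (\<lambda>t. if 0 \<le> s \<and> s \<le> t then ((T - t) / (T - s)) powr \<alpha> else 0)"
    by (auto simp: bridge_kernel_def fun_eq_iff)
  then show "(\<lambda>t. bridge_kernel \<alpha> T t s) \<in> borel_measurable borel" by simp
qed

lemma bridge_kernel_bounds:
  assumes "0 < \<alpha>" "t < T"
  shows "0 \<le> bridge_kernel \<alpha> T t s" "bridge_kernel \<alpha> T t s \<le> 1"
proof -
  have "((T - t) / (T - s)) powr \<alpha> \<le> 1 powr \<alpha>" if "0 \<le> s" "s \<le> t"
    using that assms by (intro powr_mono2) auto
  then show "0 \<le> bridge_kernel \<alpha> T t s" "bridge_kernel \<alpha> T t s \<le> 1"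
    by (auto simp: bridge_kernel_def indicator_def)
qed

lemma bridge_kernel_eq_0: "s \<notin> {0..t} \<Longrightarrow> bridge_kernel \<alpha> T t s = 0"
  by (simp add: bridge_kernel_def)

lemma isCont_bridge_kernel:
  assumes "t < T" "t \<noteq> s"
  shows "isCont (\<lambda>t. bridge_kernel \<alpha> T t s) t"
proof (cases "0 \<le> s \<and> s < t")
  case True
  have ev: "\<forall>\<^sub>F x in nhds t. bridge_kernel \<alpha> T x s = ((T - x) / (T - s)) powr \<alpha>"
    using eventually_nhds_in_open[of "{s<..}" t] True
    by (auto elim!: eventually_mono simp: bridge_kernel_def)
  have "isCont (\<lambda>x. ((T - x) / (T - s)) powr \<alpha>) t"
    using assms True by (intro continuous_intros) auto
  then show ?thesis using isCont_cong[OF ev] by simp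
next
  case False
  have ev: "\<forall>\<^sub>F x in nhds t. bridge_kernel \<alpha> T x s = 0"
  proof (cases "0 \<le> s")
    case True
    then have "t < s" using False assms by auto
    then show ?thesis
      using eventually_nhds_in_open[of "{..<s}" t]
      by (auto elim!: eventually_mono simp: bridge_kernel_def)
  qed (auto simp: bridge_kernel_def)
  show ?thesis using isCont_cong[OF ev] by simp
qed

text \<open>For fixed s the kernel jumps in t only at t = s, a null set. The power j = 1 serves
  linear functionals, j = 2 the second moment.\<close>

lemma riemann_sum_bridge_kernel:
  fixes e :: "real \<Rightarrow> real"
  assumes \<alpha>: "0 < \<alpha>" and b: "0 < b" "b < T" and e: "continuous_on {0..b} e" and j: "0 < j"
  shows "(\<lambda>n. \<Sum>i<Suc n. b / real (Suc n) * (bridge_kernel \<alpha> T (real i * b / real (Suc n)) s ^ j * e (real i * b / real (Suc n))))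
      \<longlonglongrightarrow> (LINT t:{0..b}|lborel. bridge_kernel \<alpha> T t s ^ j * e t)"
proof -
  obtain C where C: "\<And>t. t \<in> {0..b} \<Longrightarrow> \<bar>e t\<bar> \<le> C"
    using continuous_on_Icc_bound[OF e] by blast
  show ?thesis
  proof (rule riemann_sum_tendsto[OF b(1)])
    show "\<bar>bridge_kernel \<alpha> T t s ^ j * e t\<bar> \<le> C" if "t \<in> {0..b}" for t
    proof -
      have "bridge_kernel \<alpha> T t s ^ j \<le> 1" "0 \<le> bridge_kernel \<alpha> T t s ^ j"
        using bridge_kernel_bounds[OF \<alpha>, of t T s] that b by (auto intro!: power_le_one)
      then have "\<bar>bridge_kernel \<alpha> T t s ^ j * e t\<bar> \<le> 1 * \<bar>e t\<bar>"
        unfolding abs_mult by (intro mult_right_mono) auto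
      then show ?thesis using C[OF that] by simp
    qed
    show "AE t in lborel. t \<in> {0<..<b} \<longrightarrow> isCont (\<lambda>t. bridge_kernel \<alpha> T t s ^ j * e t) t"
      using AE_lborel_singleton[of s]
    proof eventually_elim
      case (elim t)
      show ?case
      proof
        assume t: "t \<in> {0<..<b}"
        have "isCont e t" using continuous_on_interior[OF e, of t] t by (simp add: interior_atLeastAtMost_real)
        then show "isCont (\<lambda>t. bridge_kernel \<alpha> T t s ^ j * e t) t"
          using t b elim by (intro continuous_intros isCont_bridge_kernel) auto
      qed
    qed
    have [measurable]: "(\<lambda>t. indicator {0..b} t *\<^sub>R e t) \<in> borel_measurable borel"
      using borel_measurable_continuous_on_indicator[OF _ e] by simp
    have "(\<lambda>t. bridge_kernel \<alpha> T t s ^ j * (indicator {0..b} t *\<^sub>R e t)) \<in> borel_measurable borel"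
      by measurable
    then show "set_borel_measurable lborel {0..b} (\<lambda>t. bridge_kernel \<alpha> T t s ^ j * e t)"
      by (simp add: set_borel_measurable_def mult_ac)
  qed
qed

text \<open>What is retained of the bridge: measurability at each time, continuous paths almost
  surely and the joint characteristic function. The Wiener process itself no longer appears.\<close>

locale gaussian_bridge = prob_space M for M :: "'a measure" +
  fixes X :: "real \<Rightarrow> 'a \<Rightarrow> real" and T \<alpha> :: real
  assumes T: "0 < T" and \<alpha>: "0 < \<alpha>"
    and X_meas: "\<And>t. 0 \<le> t \<Longrightarrow> t < T \<Longrightarrow> X t \<in> borel_measurable M"
    and X_cont: "AE \<omega> in M. continuous_on {0..<T} (\<lambda>t. X t \<omega>)"
    and X_char: "\<And>(I :: nat set) a t. finite I \<Longrightarrow> (\<And>i. i \<in> I \<Longrightarrow> 0 \<le> t i \<and> t i < T) \<Longrightarrow>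
        (CLINT \<omega>|M. iexp (\<Sum>i\<in>I. a i * X (t i) \<omega>))
          = of_real (exp (- ((LINT s|lborel. (\<Sum>i\<in>I. a i * bridge_kernel \<alpha> T (t i) s)\<^sup>2) / 2)))"
begin

abbreviation kern where "kern \<equiv> bridge_kernel \<alpha> T"

lemma grid:
  assumes "0 < b" "b < T" "i < Suc n"
  shows "0 \<le> real i * b / real (Suc n)" "real i * b / real (Suc n) \<le> b" "real i * b / real (Suc n) < T"
proof -
  have "real i * b \<le> real (Suc n) * b" using assms by (intro mult_right_mono) auto
  then show "real i * b / real (Suc n) \<le> b" by (simp add: divide_le_eq mult.commute)
  then show "real i * b / real (Suc n) < T" using assms by simp
  show "0 \<le> real i * b / real (Suc n)" using assms by simp
qed

lemma grid_nonzero: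
  assumes "0 < b" "b < T" "i < Suc n" "s \<notin> {0..b}"
  shows "kern (real i * b / real (Suc n)) s = 0"
  using grid[OF assms(1-3)] assms(4) by (intro bridge_kernel_eq_0) auto

text \<open>The functional of \<open>X\<close> over \<open>[0,b]\<close> is only almost surely the path integral; the limit
  of the Riemann sums is a measurable version of it.\<close>

lemma ex_integral_version:
  assumes b: "0 < b" "b < T" and e: "continuous_on {0..b} e"
  obtains \<xi> where "\<xi> \<in> borel_measurable M" "AE \<omega> in M. \<xi> \<omega> = (LINT t:{0..b}|lborel. X t \<omega> * e t)"
    "(CLINT \<omega>|M. iexp (\<xi> \<omega>)) = of_real (exp (- ((LINT s|lborel. (LINT t:{0..b}|lborel. kern t s * e t)\<^sup>2) / 2)))"
proof -
  define x where "x n i = real i * b / real (Suc n)" for n i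
  note grid' = grid[OF b, folded x_def]
  define S where "S n \<omega> = (\<Sum>i<Suc n. b / real (Suc n) * (X (x n i) \<omega> * e (x n i)))" for n \<omega>
  define K where "K n s = (\<Sum>i<Suc n. b / real (Suc n) * (kern (x n i) s * e (x n i)))" for n s
  define \<psi> where "\<psi> s = (LINT t:{0..b}|lborel. kern t s * e t)" for s
  have [measurable]: "S n \<in> borel_measurable M" for n
    unfolding S_def[abs_def] using grid' by (intro borel_measurable_sum borel_measurable_times X_meas) auto
  have [measurable]: "K n \<in> borel_measurable borel" for n
    unfolding K_def[abs_def] by measurable
  have K_lim: "(\<lambda>n. K n s) \<longlonglongrightarrow> \<psi> s" for s
    using riemann_sum_bridge_kernel[OF \<alpha> b e, of 1 s] by (simp add: K_def x_def \<psi>_def)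
  have [measurable]: "\<psi> \<in> borel_measurable borel"
    by (rule borel_measurable_LIMSEQ_real[OF K_lim]) auto
  have S_char: "(CLINT \<omega>|M. iexp (S n \<omega>)) = of_real (exp (- ((LINT s|lborel. (K n s)\<^sup>2) / 2)))" for n
    using X_char[of "{..<Suc n}" "x n" "\<lambda>i. b / real (Suc n) * e (x n i)"] grid'
    unfolding S_def K_def by (simp only: finite_lessThan lessThan_iff mult_ac)
  obtain C where C: "\<And>t. t \<in> {0..b} \<Longrightarrow> \<bar>e t\<bar> \<le> C"
    using continuous_on_Icc_bound[OF e] by blast
  have "0 \<le> C" using C[of 0] b by auto
  have K_bound: "\<bar>K n s\<bar> \<le> b * C * indicator {0..b} s" for n s
  proof (cases "s \<in> {0..b}")
    case True
    have "\<bar>K n s\<bar> \<le> (\<Sum>i<Suc n. \<bar>b / real (Suc n) * (kern (x n i) s * e (x n i))\<bar>)"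
      unfolding K_def by (rule sum_abs)
    also have "\<dots> \<le> (\<Sum>i<Suc n. b / real (Suc n) * (1 * C))"
    proof (intro sum_mono)
      fix i assume "i \<in> {..<Suc n}"
      then have i: "i < Suc n" by simp
      have "\<bar>kern (x n i) s * e (x n i)\<bar> \<le> 1 * C"
        unfolding abs_mult using bridge_kernel_bounds[OF \<alpha> grid'(3)[OF i], of s] C[of "x n i"] grid'[OF i]
        by (intro mult_mono) auto
      then show "\<bar>b / real (Suc n) * (kern (x n i) s * e (x n i))\<bar> \<le> b / real (Suc n) * (1 * C)"
        unfolding abs_mult[of "b / real (Suc n)"] using b by (intro mult_mono) auto
    qed
    also have "\<dots> = b * C" by simp
    finally show ?thesis using True by simp
  next
    case False
    then show ?thesis
      using grid_nonzero[OF b _ False, folded x_def] by (simp add: K_def)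
  qed
  \<comment> \<open>The variance of a Riemann sum of X is the squared norm of the Riemann sum of the
    kernel, which is bounded by b * C and supported in {0..b}.\<close>
  have var_lim: "(\<lambda>n. LINT s|lborel. (K n s)\<^sup>2) \<longlonglongrightarrow> (LINT s|lborel. (\<psi> s)\<^sup>2)"
  proof (rule integral_dominated_convergence[where w="\<lambda>s. (b * C)\<^sup>2 * indicator {0..b} s"])
    show "AE s in lborel. norm ((K n s)\<^sup>2) \<le> (b * C)\<^sup>2 * indicator {0..b} s" for n
    proof (rule AE_I2)
      fix s
      have "\<bar>K n s\<bar>\<^sup>2 \<le> (b * C * indicator {0..b} s)\<^sup>2"
        using K_bound[of n s] by (intro power_mono) auto
      then show "norm ((K n s)\<^sup>2) \<le> (b * C)\<^sup>2 * indicator {0..b} s"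
        by (cases "s \<in> {0..b}") auto
    qed
    show "AE s in lborel. (\<lambda>n. (K n s)\<^sup>2) \<longlonglongrightarrow> (\<psi> s)\<^sup>2"
      by (intro AE_I2 tendsto_intros K_lim)
  qed (simp_all add: integrable_indicator_Icc)
  \<comment> \<open>\<open>lim\<close> of measurable functions is measurable everywhere, including
    the null set on which the Riemann sums may fail to converge.\<close>
  define \<xi> where "\<xi> \<omega> = lim (\<lambda>n. S n \<omega>)" for \<omega>
  have \<xi>_meas[measurable]: "\<xi> \<in> borel_measurable M"
    unfolding \<xi>_def[abs_def] by (rule borel_measurable_lim_metric) simp
  have S_lim: "AE \<omega> in M. (\<lambda>n. S n \<omega>) \<longlonglongrightarrow> (LINT t:{0..b}|lborel. X t \<omega> * e t)"
    using X_cont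
  proof eventually_elim
    case (elim \<omega>)
    have "continuous_on {0..b} (\<lambda>t. X t \<omega> * e t)"
      using b by (intro continuous_intros e continuous_on_subset[OF elim]) auto
    from riemann_sum_tendsto_continuous[OF b(1) this]
    show ?case by (simp add: S_def x_def)
  qed
  then have \<xi>_AE: "AE \<omega> in M. \<xi> \<omega> = (LINT t:{0..b}|lborel. X t \<omega> * e t)"
    by eventually_elim (simp add: \<xi>_def limI)
  have "AE \<omega> in M. (\<lambda>n. S n \<omega>) \<longlonglongrightarrow> \<xi> \<omega>"
    using S_lim \<xi>_AE by eventually_elim simp
  then have "(\<lambda>n. CLINT \<omega>|M. iexp (S n \<omega>)) \<longlonglongrightarrow> (CLINT \<omega>|M. iexp (\<xi> \<omega>))"
    by (intro integral_dominated_convergence[where w="\<lambda>_. 1"])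
       (auto elim!: eventually_mono intro!: tendsto_intros)
  moreover have "(\<lambda>n. complex_of_real (exp (- ((LINT s|lborel. (K n s)\<^sup>2) / 2)))) \<longlonglongrightarrow> of_real (exp (- ((LINT s|lborel. (\<psi> s)\<^sup>2) / 2)))"
    by (intro tendsto_intros var_lim) simp
  ultimately have "(CLINT \<omega>|M. iexp (\<xi> \<omega>)) = of_real (exp (- ((LINT s|lborel. (\<psi> s)\<^sup>2) / 2)))"
    unfolding S_char by (rule LIMSEQ_unique)
  then show ?thesis
    using that[OF \<xi>_meas \<xi>_AE] by (simp add: \<psi>_def)
qed

lemma second_moment:
  assumes "0 \<le> t" "t < T"
  shows "(\<integral>\<^sup>+\<omega>. ennreal ((X t \<omega>)\<^sup>2) \<partial>M) = ennreal (LINT s|lborel. (kern t s)\<^sup>2)"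
proof (rule nn_expectation_square_gaussian)
  show "(CLINT \<omega>|M. iexp (u * X t \<omega>)) = of_real (exp (- ((LINT s|lborel. (kern t s)\<^sup>2) * u\<^sup>2 / 2)))" for u
    using X_char[of "{0}" "\<lambda>_. t" "\<lambda>_. u"] assms by (simp add: power_mult_distrib mult.commute)
qed (use assms X_meas in auto)

text \<open>The antiderivative is explicit. Its value at b is nonpositive and is dropped, which
  makes the bound independent of b; it is the value of the integral up to T.\<close>

lemma integral_kernel_square_le:
  assumes b: "0 < b" "b < T"
  shows "(LINT t:{0..b}|lborel. (kern t s)\<^sup>2) \<le> indicator {0..b} s * ((T - s) / (2 * \<alpha> + 1))"
proof (cases "s \<in> {0..b}")
  case True
  define P where "P t = - ((T - t) powr (2 * \<alpha> + 1)) / ((2 * \<alpha> + 1) * (T - s) powr (2 * \<alpha>))" for t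
  have k2: "(kern t s)\<^sup>2 = (T - t) powr (2 * \<alpha>) / (T - s) powr (2 * \<alpha>)" if "s \<le> t" "t \<le> b" for t
  proof -
    have "(kern t s)\<^sup>2 = (((T - t) / (T - s)) powr \<alpha>)\<^sup>2" using that True by (simp add: bridge_kernel_def)
    also have "\<dots> = ((T - t) / (T - s)) powr (2 * \<alpha>)"
      by (simp add: power2_eq_square powr_add[symmetric])
    finally show ?thesis using that True b by (simp add: powr_divide)
  qed
  have "(LINT t:{0..b}|lborel. (kern t s)\<^sup>2) = (LINT t:{s..b}|lborel. (T - t) powr (2 * \<alpha>) / (T - s) powr (2 * \<alpha>))"
    unfolding set_lebesgue_integral_def
    by (intro Bochner_Integration.integral_cong)
       (use True in \<open>auto simp: indicator_def k2 bridge_kernel_eq_0\<close>)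
  also have "\<dots> = P b - P s"
  proof -
    have "((\<lambda>t. (T - t) powr (2 * \<alpha>) / (T - s) powr (2 * \<alpha>)) has_integral P b - P s) {s..b}"
    proof (rule fundamental_theorem_of_calculus)
      show "s \<le> b" using True by simp
      fix t assume "t \<in> {s..b}"
      then have t: "t < T" using b by simp
      have "((\<lambda>t. (T - t) powr (2 * \<alpha> + 1)) has_real_derivative - ((2 * \<alpha> + 1) * (T - t) powr (2 * \<alpha>))) (at t within {s..b})"
        using t by (auto intro!: derivative_eq_intros)
      then have "(P has_real_derivative - (- ((2 * \<alpha> + 1) * (T - t) powr (2 * \<alpha>))) / ((2 * \<alpha> + 1) * (T - s) powr (2 * \<alpha>))) (at t within {s..b})"
        unfolding P_def[abs_def] by (intro DERIV_cdivide DERIV_minus)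
      then show "(P has_vector_derivative (T - t) powr (2 * \<alpha>) / (T - s) powr (2 * \<alpha>)) (at t within {s..b})"
        using \<alpha> by (simp add: has_real_derivative_iff_has_vector_derivative[symmetric])
    qed
    moreover have "set_integrable lborel {s..b} (\<lambda>t. (T - t) powr (2 * \<alpha>) / (T - s) powr (2 * \<alpha>))"
      using True b by (intro borel_integrable_atLeastAtMost' continuous_intros) auto
    ultimately show ?thesis
      using set_borel_integral_eq_integral(2) integral_unique by metis
  qed
  also have "\<dots> \<le> - P s"
    using \<alpha> by (auto simp: P_def)
  also have "- P s = (T - s) / (2 * \<alpha> + 1)"
    using True b \<alpha> by (simp add: P_def powr_add)
  finally show ?thesis using True by simp
next
  case False
  then have "kern t s = 0" if "t \<in> {0..b}" for t
    using that by (intro bridge_kernel_eq_0) auto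
  then have "(LINT t:{0..b}|lborel. (kern t s)\<^sup>2) = (LINT t:{0..b}|lborel. 0)"
    by (intro set_lebesgue_integral_cong) auto
  then show ?thesis using False by simp
qed

text \<open>The constant is the integral of (T - s) / (2 \<alpha> + 1) over [0,T]. It does not
  depend on b, as is needed for the passage to T.\<close>

lemma ex_square_integral_version:
  assumes b: "0 < b" "b < T"
  obtains V where "V \<in> borel_measurable M" "AE \<omega> in M. V \<omega> = (LINT t:{0..b}|lborel. (X t \<omega>)\<^sup>2)"
    "(\<integral>\<^sup>+\<omega>. ennreal (V \<omega>) \<partial>M) \<le> ennreal (T\<^sup>2 / (2 * (2 * \<alpha> + 1)))"
proof -
  define x where "x n i = real i * b / real (Suc n)" for n i
  note grid' = grid[OF b, folded x_def]
  define S where "S n \<omega> = (\<Sum>i<Suc n. b / real (Suc n) * (X (x n i) \<omega>)\<^sup>2)" for n \<omega>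
  define K where "K n s = (\<Sum>i<Suc n. b / real (Suc n) * (kern (x n i) s)\<^sup>2)" for n s
  have [measurable]: "S n \<in> borel_measurable M" for n
    unfolding S_def[abs_def] using grid' by (intro borel_measurable_sum borel_measurable_times borel_measurable_power X_meas) auto
  have [measurable]: "K n \<in> borel_measurable borel" for n
    unfolding K_def[abs_def] by measurable
  have S_nonneg: "0 \<le> S n \<omega>" for n \<omega> unfolding S_def using b by (intro sum_nonneg) auto
  have k_bound: "(kern (x n i) s)\<^sup>2 \<le> indicator {0..b} s" if "i < Suc n" for n i s
    using bridge_kernel_bounds[OF \<alpha> grid'(3)[OF that], of s] grid_nonzero[OF b that, folded x_def, of s]
    by (cases "s \<in> {0..b}") (auto intro!: power_le_one)
  have k_int: "integrable lborel (\<lambda>s. (kern (x n i) s)\<^sup>2)" if "i < Suc n" for n i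
  proof (rule Bochner_Integration.integrable_bound[where f="indicator {0..b} :: real \<Rightarrow> real"])
    show "AE s in lborel. norm ((kern (x n i) s)\<^sup>2) \<le> norm (indicator {0..b} s :: real)"
      using k_bound[OF that] by auto
  qed (auto intro!: integrable_indicator_Icc)
  have K_int: "integrable lborel (K n)" for n
    unfolding K_def[abs_def] using k_int by (intro Bochner_Integration.integrable_sum integrable_mult_right) auto
  have K_nonneg: "0 \<le> K n s" for n s unfolding K_def using b by (intro sum_nonneg) auto
  have S_nn: "(\<integral>\<^sup>+\<omega>. ennreal (S n \<omega>) \<partial>M) = ennreal (LINT s|lborel. K n s)" for n
  proof -
    have "(\<integral>\<^sup>+\<omega>. ennreal (S n \<omega>) \<partial>M) = (\<integral>\<^sup>+\<omega>. (\<Sum>i<Suc n. ennreal (b / real (Suc n)) * ennreal ((X (x n i) \<omega>)\<^sup>2)) \<partial>M)"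
    proof (rule nn_integral_cong)
      fix \<omega>
      have "(\<Sum>i<Suc n. ennreal (b / real (Suc n)) * ennreal ((X (x n i) \<omega>)\<^sup>2))
          = (\<Sum>i<Suc n. ennreal (b / real (Suc n) * (X (x n i) \<omega>)\<^sup>2))"
        using b by (intro sum.cong refl ennreal_mult[symmetric]) auto
      also have "\<dots> = ennreal (S n \<omega>)"
        unfolding S_def using b by (intro sum_ennreal) auto
      finally show "ennreal (S n \<omega>) = (\<Sum>i<Suc n. ennreal (b / real (Suc n)) * ennreal ((X (x n i) \<omega>)\<^sup>2))" ..
    qed
    also have "\<dots> = (\<Sum>i<Suc n. \<integral>\<^sup>+\<omega>. ennreal (b / real (Suc n)) * ennreal ((X (x n i) \<omega>)\<^sup>2) \<partial>M)"
    proof (rule nn_integral_sum)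
      fix i assume "i \<in> {..<Suc n}"
      then have [measurable]: "X (x n i) \<in> borel_measurable M" using grid' X_meas by auto
      show "(\<lambda>\<omega>. ennreal (b / real (Suc n)) * ennreal ((X (x n i) \<omega>)\<^sup>2)) \<in> borel_measurable M" by measurable
    qed
    also have "\<dots> = (\<Sum>i<Suc n. ennreal (b / real (Suc n) * (LINT s|lborel. (kern (x n i) s)\<^sup>2)))"
    proof (intro sum.cong refl)
      fix i assume "i \<in> {..<Suc n}"
      then have i: "0 \<le> x n i" "x n i < T" using grid' by auto
      have [measurable]: "X (x n i) \<in> borel_measurable M" using X_meas i by auto
      have "(\<integral>\<^sup>+\<omega>. ennreal (b / real (Suc n)) * ennreal ((X (x n i) \<omega>)\<^sup>2) \<partial>M)
          = ennreal (b / real (Suc n)) * ennreal (LINT s|lborel. (kern (x n i) s)\<^sup>2)"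
        unfolding second_moment[OF i, symmetric] by (rule nn_integral_cmult) measurable
      also have "\<dots> = ennreal (b / real (Suc n) * (LINT s|lborel. (kern (x n i) s)\<^sup>2))"
        using b by (intro ennreal_mult[symmetric]) auto
      finally show "(\<integral>\<^sup>+\<omega>. ennreal (b / real (Suc n)) * ennreal ((X (x n i) \<omega>)\<^sup>2) \<partial>M)
          = ennreal (b / real (Suc n) * (LINT s|lborel. (kern (x n i) s)\<^sup>2))" .
    qed
    also have "\<dots> = ennreal (\<Sum>i<Suc n. b / real (Suc n) * (LINT s|lborel. (kern (x n i) s)\<^sup>2))"
      using b by (intro sum_ennreal) auto
    also have "(\<Sum>i<Suc n. b / real (Suc n) * (LINT s|lborel. (kern (x n i) s)\<^sup>2)) = (LINT s|lborel. K n s)"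
      unfolding K_def using k_int by (subst Bochner_Integration.integral_sum) auto
    finally show ?thesis .
  qed
  have K_lim: "(\<lambda>n. K n s) \<longlonglongrightarrow> (LINT t:{0..b}|lborel. (kern t s)\<^sup>2)" for s
    using riemann_sum_bridge_kernel[OF \<alpha> b continuous_on_const[of _ 1], of 2 s] by (simp add: K_def x_def)
  have K_bound: "norm (K n s) \<le> b * indicator {0..b} s" for n s
  proof -
    have "K n s \<le> (\<Sum>i<Suc n. b / real (Suc n) * indicator {0..b} s)"
      unfolding K_def using b k_bound by (intro sum_mono mult_left_mono) auto
    then show ?thesis using K_nonneg[of n s] by simp
  qed
  define \<psi> where "\<psi> s = (LINT t:{0..b}|lborel. (kern t s)\<^sup>2)" for s
  have [measurable]: "\<psi> \<in> borel_measurable borel"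
    unfolding \<psi>_def[abs_def] by (rule borel_measurable_LIMSEQ_real[OF K_lim]) auto
  have i0: "integrable lborel (\<lambda>s. b * indicator {0..b} s)" by (simp add: integrable_indicator_Icc)
  have lim_AE: "AE s in lborel. (\<lambda>n. K n s) \<longlonglongrightarrow> \<psi> s" "AE s in lborel. norm (K n s) \<le> b * indicator {0..b} s" for n
    using K_lim K_bound by (auto simp: \<psi>_def)
  have int_lim: "(\<lambda>n. LINT s|lborel. K n s) \<longlonglongrightarrow> (LINT s|lborel. \<psi> s)"
    by (rule integral_dominated_convergence[OF _ _ i0 lim_AE]) auto
  have \<psi>_int: "integrable lborel \<psi>"
    by (rule integrable_dominated_convergence[OF _ _ i0 lim_AE]) auto
  have "(LINT s|lborel. \<psi> s) \<le> (LINT s:{0..T}|lborel. (T - s) / (2 * \<alpha> + 1))"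
    unfolding set_lebesgue_integral_def
  proof (rule integral_mono[OF \<psi>_int])
    show "integrable lborel (\<lambda>s. indicator {0..T} s *\<^sub>R ((T - s) / (2 * \<alpha> + 1)))"
    proof -
      have "set_integrable lborel {0..T} (\<lambda>s. (T - s) / (2 * \<alpha> + 1))"
        using \<alpha> by (intro borel_integrable_atLeastAtMost' continuous_intros) auto
      then show ?thesis by (simp only: set_integrable_def)
    qed
    show "\<psi> s \<le> indicator {0..T} s *\<^sub>R ((T - s) / (2 * \<alpha> + 1))" for s
    proof -
      have "0 \<le> indicator {0..T} s *\<^sub>R ((T - s) / (2 * \<alpha> + 1))"
        using \<alpha> by (auto simp: indicator_def)
      moreover have "indicator {0..b} s = (1::real) \<Longrightarrow> indicator {0..T} s = (1::real)"
        using b by (auto simp: indicator_def split: if_splits)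
      ultimately show ?thesis
        using integral_kernel_square_le[OF b, of s] unfolding \<psi>_def by (cases "s \<in> {0..b}") auto
    qed
  qed
  also have "(LINT s:{0..T}|lborel. (T - s) / (2 * \<alpha> + 1)) = T\<^sup>2 / (2 * (2 * \<alpha> + 1))"
  proof -
    have "((\<lambda>s. (T - s) / (2 * \<alpha> + 1)) has_integral (- (T - T)\<^sup>2 / (2 * (2 * \<alpha> + 1))) - (- (T - 0)\<^sup>2 / (2 * (2 * \<alpha> + 1)))) {0..T}"
    proof (rule fundamental_theorem_of_calculus)
      show "((\<lambda>s. - (T - s)\<^sup>2 / (2 * (2 * \<alpha> + 1))) has_vector_derivative (T - s) / (2 * \<alpha> + 1)) (at s within {0..T})" for s
      proof -
        have "((\<lambda>s. (T - s)\<^sup>2) has_real_derivative - (2 * (T - s))) (at s within {0..T})"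
          by (auto intro!: derivative_eq_intros)
        then have "((\<lambda>s. - (T - s)\<^sup>2 / (2 * (2 * \<alpha> + 1))) has_real_derivative
            - (- (2 * (T - s))) / (2 * (2 * \<alpha> + 1))) (at s within {0..T})"
          by (intro DERIV_cdivide DERIV_minus)
        moreover have "- (- (2 * (T - s))) / (2 * (2 * \<alpha> + 1)) = (T - s) / (2 * \<alpha> + 1)"
          using mult_divide_mult_cancel_left[of 2 "T - s" "2 * \<alpha> + 1"] by simp
        ultimately show ?thesis
          by (simp only: has_real_derivative_iff_has_vector_derivative)
      qed
    qed (use T in simp)
    moreover have "set_integrable lborel {0..T} (\<lambda>s. (T - s) / (2 * \<alpha> + 1))"
      using \<alpha> by (intro borel_integrable_atLeastAtMost' continuous_intros) auto
    then have "(LINT s:{0..T}|lborel. (T - s) / (2 * \<alpha> + 1)) = integral {0..T} (\<lambda>s. (T - s) / (2 * \<alpha> + 1))"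
      by (rule set_borel_integral_eq_integral(2))
    ultimately have "(LINT s:{0..T}|lborel. (T - s) / (2 * \<alpha> + 1))
        = (- (T - T)\<^sup>2 / (2 * (2 * \<alpha> + 1))) - (- (T - 0)\<^sup>2 / (2 * (2 * \<alpha> + 1)))"
      using integral_unique by metis
    also have "\<dots> = T\<^sup>2 / (2 * (2 * \<alpha> + 1))" by simp
    finally show ?thesis .
  qed
  finally have \<psi>_le: "(LINT s|lborel. \<psi> s) \<le> T\<^sup>2 / (2 * (2 * \<alpha> + 1))" .
  define V where "V \<omega> = lim (\<lambda>n. S n \<omega>)" for \<omega>
  have V_meas[measurable]: "V \<in> borel_measurable M"
    unfolding V_def[abs_def] by (rule borel_measurable_lim_metric) simp
  have S_lim: "AE \<omega> in M. (\<lambda>n. S n \<omega>) \<longlonglongrightarrow> (LINT t:{0..b}|lborel. (X t \<omega>)\<^sup>2)"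
    using X_cont
  proof eventually_elim
    case (elim \<omega>)
    have "continuous_on {0..b} (\<lambda>t. (X t \<omega>)\<^sup>2)"
      using b by (intro continuous_intros continuous_on_subset[OF elim]) auto
    from riemann_sum_tendsto_continuous[OF b(1) this]
    show ?case by (simp add: S_def x_def)
  qed
  then have V_AE: "AE \<omega> in M. V \<omega> = (LINT t:{0..b}|lborel. (X t \<omega>)\<^sup>2)"
    by eventually_elim (simp add: V_def limI)
  \<comment> \<open>Fatou's lemma along the Riemann sums, whose expectations are sums of variances
    and therefore known exactly.\<close>
  have "(\<integral>\<^sup>+\<omega>. ennreal (V \<omega>) \<partial>M) = (\<integral>\<^sup>+\<omega>. liminf (\<lambda>n. ennreal (S n \<omega>)) \<partial>M)"
  proof (rule nn_integral_cong_AE)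
    show "AE \<omega> in M. ennreal (V \<omega>) = liminf (\<lambda>n. ennreal (S n \<omega>))"
      using S_lim V_AE by eventually_elim (auto intro!: lim_imp_Liminf[symmetric] tendsto_ennrealI)
  qed
  also have "\<dots> \<le> liminf (\<lambda>n. \<integral>\<^sup>+\<omega>. ennreal (S n \<omega>) \<partial>M)"
    by (rule nn_integral_liminf) auto
  also have "\<dots> = ennreal (LINT s|lborel. \<psi> s)"
    unfolding S_nn by (intro lim_imp_Liminf tendsto_ennrealI int_lim) simp
  also have "\<dots> \<le> ennreal (T\<^sup>2 / (2 * (2 * \<alpha> + 1)))"
    by (rule ennreal_leI[OF \<psi>_le])
  finally show ?thesis using that[OF V_meas V_AE] by blast
qed

end

section \<open>Passage from compact subintervals to [0,T)\<close>

context gaussian_bridge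
begin

text \<open>Increases to T from T / 2; the summand 2 keeps every cutoff positive.\<close>

definition cutoff :: "nat \<Rightarrow> real" where "cutoff m = T - T / (real m + 2)"

lemma cutoff: "0 < cutoff m" "cutoff m < T" "cutoff m \<le> cutoff (Suc m)"
proof -
  have "T * 1 < T * (real m + 2)" using T by (intro mult_strict_left_mono) auto
  then show "0 < cutoff m" by (simp add: cutoff_def pos_divide_less_eq)
  show "cutoff m < T" using T by (simp add: cutoff_def)
  show "cutoff m \<le> cutoff (Suc m)"
    unfolding cutoff_def using T by (intro diff_left_mono divide_left_mono) auto
qed

lemma cutoff_tendsto: "cutoff \<longlonglongrightarrow> T"
  unfolding cutoff_def[abs_def] by real_asymp

lemma indicator_cutoff_tendsto: "(\<lambda>m. indicator {0..cutoff m} t :: real) \<longlonglongrightarrow> indicator {0..<T} t"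
proof (cases "t \<in> {0..<T}")
  case True
  then have "\<forall>\<^sub>F m in sequentially. t < cutoff m"
    using order_tendstoD(1)[OF cutoff_tendsto, of t] by auto
  then have "\<forall>\<^sub>F m in sequentially. indicator {0..<T} t = (indicator {0..cutoff m} t :: real)"
    by eventually_elim (use True in \<open>auto simp: indicator_def\<close>)
  then show ?thesis by (rule Lim_transform_eventually[OF tendsto_const])
next
  case False
  then have "indicator {0..cutoff m} t = (0::real)" for m
    using cutoff(2)[of m] by (auto simp: indicator_def)
  then show ?thesis using False by simp
qed

lemma set_integral_cutoff_tendsto:
  fixes g :: "real \<Rightarrow> real"
  assumes "set_integrable lborel {0..<T} g"
  shows "(\<lambda>m. LINT t:{0..cutoff m}|lborel. g t) \<longlonglongrightarrow> (LINT t:{0..<T}|lborel. g t)"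
  unfolding set_lebesgue_integral_def
proof (rule integral_dominated_convergence[where w="\<lambda>t. norm (indicator {0..<T} t *\<^sub>R g t)"])
  show "integrable lborel (\<lambda>t. norm (indicator {0..<T} t *\<^sub>R g t))"
    using assms unfolding set_integrable_def by (rule integrable_norm)
  show meas: "(\<lambda>t. indicator {0..<T} t *\<^sub>R g t) \<in> borel_measurable lborel"
    using assms unfolding set_integrable_def by auto
  have eq: "indicator {0..cutoff m} t *\<^sub>R g t = indicator {0..cutoff m} t * (indicator {0..<T} t *\<^sub>R g t)" for m t
    using cutoff(2)[of m] by (auto simp: indicator_def)
  show "(\<lambda>t. indicator {0..cutoff m} t *\<^sub>R g t) \<in> borel_measurable lborel" for m
    unfolding eq using meas by measurable
  show "AE t in lborel. (\<lambda>m. indicator {0..cutoff m} t *\<^sub>R g t) \<longlonglongrightarrow> indicator {0..<T} t *\<^sub>R g t"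
    by (intro AE_I2 tendsto_scaleR indicator_cutoff_tendsto tendsto_const)
  show "AE t in lborel. norm (indicator {0..cutoff m} t *\<^sub>R g t) \<le> norm (indicator {0..<T} t *\<^sub>R g t)" for m
    using cutoff(2)[of m] by (intro AE_I2) (auto simp: indicator_def)
qed

text \<open>Monotone convergence in the cutoff. The value is an extended real because finiteness is
  not known path by path; it is deduced afterwards from the bound on the expectation.\<close>

lemma ex_path_square_version:
  obtains Y :: "'a \<Rightarrow> ennreal" where "Y \<in> borel_measurable M"
    "AE \<omega> in M. Y \<omega> = (\<integral>\<^sup>+t\<in>{0..<T}. ennreal ((X t \<omega>)\<^sup>2) \<partial>lborel)"
    "(\<integral>\<^sup>+\<omega>. Y \<omega> \<partial>M) \<le> ennreal (T\<^sup>2 / (2 * (2 * \<alpha> + 1)))"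
proof -
  let ?C = "ennreal (T\<^sup>2 / (2 * (2 * \<alpha> + 1)))"
  have "\<forall>m. \<exists>V. V \<in> borel_measurable M \<and> (AE \<omega> in M. V \<omega> = (LINT t:{0..cutoff m}|lborel. (X t \<omega>)\<^sup>2)) \<and>
    (\<integral>\<^sup>+\<omega>. ennreal (V \<omega>) \<partial>M) \<le> ?C"
  proof
    fix m
    obtain V where "V \<in> borel_measurable M" "AE \<omega> in M. V \<omega> = (LINT t:{0..cutoff m}|lborel. (X t \<omega>)\<^sup>2)"
      "(\<integral>\<^sup>+\<omega>. ennreal (V \<omega>) \<partial>M) \<le> ?C"
      by (rule ex_square_integral_version[OF cutoff(1,2)])
    then show "\<exists>V. V \<in> borel_measurable M \<and> (AE \<omega> in M. V \<omega> = (LINT t:{0..cutoff m}|lborel. (X t \<omega>)\<^sup>2)) \<and>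
        (\<integral>\<^sup>+\<omega>. ennreal (V \<omega>) \<partial>M) \<le> ?C"
      by (intro exI conjI)
  qed
  from choice[OF this] obtain V where V[measurable]: "\<And>m. V m \<in> borel_measurable M"
    and V_AE: "\<And>m. AE \<omega> in M. V m \<omega> = (LINT t:{0..cutoff m}|lborel. (X t \<omega>)\<^sup>2)"
    and V_le: "\<And>m. (\<integral>\<^sup>+\<omega>. ennreal (V m \<omega>) \<partial>M) \<le> ?C"
    by blast
  have V_all: "AE \<omega> in M. \<forall>m. V m \<omega> = (LINT t:{0..cutoff m}|lborel. (X t \<omega>)\<^sup>2)"
    using V_AE by (simp only: AE_all_countable) blast
  have AE_nn: "AE \<omega> in M. \<forall>m. ennreal (V m \<omega>) = (\<integral>\<^sup>+t. ennreal ((X t \<omega>)\<^sup>2) * indicator {0..cutoff m} t \<partial>lborel)"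
    using X_cont V_all
  proof eventually_elim
    case (elim \<omega>)
    show ?case
    proof
      fix m
      have cont: "continuous_on {0..cutoff m} (\<lambda>t. (X t \<omega>)\<^sup>2)"
        using cutoff[of m] by (intro continuous_intros continuous_on_subset[OF elim(1)]) auto
      have int: "integrable lborel (\<lambda>t. indicator {0..cutoff m} t *\<^sub>R (X t \<omega>)\<^sup>2)"
        using borel_integrable_atLeastAtMost'[OF cont] by (simp add: set_integrable_def)
      have "ennreal (V m \<omega>) = ennreal (LINT t|lborel. indicator {0..cutoff m} t *\<^sub>R (X t \<omega>)\<^sup>2)"
        using elim(2) by (simp add: set_lebesgue_integral_def)
      also have "\<dots> = (\<integral>\<^sup>+t. ennreal (indicator {0..cutoff m} t *\<^sub>R (X t \<omega>)\<^sup>2) \<partial>lborel)"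
        by (rule nn_integral_eq_integral[symmetric, OF int]) auto
      also have "\<dots> = (\<integral>\<^sup>+t. ennreal ((X t \<omega>)\<^sup>2) * indicator {0..cutoff m} t \<partial>lborel)"
        by (intro nn_integral_cong) (auto simp: indicator_def)
      finally show "ennreal (V m \<omega>) = (\<integral>\<^sup>+t. ennreal ((X t \<omega>)\<^sup>2) * indicator {0..cutoff m} t \<partial>lborel)" .
    qed
  qed
  define Y where "Y \<omega> = (SUP m. ennreal (V m \<omega>))" for \<omega>
  have Y: "Y \<in> borel_measurable M" unfolding Y_def[abs_def] by measurable
  have sub: "{0..cutoff m} \<subseteq> {0..cutoff (Suc m)}" for m using cutoff(3)[of m] by auto
  have "AE \<omega> in M. Y \<omega> = (\<integral>\<^sup>+t\<in>{0..<T}. ennreal ((X t \<omega>)\<^sup>2) \<partial>lborel)"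
    using X_cont AE_nn
  proof eventually_elim
    case (elim \<omega>)
    let ?f = "\<lambda>m t. ennreal ((X t \<omega>)\<^sup>2) * indicator {0..cutoff m} t"
    have inc: "incseq ?f"
      by (intro incseq_SucI le_funI mult_left_mono) (use cutoff(3) in \<open>auto simp: indicator_def intro: order_trans\<close>)
    have meas: "?f m \<in> borel_measurable lborel" for m
    proof -
      have "(\<lambda>t. indicator {0..cutoff m} t *\<^sub>R (X t \<omega>)) \<in> borel_measurable borel"
        using cutoff[of m] by (intro borel_measurable_continuous_on_indicator continuous_on_subset[OF elim(1)]) auto
      then have "(\<lambda>t. ennreal ((indicator {0..cutoff m} t *\<^sub>R (X t \<omega>))\<^sup>2)) \<in> borel_measurable borel" by measurable
      moreover have "ennreal ((indicator {0..cutoff m} t *\<^sub>R (X t \<omega>))\<^sup>2) = ?f m t" for t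
        by (auto simp: indicator_def)
      ultimately have "?f m \<in> borel_measurable borel" by (simp only:)
      then show ?thesis by (subst measurable_cong_sets[OF sets_lborel refl])
    qed
    have "(SUP m. ?f m t) = ennreal ((X t \<omega>)\<^sup>2) * indicator {0..<T} t" for t
    proof (rule LIMSEQ_unique[OF LIMSEQ_SUP])
      show "incseq (\<lambda>m. ?f m t)" using inc by (auto simp: incseq_def le_fun_def)
      have "(\<lambda>m. ennreal ((X t \<omega>)\<^sup>2 * indicator {0..cutoff m} t)) \<longlonglongrightarrow> ennreal ((X t \<omega>)\<^sup>2 * indicator {0..<T} t)"
        by (intro tendsto_ennrealI tendsto_mult tendsto_const indicator_cutoff_tendsto)
      then show "(\<lambda>m. ?f m t) \<longlonglongrightarrow> ennreal ((X t \<omega>)\<^sup>2) * indicator {0..<T} t"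
        by (simp add: ennreal_mult' ennreal_indicator)
    qed
    then have "(\<integral>\<^sup>+t\<in>{0..<T}. ennreal ((X t \<omega>)\<^sup>2) \<partial>lborel) = (\<integral>\<^sup>+t. (SUP m. ?f m t) \<partial>lborel)" by simp
    also have "\<dots> = (SUP m. \<integral>\<^sup>+t. ?f m t \<partial>lborel)"
      by (rule nn_integral_monotone_convergence_SUP[OF inc meas])
    finally show ?case using elim(2) by (simp add: Y_def)
  qed
  moreover have "(\<integral>\<^sup>+\<omega>. Y \<omega> \<partial>M) \<le> ?C"
  proof -
    have "(\<integral>\<^sup>+\<omega>. Y \<omega> \<partial>M) = (SUP m. \<integral>\<^sup>+\<omega>. ennreal (V m \<omega>) \<partial>M)"
      unfolding Y_def
    proof (rule nn_integral_monotone_convergence_SUP_AE)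
      show "AE \<omega> in M. ennreal (V m \<omega>) \<le> ennreal (V (Suc m) \<omega>)" for m
        using AE_nn
      proof eventually_elim
        case (elim \<omega>)
        have "(\<integral>\<^sup>+t. ennreal ((X t \<omega>)\<^sup>2) * indicator {0..cutoff m} t \<partial>lborel)
            \<le> (\<integral>\<^sup>+t. ennreal ((X t \<omega>)\<^sup>2) * indicator {0..cutoff (Suc m)} t \<partial>lborel)"
          using sub[of m] by (intro nn_integral_mono mult_left_mono) (auto simp: indicator_def)
        then show ?case using elim by simp
      qed
    qed measurable
    also have "\<dots> \<le> ?C" by (rule SUP_least) (rule V_le)
    finally show ?thesis .
  qed
  ultimately show ?thesis using that[OF Y] by blast
qed

lemma AE_square_integrable: "AE \<omega> in M. set_integrable lborel {0..<T} (\<lambda>t. (X t \<omega>)\<^sup>2)"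
proof -
  obtain Y :: "'a \<Rightarrow> ennreal" where Y: "Y \<in> borel_measurable M"
    "AE \<omega> in M. Y \<omega> = (\<integral>\<^sup>+t\<in>{0..<T}. ennreal ((X t \<omega>)\<^sup>2) \<partial>lborel)"
    "(\<integral>\<^sup>+\<omega>. Y \<omega> \<partial>M) \<le> ennreal (T\<^sup>2 / (2 * (2 * \<alpha> + 1)))"
    by (rule ex_path_square_version)
  have "(\<integral>\<^sup>+\<omega>. Y \<omega> \<partial>M) \<noteq> \<infinity>" using Y(3) by (auto simp: top_unique)
  then have "AE \<omega> in M. Y \<omega> \<noteq> \<infinity>" by (rule nn_integral_noteq_infinite[OF Y(1)])
  then show ?thesis
    using Y(2) X_cont
  proof eventually_elim
    case (elim \<omega>)
    have meas: "(\<lambda>t. indicator {0..<T} t *\<^sub>R (X t \<omega>)\<^sup>2) \<in> borel_measurable borel"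
      by (intro borel_measurable_continuous_on_indicator continuous_intros elim) auto
    have "(\<integral>\<^sup>+t. ennreal (norm (indicator {0..<T} t *\<^sub>R (X t \<omega>)\<^sup>2)) \<partial>lborel) = Y \<omega>"
      unfolding elim(2) by (intro nn_integral_cong) (auto simp: indicator_def)
    then show ?case
      unfolding set_integrable_def using elim(1) meas by (intro integrableI_bounded) (auto simp: less_top)
  qed
qed

text \<open>Near T a path is only known to be square integrable, so the product is dominated by the
  sum of the squares.\<close>

lemma set_integrable_path_mult:
  fixes f e :: "real \<Rightarrow> real"
  assumes f: "continuous_on {0..<T} f" "set_integrable lborel {0..<T} (\<lambda>t. (f t)\<^sup>2)"
    and e: "continuous_on {0..T} e"
  shows "set_integrable lborel {0..<T} (\<lambda>t. f t * e t)"
proof -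
  have "continuous_on {0..<T} e" using e by (rule continuous_on_subset) auto
  have "set_integrable lborel {0..T} (\<lambda>t. (e t)\<^sup>2)"
    by (intro borel_integrable_atLeastAtMost' continuous_intros e)
  then have e2: "set_integrable lborel {0..<T} (\<lambda>t. (e t)\<^sup>2)"
    by (rule set_integrable_subset) auto
  show ?thesis
    unfolding set_integrable_def
  proof (rule Bochner_Integration.integrable_bound)
    show "integrable lborel (\<lambda>t. indicator {0..<T} t *\<^sub>R (f t)\<^sup>2 + indicator {0..<T} t *\<^sub>R (e t)\<^sup>2)"
      using f(2) e2 unfolding set_integrable_def by (rule Bochner_Integration.integrable_add)
    have "(\<lambda>t. indicator {0..<T} t *\<^sub>R (f t * e t)) \<in> borel_measurable borel"
      using \<open>continuous_on {0..<T} e\<close> by (intro borel_measurable_continuous_on_indicator continuous_intros f) auto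
    then show "(\<lambda>t. indicator {0..<T} t *\<^sub>R (f t * e t)) \<in> borel_measurable lborel" by simp
    have "\<bar>x * y\<bar> \<le> x\<^sup>2 + y\<^sup>2" for x y :: real
      using sum_squares_bound[of "\<bar>x\<bar>" "\<bar>y\<bar>"] mult_nonneg_nonneg[of "\<bar>x\<bar>" "\<bar>y\<bar>"]
      unfolding abs_mult power2_abs by linarith
    then show "AE t in lborel. norm (indicator {0..<T} t *\<^sub>R (f t * e t))
        \<le> norm (indicator {0..<T} t *\<^sub>R (f t)\<^sup>2 + indicator {0..<T} t *\<^sub>R (e t)\<^sup>2)"
      by (intro AE_I2) (auto simp: indicator_def)
  qed
qed

lemma set_integrable_kernel_mult:
  assumes e: "continuous_on {0..T} e"
  shows "set_integrable lborel {0..<T} (\<lambda>t. kern t s * e t)"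
  unfolding set_integrable_def
proof (rule Bochner_Integration.integrable_bound[where f="\<lambda>t. indicator {0..T} t *\<^sub>R e t"])
  show int: "integrable lborel (\<lambda>t. indicator {0..T} t *\<^sub>R e t)"
    using borel_integrable_atLeastAtMost'[OF e] by (simp only: set_integrable_def)
  then have [measurable]: "(\<lambda>t. indicator {0..T} t *\<^sub>R e t) \<in> borel_measurable lborel"
    by (rule borel_measurable_integrable)
  have "(\<lambda>t. indicator {0..<T} t * (kern t s * (indicator {0..T} t *\<^sub>R e t))) \<in> borel_measurable lborel"
    by measurable
  moreover have "indicator {0..<T} t * (kern t s * (indicator {0..T} t *\<^sub>R e t)) = indicator {0..<T} t *\<^sub>R (kern t s * e t)" for t
    by (auto simp: indicator_def)
  ultimately show "(\<lambda>t. indicator {0..<T} t *\<^sub>R (kern t s * e t)) \<in> borel_measurable lborel" by (simp only:)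
  show "AE t in lborel. norm (indicator {0..<T} t *\<^sub>R (kern t s * e t)) \<le> norm (indicator {0..T} t *\<^sub>R e t)"
  proof (rule AE_I2)
    fix t
    show "norm (indicator {0..<T} t *\<^sub>R (kern t s * e t)) \<le> norm (indicator {0..T} t *\<^sub>R e t)"
    proof (cases "t \<in> {0..<T}")
      case True
      then have "\<bar>kern t s * e t\<bar> \<le> 1 * \<bar>e t\<bar>"
        unfolding abs_mult using bridge_kernel_bounds[OF \<alpha>, of t T s] by (intro mult_right_mono) auto
      then show ?thesis using True by simp
    qed simp
  qed
qed

text \<open>A second limit on top of \<open>ex_integral_version\<close>. The path integrals converge
  by almost sure square integrability; the variances converge because the kernel images are bounded
  by C * T uniformly in the cutoff.\<close>

lemma ex_linear_functional_version:
  assumes e: "continuous_on {0..T} e"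
  obtains \<xi> where "\<xi> \<in> borel_measurable M" "AE \<omega> in M. \<xi> \<omega> = (LINT t:{0..<T}|lborel. X t \<omega> * e t)"
    "(CLINT \<omega>|M. iexp (\<xi> \<omega>)) = of_real (exp (- ((LINT s|lborel. (LINT t:{0..<T}|lborel. kern t s * e t)\<^sup>2) / 2)))"
proof -
  have e_cut: "continuous_on {0..cutoff m} e" for m
    using cutoff(2)[of m] by (intro continuous_on_subset[OF e]) auto
  define \<psi> where "\<psi> m s = (LINT t:{0..cutoff m}|lborel. kern t s * e t)" for m s
  define \<Psi> where "\<Psi> s = (LINT t:{0..<T}|lborel. kern t s * e t)" for s
  have "\<forall>m. \<exists>\<xi>. \<xi> \<in> borel_measurable M \<and> (AE \<omega> in M. \<xi> \<omega> = (LINT t:{0..cutoff m}|lborel. X t \<omega> * e t)) \<and>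
    (CLINT \<omega>|M. iexp (\<xi> \<omega>)) = of_real (exp (- ((LINT s|lborel. (\<psi> m s)\<^sup>2) / 2)))"
  proof
    fix m
    obtain \<xi> where "\<xi> \<in> borel_measurable M" "AE \<omega> in M. \<xi> \<omega> = (LINT t:{0..cutoff m}|lborel. X t \<omega> * e t)"
      "(CLINT \<omega>|M. iexp (\<xi> \<omega>)) = of_real (exp (- ((LINT s|lborel. (LINT t:{0..cutoff m}|lborel. kern t s * e t)\<^sup>2) / 2)))"
      by (rule ex_integral_version[OF cutoff(1,2) e_cut])
    then show "\<exists>\<xi>. \<xi> \<in> borel_measurable M \<and> (AE \<omega> in M. \<xi> \<omega> = (LINT t:{0..cutoff m}|lborel. X t \<omega> * e t)) \<and>
        (CLINT \<omega>|M. iexp (\<xi> \<omega>)) = of_real (exp (- ((LINT s|lborel. (\<psi> m s)\<^sup>2) / 2)))"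
      unfolding \<psi>_def by (intro exI conjI)
  qed
  from choice[OF this] obtain \<xi> where \<xi>[measurable]: "\<And>m. \<xi> m \<in> borel_measurable M"
    and \<xi>_AE: "\<And>m. AE \<omega> in M. \<xi> m \<omega> = (LINT t:{0..cutoff m}|lborel. X t \<omega> * e t)"
    and \<xi>_char: "\<And>m. (CLINT \<omega>|M. iexp (\<xi> m \<omega>)) = of_real (exp (- ((LINT s|lborel. (\<psi> m s)\<^sup>2) / 2)))"
    by blast
  obtain C where C: "\<And>t. t \<in> {0..T} \<Longrightarrow> \<bar>e t\<bar> \<le> C"
    using continuous_on_Icc_bound[OF e] by blast
  have C0: "0 \<le> C" using C[of 0] T by auto
  have ke_bound: "\<bar>indicator {0..<T} t *\<^sub>R (kern t s * e t)\<bar> \<le> C * indicator {0..T} t" for t s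
  proof (cases "t \<in> {0..<T}")
    case True
    have "\<bar>kern t s * e t\<bar> \<le> 1 * C"
      unfolding abs_mult using bridge_kernel_bounds[OF \<alpha>, of t T s] C[of t] True by (intro mult_mono) auto
    then show ?thesis using True by (simp add: indicator_def)
  qed (use C0 in simp)
  note ke_int = set_integrable_kernel_mult[OF e]
  have \<psi>_lim: "(\<lambda>m. \<psi> m s) \<longlonglongrightarrow> \<Psi> s" for s
    unfolding \<psi>_def \<Psi>_def by (rule set_integral_cutoff_tendsto[OF ke_int])
  have \<psi>_meas[measurable]: "\<psi> m \<in> borel_measurable borel" for m
    unfolding \<psi>_def[abs_def]
    by (rule borel_measurable_LIMSEQ_real[OF riemann_sum_bridge_kernel[OF \<alpha> cutoff(1,2) e_cut, of 1, unfolded power_one_right]]) auto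
  have [measurable]: "\<Psi> \<in> borel_measurable borel"
    by (rule borel_measurable_LIMSEQ_real[OF \<psi>_lim]) simp
  have \<psi>_bound: "\<bar>\<psi> m s\<bar> \<le> C * T * indicator {0..T} s" for m s
  proof (cases "s \<in> {0..T}")
    case True
    have "\<bar>\<psi> m s\<bar> \<le> (LINT t|lborel. C * indicator {0..T} t)"
      unfolding \<psi>_def set_lebesgue_integral_def real_norm_def[symmetric]
    proof (rule order_trans[OF integral_norm_bound integral_mono_AE'])
      show "integrable lborel (\<lambda>t. C * indicator {0..T} t)" by (simp add: integrable_indicator_Icc)
      show "AE t in lborel. norm (indicator {0..cutoff m} t *\<^sub>R (kern t s * e t)) \<le> C * indicator {0..T} t"
      proof (rule AE_I2)
        fix t
        have "norm (indicator {0..cutoff m} t *\<^sub>R (kern t s * e t)) \<le> \<bar>indicator {0..<T} t *\<^sub>R (kern t s * e t)\<bar>"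
          using cutoff(2)[of m] by (auto simp: indicator_def)
        then show "norm (indicator {0..cutoff m} t *\<^sub>R (kern t s * e t)) \<le> C * indicator {0..T} t"
          using ke_bound order_trans by blast
      qed
    qed (auto simp: C0)
    also have "\<dots> = C * T" using T by simp
    finally show ?thesis using True by simp
  next
    case False
    have "kern t s = 0" if "t \<in> {0..cutoff m}" for t
      using that False cutoff(2)[of m] by (intro bridge_kernel_eq_0) auto
    then have "\<psi> m s = (LINT t:{0..cutoff m}|lborel. 0)"
      unfolding \<psi>_def by (intro set_lebesgue_integral_cong) auto
    then show ?thesis using False by simp
  qed
  have var_lim: "(\<lambda>m. LINT s|lborel. (\<psi> m s)\<^sup>2) \<longlonglongrightarrow> (LINT s|lborel. (\<Psi> s)\<^sup>2)"
  proof (rule integral_dominated_convergence[where w="\<lambda>s. (C * T)\<^sup>2 * indicator {0..T} s"])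
    show "AE s in lborel. norm ((\<psi> m s)\<^sup>2) \<le> (C * T)\<^sup>2 * indicator {0..T} s" for m
    proof (rule AE_I2)
      fix s
      have "\<bar>\<psi> m s\<bar>\<^sup>2 \<le> (C * T * indicator {0..T} s)\<^sup>2"
        using \<psi>_bound[of m s] by (intro power_mono) auto
      then show "norm ((\<psi> m s)\<^sup>2) \<le> (C * T)\<^sup>2 * indicator {0..T} s"
        by (cases "s \<in> {0..T}") auto
    qed
    show "AE s in lborel. (\<lambda>m. (\<psi> m s)\<^sup>2) \<longlonglongrightarrow> (\<Psi> s)\<^sup>2"
      by (intro AE_I2 tendsto_intros \<psi>_lim)
  qed (simp_all add: integrable_indicator_Icc)
  define \<Xi> where "\<Xi> \<omega> = lim (\<lambda>m. \<xi> m \<omega>)" for \<omega>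
  have \<Xi>_meas[measurable]: "\<Xi> \<in> borel_measurable M"
    unfolding \<Xi>_def[abs_def] by (rule borel_measurable_lim_metric) simp
  have \<xi>_all: "AE \<omega> in M. \<forall>m. \<xi> m \<omega> = (LINT t:{0..cutoff m}|lborel. X t \<omega> * e t)"
    using \<xi>_AE by (simp only: AE_all_countable) blast
  have \<xi>_lim: "AE \<omega> in M. (\<lambda>m. \<xi> m \<omega>) \<longlonglongrightarrow> (LINT t:{0..<T}|lborel. X t \<omega> * e t)"
    using X_cont AE_square_integrable \<xi>_all
  proof eventually_elim
    case (elim \<omega>)
    from set_integral_cutoff_tendsto[OF set_integrable_path_mult[OF elim(1,2) e]] elim(3)
    show ?case by simp
  qed
  then have \<Xi>_AE: "AE \<omega> in M. \<Xi> \<omega> = (LINT t:{0..<T}|lborel. X t \<omega> * e t)"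
    by eventually_elim (simp add: \<Xi>_def limI)
  have "AE \<omega> in M. (\<lambda>m. \<xi> m \<omega>) \<longlonglongrightarrow> \<Xi> \<omega>"
    using \<xi>_lim \<Xi>_AE by eventually_elim simp
  then have "(\<lambda>m. CLINT \<omega>|M. iexp (\<xi> m \<omega>)) \<longlonglongrightarrow> (CLINT \<omega>|M. iexp (\<Xi> \<omega>))"
    by (intro integral_dominated_convergence[where w="\<lambda>_. 1"])
       (auto elim!: eventually_mono intro!: tendsto_intros)
  moreover have "(\<lambda>m. complex_of_real (exp (- ((LINT s|lborel. (\<psi> m s)\<^sup>2) / 2)))) \<longlonglongrightarrow> of_real (exp (- ((LINT s|lborel. (\<Psi> s)\<^sup>2) / 2)))"
    by (intro tendsto_intros var_lim) simp
  ultimately have "(CLINT \<omega>|M. iexp (\<Xi> \<omega>)) = of_real (exp (- ((LINT s|lborel. (\<Psi> s)\<^sup>2) / 2)))"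
    unfolding \<xi>_char by (rule LIMSEQ_unique)
  then show ?thesis
    using that[OF \<Xi>_meas \<Xi>_AE] by (simp add: \<Psi>_def)
qed

end

section \<open>The spectral decomposition of the bridge\<close>

lemma set_integral_reflect:
  fixes h :: "real \<Rightarrow> real"
  shows "(LINT t:{s..T}|lborel. h (T - t)) = (LINT r:{0..T - s}|lborel. h r)"
proof -
  have "(LINT r|lborel. indicator {0..T - s} r *\<^sub>R h r)
      = \<bar>-1\<bar> *\<^sub>R (LINT t|lborel. indicator {0..T - s} (T + (-1) * t) *\<^sub>R h (T + (-1) * t))"
    by (rule lborel_integral_real_affine) simp
  also have "\<dots> = (LINT t|lborel. indicator {s..T} t *\<^sub>R h (T - t))"
    by (auto intro!: Bochner_Integration.integral_cong simp: indicator_def)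
  finally show ?thesis by (simp add: set_lebesgue_integral_def)
qed

lemma
  fixes f :: "nat \<Rightarrow> 'b \<Rightarrow> real"
  assumes int: "\<And>i j. integrable N (\<lambda>s. f i s * f j s)"
    and orth: "\<And>i j. i \<noteq> j \<Longrightarrow> (LINT s|N. f i s * f j s) = 0"
  shows integral_square_orthogonal_sum:
      "(LINT s|N. (\<Sum>i<n. c i * f i s)\<^sup>2) = (\<Sum>i<n. (c i)\<^sup>2 * (LINT s|N. f i s * f i s))"
    and integrable_square_sum: "integrable N (\<lambda>s. (\<Sum>i<n. c i * f i s)\<^sup>2)"
proof -
  have eq: "(\<Sum>i<n. c i * f i s)\<^sup>2 = (\<Sum>i<n. \<Sum>j<n. (c i * c j) * (f i s * f j s))" for s
    unfolding power2_eq_square sum_product by (intro sum.cong refl) (simp only: mult_ac)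
  show "integrable N (\<lambda>s. (\<Sum>i<n. c i * f i s)\<^sup>2)"
    unfolding eq by (intro Bochner_Integration.integrable_sum integrable_mult_right int)
  have "(LINT s|N. (\<Sum>i<n. c i * f i s)\<^sup>2) = (\<Sum>i<n. \<Sum>j<n. (c i * c j) * (LINT s|N. f i s * f j s))"
    unfolding eq by (simp add: int)
  also have "\<dots> = (\<Sum>i<n. \<Sum>j<n. if i = j then (c i)\<^sup>2 * (LINT s|N. f i s * f i s) else 0)"
    by (intro sum.cong refl) (auto simp: orth power2_eq_square)
  finally show "(LINT s|N. (\<Sum>i<n. c i * f i s)\<^sup>2) = (\<Sum>i<n. (c i)\<^sup>2 * (LINT s|N. f i s * f i s))"
    by simp
qed

locale bessel_bridge = gaussian_bridge +
  fixes \<nu> :: real and z :: "nat \<Rightarrow> real"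
  assumes \<nu>: "\<nu> = \<alpha> - 1 / 2"
    and z_mono: "strict_mono_on {1..} z"
    and z_zeros: "z ` {1..} = {x. 0 < x \<and> bessel_J \<nu> x = 0}"
begin

lemma \<nu>_gt: "- 1 / 2 < \<nu>" using \<alpha> \<nu> by simp

lemmas z_pos = bessel_zeros_pos[OF \<nu>_gt z_mono z_zeros]

definition freq :: "nat \<Rightarrow> real" where "freq j = (z (Suc j))\<^sup>2 / T\<^sup>2"

text \<open>The reciprocal of \<open>freq j\<close>. It arises as the squared norm of the dual
  function and hence as the variance of the coefficient.\<close>

definition eigenvalue :: "nat \<Rightarrow> real" where "eigenvalue j = T\<^sup>2 / (z (Suc j))\<^sup>2"

definition mode_norm :: "nat \<Rightarrow> real" where
  "mode_norm j = sqrt (LINT r:{0..T}|lborel. bessel_mode \<nu> (freq j) r * bessel_mode \<nu> (freq j) r)"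

definition eigenfunction :: "nat \<Rightarrow> real \<Rightarrow> real" where
  "eigenfunction j t = bessel_mode \<nu> (freq j) (T - t) / mode_norm j"

lemma freq_pos: "0 < freq j" using z_pos[of j] T by (simp add: freq_def)

lemma eigenvalue_pos: "0 < eigenvalue j" using z_pos[of j] T by (simp add: eigenvalue_def)

lemma freq_zero: "bessel_entire \<nu> (freq j * T\<^sup>2) = 0"
  using bessel_entire_zeros[OF \<nu>_gt z_mono z_zeros, of j] T by (simp add: freq_def)

lemma freq_inj: "i \<noteq> j \<Longrightarrow> freq i \<noteq> freq j"
proof -
  assume "i \<noteq> j"
  then have "z (Suc i) \<noteq> z (Suc j)"
    using strict_mono_on_eqD[OF z_mono, of "Suc i" "Suc j"] by auto
  then show ?thesis using z_pos[of i] z_pos[of j] T by (simp add: freq_def)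
qed

lemma mode_norm_square:
  "(mode_norm j)\<^sup>2 = (LINT r:{0..T}|lborel. bessel_mode \<nu> (freq j) r * bessel_mode \<nu> (freq j) r)"
  and mode_norm_pos: "0 < mode_norm j"
  using bessel_mode_norm_pos[OF \<nu>_gt T freq_zero freq_pos, of j] by (simp_all add: mode_norm_def)

lemma continuous_on_eigenfunction: "continuous_on {0..T} (eigenfunction j)"
  unfolding eigenfunction_def[abs_def]
  using mode_norm_pos[of j]
  by (intro continuous_intros continuous_on_compose2[OF continuous_on_bessel_mode[OF \<nu>_gt]]) auto

lemma eigenfunction_T: "eigenfunction j T = 0"
  using \<nu>_gt by (simp add: eigenfunction_def bessel_mode_def)

lemma set_integral_half_open:
  fixes g :: "real \<Rightarrow> real"
  assumes "g T = 0"
  shows "(LINT t:{0..<T}|lborel. g t) = (LINT t:{0..T}|lborel. g t)"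
proof -
  have "indicator {0..<T} t *\<^sub>R g t = indicator {0..T} t *\<^sub>R g t" for t
    using assms by (cases "t = T") (auto simp: indicator_def)
  then show ?thesis unfolding set_lebesgue_integral_def by (simp only:)
qed

lemma eigenfunction_orthonormal:
  "(LINT t:{0..<T}|lborel. eigenfunction i t * eigenfunction j t) = (if i = j then 1 else 0)"
proof -
  have "(LINT t:{0..<T}|lborel. eigenfunction i t * eigenfunction j t)
      = (LINT t:{0..T}|lborel. eigenfunction i t * eigenfunction j t)"
    by (rule set_integral_half_open) (simp add: eigenfunction_T)
  also have "\<dots> = (LINT r:{0..T}|lborel. bessel_mode \<nu> (freq i) r * bessel_mode \<nu> (freq j) r / (mode_norm i * mode_norm j))"
    using set_integral_reflect[of 0 T "\<lambda>r. bessel_mode \<nu> (freq i) r * bessel_mode \<nu> (freq j) r / (mode_norm i * mode_norm j)"]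
    by (simp add: eigenfunction_def)
  also have "\<dots> = (LINT r:{0..T}|lborel. bessel_mode \<nu> (freq i) r * bessel_mode \<nu> (freq j) r) / (mode_norm i * mode_norm j)"
    by simp
  also have "\<dots> = (if i = j then 1 else 0)"
    using bessel_mode_orthogonal(2)[OF \<nu>_gt less_imp_le[OF T] freq_zero freq_zero freq_inj, of i j]
      mode_norm_square[of i] mode_norm_pos[of i] by (auto simp: power2_eq_square)
  finally show ?thesis .
qed

definition dual_function :: "nat \<Rightarrow> real \<Rightarrow> real" where
  "dual_function j s = indicator {0..T} s * (bessel_comode \<nu> (freq j) (T - s) / mode_norm j)"

text \<open>After r = T - t the kernel contributes r^(\<nu>+1/2) over (T - s)^(\<nu>+1/2), because
  \<alpha> = \<nu> + 1/2, and the integral is \<open>integral_powr_bessel_mode\<close>. At s = T,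
  where the quotient degenerates, both sides vanish.\<close>

lemma kernel_eigenfunction:
  "(LINT t:{0..<T}|lborel. kern t s * eigenfunction j t) = dual_function j s"
proof (cases "s \<in> {0..<T}")
  case True
  define c where "c = (T - s) powr (\<nu> + 1 / 2) * mode_norm j"
  have c: "0 < c" using True mode_norm_pos by (simp add: c_def)
  have "(LINT t:{0..<T}|lborel. kern t s * eigenfunction j t)
      = (LINT t:{s..T}|lborel. (T - t) powr (\<nu> + 1 / 2) * bessel_mode \<nu> (freq j) (T - t) / c)"
    unfolding set_lebesgue_integral_def
  proof (rule Bochner_Integration.integral_cong[OF refl])
    fix t
    consider "t \<in> {s..<T}" | "t = T" | "t \<notin> {s..T}" by fastforce
    then show "indicator {0..<T} t *\<^sub>R (kern t s * eigenfunction j t)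
        = indicator {s..T} t *\<^sub>R ((T - t) powr (\<nu> + 1 / 2) * bessel_mode \<nu> (freq j) (T - t) / c)"
    proof cases
      case 1
      then have "kern t s = (T - t) powr (\<nu> + 1 / 2) / (T - s) powr (\<nu> + 1 / 2)"
        using True \<nu> by (simp add: bridge_kernel_def powr_divide)
      then show ?thesis using 1 True by (simp add: eigenfunction_def c_def)
    next
      case 2
      then show ?thesis using \<nu>_gt by simp
    next
      case 3
      then show ?thesis by (cases "t < T") (auto simp: bridge_kernel_def indicator_def)
    qed
  qed
  also have "\<dots> = (LINT r:{0..T - s}|lborel. r powr (\<nu> + 1 / 2) * bessel_mode \<nu> (freq j) r) / c"
    using set_integral_reflect[of s T "\<lambda>r. r powr (\<nu> + 1 / 2) * bessel_mode \<nu> (freq j) r / c"] by simp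
  also have "\<dots> = dual_function j s"
    using True integral_powr_bessel_mode[OF \<nu>_gt, of "T - s" "freq j"]
    by (simp add: dual_function_def c_def)
  finally show ?thesis .
next
  case False
  have "indicator {0..<T} t *\<^sub>R (kern t s * eigenfunction j t) = 0" for t
    using False by (auto simp: bridge_kernel_def indicator_def)
  moreover have "dual_function j s = 0"
    using False \<nu>_gt by (cases "s = T") (auto simp: dual_function_def bessel_comode_def)
  ultimately show ?thesis unfolding set_lebesgue_integral_def by (simp only: Bochner_Integration.integral_zero)
qed

lemma dual_function_product:
  "dual_function i s * dual_function j s
     = indicator {0..T} s *\<^sub>R (bessel_comode \<nu> (freq i) (T - s) * bessel_comode \<nu> (freq j) (T - s) / (mode_norm i * mode_norm j))"
  by (simp add: dual_function_def indicator_def)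

lemma integrable_dual_function: "integrable lborel (\<lambda>s. dual_function i s * dual_function j s)"
proof -
  have "continuous_on {0..T} (\<lambda>s. bessel_comode \<nu> (freq i) (T - s) * bessel_comode \<nu> (freq j) (T - s) / (mode_norm i * mode_norm j))"
    using mode_norm_pos[of i] mode_norm_pos[of j]
    by (intro continuous_intros continuous_on_compose2[OF continuous_on_bessel_comode[OF \<nu>_gt]]) auto
  from borel_integrable_atLeastAtMost'[OF this] show ?thesis
    unfolding dual_function_product set_integrable_def .
qed

text \<open>Orthogonality is that of the comodes. On the diagonal the squared norm of the mode is
  \<open>freq i\<close> times that of the comode, so normalising the mode leaves 1 / freq i.\<close>

lemma dual_function_orthogonal:
  "(LINT s|lborel. dual_function i s * dual_function j s) = (if i = j then eigenvalue i else 0)"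
proof -
  have "(LINT s|lborel. dual_function i s * dual_function j s)
      = (LINT s:{0..T}|lborel. bessel_comode \<nu> (freq i) (T - s) * bessel_comode \<nu> (freq j) (T - s) / (mode_norm i * mode_norm j))"
    unfolding dual_function_product set_lebesgue_integral_def ..
  also have "\<dots> = (LINT r:{0..T}|lborel. bessel_comode \<nu> (freq i) r * bessel_comode \<nu> (freq j) r) / (mode_norm i * mode_norm j)"
    using set_integral_reflect[of 0 T "\<lambda>r. bessel_comode \<nu> (freq i) r * bessel_comode \<nu> (freq j) r / (mode_norm i * mode_norm j)"]
    by simp
  also have "\<dots> = (if i = j then eigenvalue i else 0)"
  proof (cases "i = j")
    case True
    define q where "q = (LINT r:{0..T}|lborel. bessel_comode \<nu> (freq i) r * bessel_comode \<nu> (freq i) r)"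
    have m: "mode_norm i * mode_norm i = freq i * q"
      using trans[OF mode_norm_square[of i] bessel_mode_eq_comode_integral[OF \<nu>_gt less_imp_le[OF T] freq_zero]]
      by (simp only: q_def power2_eq_square)
    then have "q \<noteq> 0" using mode_norm_pos[of i] by auto
    then have "q / (mode_norm i * mode_norm i) = 1 / freq i" unfolding m by simp
    moreover have "eigenvalue i = 1 / freq i" by (simp add: eigenvalue_def freq_def)
    ultimately show ?thesis using True by (simp add: q_def)
  next
    case False
    then show ?thesis
      using bessel_mode_orthogonal(1)[OF \<nu>_gt less_imp_le[OF T] freq_zero freq_zero freq_inj, of i j] by simp
  qed
  finally show ?thesis .
qed

text \<open>A measurable representative is chosen, as the integral along the path is measurable only
  up to a null set.\<close>

definition coefficient :: "nat \<Rightarrow> 'a \<Rightarrow> real" where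
  "coefficient j = (SOME \<xi>. \<xi> \<in> borel_measurable M \<and>
      (AE \<omega> in M. \<xi> \<omega> = (LINT t:{0..<T}|lborel. X t \<omega> * eigenfunction j t)))"

lemma coefficient:
  shows coefficient_measurable [measurable]: "coefficient j \<in> borel_measurable M"
    and coefficient_AE: "AE \<omega> in M. coefficient j \<omega> = (LINT t:{0..<T}|lborel. X t \<omega> * eigenfunction j t)"
proof -
  have "\<exists>\<xi>. \<xi> \<in> borel_measurable M \<and> (AE \<omega> in M. \<xi> \<omega> = (LINT t:{0..<T}|lborel. X t \<omega> * eigenfunction j t))"
  proof -
    obtain \<xi> where "\<xi> \<in> borel_measurable M" "AE \<omega> in M. \<xi> \<omega> = (LINT t:{0..<T}|lborel. X t \<omega> * eigenfunction j t)"
      by (rule ex_linear_functional_version[OF continuous_on_eigenfunction])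
    then show ?thesis by blast
  qed
  from someI_ex[OF this]
  show "coefficient j \<in> borel_measurable M"
    "AE \<omega> in M. coefficient j \<omega> = (LINT t:{0..<T}|lborel. X t \<omega> * eigenfunction j t)"
    unfolding coefficient_def by auto
qed

lemma path_sum_integral:
  assumes "continuous_on {0..<T} (\<lambda>t. X t \<omega>)" "set_integrable lborel {0..<T} (\<lambda>t. (X t \<omega>)\<^sup>2)"
  shows "(LINT t:{0..<T}|lborel. X t \<omega> * (\<Sum>j<n. c j * eigenfunction j t))
      = (\<Sum>j<n. c j * (LINT t:{0..<T}|lborel. X t \<omega> * eigenfunction j t))"
proof -
  have int: "integrable lborel (\<lambda>t. indicator {0..<T} t *\<^sub>R (X t \<omega> * eigenfunction j t))" for j
    using set_integrable_path_mult[OF assms continuous_on_eigenfunction, of j] by (simp only: set_integrable_def)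
  have "indicator {0..<T} t *\<^sub>R (X t \<omega> * (\<Sum>j<n. c j * eigenfunction j t))
      = (\<Sum>j<n. c j * (indicator {0..<T} t *\<^sub>R (X t \<omega> * eigenfunction j t)))" for t
    by (simp add: sum_distrib_left mult_ac)
  then show ?thesis
    unfolding set_lebesgue_integral_def by (simp only: Bochner_Integration.integral_sum int integrable_mult_right integral_mult_right_zero)
qed

text \<open>A linear combination of coefficients is again a linear functional of the path, with a
  combination e of eigenfunctions as weight. Its variance is the squared norm of the same
  combination of dual functions, which orthogonality reduces to the sum of squares.\<close>

lemma gaussian_coefficients:
  "std_gaussian_family M (\<lambda>j \<omega>. coefficient j \<omega> / sqrt (eigenvalue j)) {..<n}"
  unfolding std_gaussian_family_def
proof (intro conjI ballI allI)
  fix a :: "nat \<Rightarrow> real"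
  \<comment> \<open>Dividing by the standard deviation gives every coefficient unit
    variance.\<close>
  define c where "c j = a j / sqrt (eigenvalue j)" for j
  define e where "e t = (\<Sum>j<n. c j * eigenfunction j t)" for t
  have e: "continuous_on {0..T} e"
    unfolding e_def[abs_def] by (intro continuous_intros continuous_on_eigenfunction)
  obtain \<xi> where \<xi>[measurable]: "\<xi> \<in> borel_measurable M"
    and \<xi>_AE: "AE \<omega> in M. \<xi> \<omega> = (LINT t:{0..<T}|lborel. X t \<omega> * e t)"
    and \<xi>_char: "(CLINT \<omega>|M. iexp (\<xi> \<omega>)) = of_real (exp (- ((LINT s|lborel. (LINT t:{0..<T}|lborel. kern t s * e t)\<^sup>2) / 2)))"
    by (rule ex_linear_functional_version[OF e])
  have coeff_all: "AE \<omega> in M. \<forall>j. coefficient j \<omega> = (LINT t:{0..<T}|lborel. X t \<omega> * eigenfunction j t)"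
    using coefficient_AE by (simp only: AE_all_countable) blast
  have AE_eq: "AE \<omega> in M. (\<Sum>j<n. a j * (coefficient j \<omega> / sqrt (eigenvalue j))) = \<xi> \<omega>"
    using X_cont AE_square_integrable coeff_all \<xi>_AE
  proof eventually_elim
    case (elim \<omega>)
    have "(\<Sum>j<n. a j * (coefficient j \<omega> / sqrt (eigenvalue j))) = (\<Sum>j<n. c j * coefficient j \<omega>)"
      by (simp add: c_def)
    also have "\<dots> = (\<Sum>j<n. c j * (LINT t:{0..<T}|lborel. X t \<omega> * eigenfunction j t))"
      using elim(3) by simp
    finally show ?case
      unfolding elim(4) e_def path_sum_integral[OF elim(1,2)] .
  qed
  have kernel_e: "(LINT t:{0..<T}|lborel. kern t s * e t) = (\<Sum>j<n. c j * dual_function j s)" for s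
  proof -
    have int: "integrable lborel (\<lambda>t. indicator {0..<T} t *\<^sub>R (kern t s * eigenfunction j t))" for j
      using set_integrable_kernel_mult[OF continuous_on_eigenfunction, of s j] by (simp only: set_integrable_def)
    have "indicator {0..<T} t *\<^sub>R (kern t s * e t) = (\<Sum>j<n. c j * (indicator {0..<T} t *\<^sub>R (kern t s * eigenfunction j t)))" for t
      by (simp add: e_def sum_distrib_left mult_ac)
    then show ?thesis
      unfolding kernel_eigenfunction[symmetric] set_lebesgue_integral_def
      by (simp only: Bochner_Integration.integral_sum int integrable_mult_right integral_mult_right_zero)
  qed
  have "(LINT s|lborel. (\<Sum>j<n. c j * dual_function j s)\<^sup>2) = (\<Sum>j<n. (c j)\<^sup>2 * (LINT s|lborel. dual_function j s * dual_function j s))"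
    by (rule integral_square_orthogonal_sum) (auto simp: integrable_dual_function dual_function_orthogonal)
  also have "\<dots> = (\<Sum>j<n. (a j)\<^sup>2)"
    using eigenvalue_pos by (intro sum.cong refl) (simp add: dual_function_orthogonal c_def power_divide less_imp_le less_imp_neq[symmetric])
  finally have var: "(LINT s|lborel. (LINT t:{0..<T}|lborel. kern t s * e t)\<^sup>2) = (\<Sum>j<n. (a j)\<^sup>2)"
    unfolding kernel_e .
  have "(CLINT \<omega>|M. iexp (\<Sum>j<n. a j * (coefficient j \<omega> / sqrt (eigenvalue j)))) = (CLINT \<omega>|M. iexp (\<xi> \<omega>))"
  proof (rule integral_cong_AE)
    show "AE \<omega> in M. iexp (\<Sum>j<n. a j * (coefficient j \<omega> / sqrt (eigenvalue j))) = iexp (\<xi> \<omega>)"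
      using AE_eq by eventually_elim simp
  qed measurable
  then show "(CLINT \<omega>|M. iexp (\<Sum>j<n. a j * (coefficient j \<omega> / sqrt (eigenvalue j)))) = of_real (exp (- ((\<Sum>j<n. (a j)\<^sup>2) / 2)))"
    unfolding \<xi>_char var .
qed measurable

text \<open>Because 4 (\<nu> + 1) = 2 (2 \<alpha> + 1), the total variance is exactly the bound in
  \<open>ex_path_square_version\<close>; this coincidence closes Bessel's inequality.\<close>

lemma eigenvalue_sums: "eigenvalue sums (T\<^sup>2 / (2 * (2 * \<alpha> + 1)))"
proof -
  have "(\<lambda>j. T\<^sup>2 * (1 / (z (Suc j))\<^sup>2)) sums (T\<^sup>2 * (1 / (4 * (\<nu> + 1))))"
    by (rule sums_mult[OF sums_inverse_bessel_zeros[OF \<nu>_gt z_mono z_zeros]])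
  moreover have "4 * (\<nu> + 1) = 2 * (2 * \<alpha> + 1)" by (simp add: \<nu>)
  ultimately show ?thesis by (simp only: eigenvalue_def[abs_def] times_divide_eq_right mult_1_right)
qed

text \<open>The integral of (X - p)^2 is nonnegative for the partial expansion p, and both X * p and
  p^2 integrate to the sum of the squared coefficients.\<close>

lemma path_bessel_inequality:
  assumes X: "continuous_on {0..<T} (\<lambda>t. X t \<omega>)" "set_integrable lborel {0..<T} (\<lambda>t. (X t \<omega>)\<^sup>2)"
    and c: "\<And>j. c j = (LINT t:{0..<T}|lborel. X t \<omega> * eigenfunction j t)"
  shows "(\<Sum>j<n. (c j)\<^sup>2) \<le> (LINT t:{0..<T}|lborel. (X t \<omega>)\<^sup>2)"
proof -
  define p where "p t = (\<Sum>j<n. c j * eigenfunction j t)" for t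
  have p: "continuous_on {0..T} p"
    unfolding p_def[abs_def] by (intro continuous_intros continuous_on_eigenfunction)
  have ee: "integrable lborel (\<lambda>t. (indicator {0..<T} t * eigenfunction i t) * (indicator {0..<T} t * eigenfunction j t))" for i j
  proof -
    have "set_integrable lborel {0..T} (\<lambda>t. eigenfunction i t * eigenfunction j t)"
      by (intro borel_integrable_atLeastAtMost' continuous_intros continuous_on_eigenfunction)
    then have "set_integrable lborel {0..<T} (\<lambda>t. eigenfunction i t * eigenfunction j t)"
      by (rule set_integrable_subset) auto
    moreover have "indicator {0..<T} t *\<^sub>R (eigenfunction i t * eigenfunction j t)
        = (indicator {0..<T} t * eigenfunction i t) * (indicator {0..<T} t * eigenfunction j t)" for t
      by (auto simp: indicator_def)
    ultimately show ?thesis by (simp only: set_integrable_def)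
  qed
  have ee_val: "(LINT t|lborel. (indicator {0..<T} t * eigenfunction i t) * (indicator {0..<T} t * eigenfunction j t)) = (if i = j then 1 else 0)" for i j
  proof -
    have "indicator {0..<T} t *\<^sub>R (eigenfunction i t * eigenfunction j t)
        = (indicator {0..<T} t * eigenfunction i t) * (indicator {0..<T} t * eigenfunction j t)" for t
      by (auto simp: indicator_def)
    then show ?thesis
      using eigenfunction_orthonormal[of i j] by (simp only: set_lebesgue_integral_def)
  qed
  have p2_eq: "indicator {0..<T} t *\<^sub>R (p t)\<^sup>2 = (\<Sum>j<n. c j * (indicator {0..<T} t * eigenfunction j t))\<^sup>2" for t
    by (auto simp: p_def indicator_def)
  have p2_int: "integrable lborel (\<lambda>t. indicator {0..<T} t *\<^sub>R (p t)\<^sup>2)"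
    unfolding p2_eq by (rule integrable_square_sum[OF ee]) (simp add: ee_val)
  have p2: "(LINT t|lborel. indicator {0..<T} t *\<^sub>R (p t)\<^sup>2) = (\<Sum>j<n. (c j)\<^sup>2)"
    unfolding p2_eq by (subst integral_square_orthogonal_sum[OF ee]) (simp_all add: ee_val)
  have Xp_int: "integrable lborel (\<lambda>t. indicator {0..<T} t *\<^sub>R (X t \<omega> * p t))"
    using set_integrable_path_mult[OF X p] by (simp only: set_integrable_def)
  have Xp: "(LINT t|lborel. indicator {0..<T} t *\<^sub>R (X t \<omega> * p t)) = (\<Sum>j<n. (c j)\<^sup>2)"
    using path_sum_integral[OF X, of c n] unfolding p_def c[symmetric]
    by (simp add: set_lebesgue_integral_def power2_eq_square)
  have X2_int: "integrable lborel (\<lambda>t. indicator {0..<T} t *\<^sub>R (X t \<omega>)\<^sup>2)"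
    using X(2) by (simp only: set_integrable_def)
  have "0 \<le> (LINT t|lborel. indicator {0..<T} t *\<^sub>R (X t \<omega> - p t)\<^sup>2)" by simp
  also have "(\<lambda>t. indicator {0..<T} t *\<^sub>R (X t \<omega> - p t)\<^sup>2)
      = (\<lambda>t. indicator {0..<T} t *\<^sub>R (X t \<omega>)\<^sup>2 - 2 * (indicator {0..<T} t *\<^sub>R (X t \<omega> * p t)) + indicator {0..<T} t *\<^sub>R (p t)\<^sup>2)"
    by (auto simp: fun_eq_iff indicator_def power2_eq_square algebra_simps)
  also have "(LINT t|lborel. indicator {0..<T} t *\<^sub>R (X t \<omega>)\<^sup>2 - 2 * (indicator {0..<T} t *\<^sub>R (X t \<omega> * p t)) + indicator {0..<T} t *\<^sub>R (p t)\<^sup>2)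
      = (LINT t|lborel. indicator {0..<T} t *\<^sub>R (X t \<omega>)\<^sup>2) - 2 * (LINT t|lborel. indicator {0..<T} t *\<^sub>R (X t \<omega> * p t))
        + (LINT t|lborel. indicator {0..<T} t *\<^sub>R (p t)\<^sup>2)"
    by (subst Bochner_Integration.integral_add[OF Bochner_Integration.integrable_diff[OF X2_int integrable_mult_right[OF Xp_int]] p2_int],
        subst Bochner_Integration.integral_diff[OF X2_int integrable_mult_right[OF Xp_int]])
       (simp only: integral_mult_right_zero)
  finally show ?thesis
    unfolding p2 Xp by (simp add: set_lebesgue_integral_def)
qed

text \<open>Both sides have the same finite expectation, so Bessel's inequality is an equality almost surely.\<close>

lemma path_integral_eq_sum:
  "AE \<omega> in M. (LINT t:{0..<T}|lborel. (X t \<omega>)\<^sup>2) = (\<Sum>j. eigenvalue j * (coefficient j \<omega> / sqrt (eigenvalue j))\<^sup>2)"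
proof -
  let ?C = "ennreal (T\<^sup>2 / (2 * (2 * \<alpha> + 1)))"
  obtain Y :: "'a \<Rightarrow> ennreal" where Y[measurable]: "Y \<in> borel_measurable M"
    and Y_AE: "AE \<omega> in M. Y \<omega> = (\<integral>\<^sup>+t\<in>{0..<T}. ennreal ((X t \<omega>)\<^sup>2) \<partial>lborel)"
    and Y_le: "(\<integral>\<^sup>+\<omega>. Y \<omega> \<partial>M) \<le> ?C"
    by (rule ex_path_square_version)
  have Y_eq: "AE \<omega> in M. Y \<omega> = ennreal (LINT t:{0..<T}|lborel. (X t \<omega>)\<^sup>2)"
    using Y_AE AE_square_integrable
  proof eventually_elim
    case (elim \<omega>)
    have "(\<integral>\<^sup>+t\<in>{0..<T}. ennreal ((X t \<omega>)\<^sup>2) \<partial>lborel) = (\<integral>\<^sup>+t. ennreal (indicator {0..<T} t *\<^sub>R (X t \<omega>)\<^sup>2) \<partial>lborel)"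
      by (intro nn_integral_cong) (auto simp: indicator_def)
    also have "\<dots> = ennreal (LINT t|lborel. indicator {0..<T} t *\<^sub>R (X t \<omega>)\<^sup>2)"
      using elim(2) unfolding set_integrable_def by (rule nn_integral_eq_integral) auto
    finally show ?case using elim(1) by (simp add: set_lebesgue_integral_def)
  qed
  define U where "U \<omega> = (\<Sum>j. ennreal ((coefficient j \<omega>)\<^sup>2))" for \<omega>
  have [measurable]: "U \<in> borel_measurable M" unfolding U_def[abs_def] by measurable
  have coeff_all: "AE \<omega> in M. \<forall>j. coefficient j \<omega> = (LINT t:{0..<T}|lborel. X t \<omega> * eigenfunction j t)"
    using coefficient_AE by (simp only: AE_all_countable) blast
  have bessel: "AE \<omega> in M. \<forall>n. (\<Sum>j<n. (coefficient j \<omega>)\<^sup>2) \<le> (LINT t:{0..<T}|lborel. (X t \<omega>)\<^sup>2)"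
    using X_cont AE_square_integrable coeff_all
    by eventually_elim (auto intro!: path_bessel_inequality)
  have UY: "AE \<omega> in M. U \<omega> \<le> Y \<omega>"
    using bessel Y_eq
  proof eventually_elim
    case (elim \<omega>)
    show ?case
      unfolding U_def elim(2)
    proof (rule suminf_le_const)
      show "(\<Sum>j<n. ennreal ((coefficient j \<omega>)\<^sup>2)) \<le> ennreal (LINT t:{0..<T}|lborel. (X t \<omega>)\<^sup>2)" for n
        using elim(1) by (subst sum_ennreal) (auto intro: ennreal_leI)
    qed simp
  qed
  have "(\<integral>\<^sup>+\<omega>. ennreal ((coefficient j \<omega>)\<^sup>2) \<partial>M) = ennreal (eigenvalue j)" for j
  proof -
    have "(coefficient j \<omega>)\<^sup>2 = eigenvalue j * (coefficient j \<omega> / sqrt (eigenvalue j))\<^sup>2" for \<omega>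
      using eigenvalue_pos[of j] by (simp add: power_divide)
    then have "(\<integral>\<^sup>+\<omega>. ennreal ((coefficient j \<omega>)\<^sup>2) \<partial>M)
        = (\<integral>\<^sup>+\<omega>. ennreal (eigenvalue j) * ennreal ((coefficient j \<omega> / sqrt (eigenvalue j))\<^sup>2) \<partial>M)"
      using eigenvalue_pos[of j] by (simp only: ennreal_mult'[OF less_imp_le])
    also have "\<dots> = ennreal (eigenvalue j) * (\<integral>\<^sup>+\<omega>. ennreal ((coefficient j \<omega> / sqrt (eigenvalue j))\<^sup>2) \<partial>M)"
      by (rule nn_integral_cmult) measurable
    also have "\<dots> = ennreal (eigenvalue j)"
      using std_gaussian_nn_square[OF gaussian_coefficients, of j] by simp
    finally show ?thesis .
  qed
  then have "(\<integral>\<^sup>+\<omega>. U \<omega> \<partial>M) = (\<Sum>j. ennreal (eigenvalue j))"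
    unfolding U_def by (subst nn_integral_suminf) auto
  also have "\<dots> = ?C"
    using eigenvalue_sums eigenvalue_pos by (subst suminf_ennreal2) (auto simp: sums_iff less_imp_le)
  finally have EU: "(\<integral>\<^sup>+\<omega>. U \<omega> \<partial>M) = ?C" .
  \<comment> \<open>Subtraction of extended reals is legitimate here since U is below Y almost
    surely and has finite expectation.\<close>
  have "(\<integral>\<^sup>+\<omega>. Y \<omega> - U \<omega> \<partial>M) = (\<integral>\<^sup>+\<omega>. Y \<omega> \<partial>M) - (\<integral>\<^sup>+\<omega>. U \<omega> \<partial>M)"
    by (rule nn_integral_diff) (use UY EU in auto)
  also have "\<dots> = 0" unfolding EU using Y_le by (simp add: diff_eq_0_iff_ennreal le_less_trans[OF _ ennreal_less_top])
  finally have "AE \<omega> in M. Y \<omega> - U \<omega> = 0" by (subst (asm) nn_integral_0_iff_AE) auto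
  moreover have "AE \<omega> in M. U \<omega> \<noteq> \<infinity>"
    by (rule nn_integral_noteq_infinite) (auto simp: EU)
  ultimately show ?thesis
    using UY Y_eq bessel
  proof eventually_elim
    case (elim \<omega>)
    let ?y = "LINT t:{0..<T}|lborel. (X t \<omega>)\<^sup>2"
    have "Y \<omega> = U \<omega>" using elim(1,3) by (auto simp: diff_eq_0_iff_ennreal)
    moreover have s: "summable (\<lambda>j. (coefficient j \<omega>)\<^sup>2)"
      using elim(5) by (intro summableI_nonneg_bounded[where x="?y"]) auto
    ultimately have "ennreal ?y = ennreal (\<Sum>j. (coefficient j \<omega>)\<^sup>2)"
      using elim(4) unfolding U_def by (simp add: suminf_ennreal2)
    moreover have "0 \<le> ?y" by (simp add: set_lebesgue_integral_def)
    moreover have "0 \<le> (\<Sum>j. (coefficient j \<omega>)\<^sup>2)" using s by (intro suminf_nonneg) auto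
    ultimately have "?y = (\<Sum>j. (coefficient j \<omega>)\<^sup>2)" by simp
    moreover have "eigenvalue j * (coefficient j \<omega> / sqrt (eigenvalue j))\<^sup>2 = (coefficient j \<omega>)\<^sup>2" for j
      using eigenvalue_pos[of j] by (simp add: power_divide)
    ultimately show ?case by simp
  qed
qed

end

section \<open>Transfer to the tail probability and evaluation of the constants\<close>

text \<open>The set \<open>B\<close> agrees with a measurable set outside a null set, hence belongs
  to the completion; this replaces the path integral in \<open>tail_prob\<close> by its measurable
  version.\<close>

lemma prob_completion_cong_AE:
  assumes A: "A \<in> sets M" and B: "B \<subseteq> space M" and AE: "AE x in M. x \<in> A \<longleftrightarrow> x \<in> B"
  shows "measure (completion M) B = measure M A"
proof -
  from AE obtain N where N: "{x \<in> space M. \<not> (x \<in> A \<longleftrightarrow> x \<in> B)} \<subseteq> N" "N \<in> null_sets M"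
    by (auto elim!: AE_E simp: null_sets_def)
  have B_sets: "B \<in> sets (completion M)"
  proof (rule sets_completionI)
    show "B = (A - N) \<union> (B \<inter> N)" using N(1) B sets.sets_into_space[OF A] by auto
    show "A - N \<in> sets M" using A N(2) by auto
  qed (use N(2) in auto)
  have "emeasure (completion M) B = emeasure (completion M) A"
    by (rule emeasure_eq_AE) (use AE_completion[OF AE] A B_sets in auto)
  then show ?thesis using A by (simp add: measure_def)
qed

lemma asymp_equiv_of_scaled_limit:
  fixes f :: "real \<Rightarrow> real"
  assumes lim: "((\<lambda>x. sqrt x * exp (c * x) * f x) \<longlongrightarrow> K) at_top" and K: "K \<noteq> 0"
  shows "f \<sim>[at_top] (\<lambda>x. K * x powr (-1 / 2) * exp (- (c * x)))"
proof (rule asymp_equivI')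
  have "((\<lambda>x. sqrt x * exp (c * x) * f x / K) \<longlongrightarrow> K / K) at_top"
    using K by (intro tendsto_divide lim tendsto_const)
  then have "((\<lambda>x. sqrt x * exp (c * x) * f x / K) \<longlongrightarrow> 1) at_top" using K by simp
  moreover have "\<forall>\<^sub>F x in at_top. sqrt x * exp (c * x) * f x / K = f x / (K * x powr (-1 / 2) * exp (- (c * x)))"
    using eventually_gt_at_top[of 0]
  proof eventually_elim
    case (elim x)
    have "x powr (-1 / 2) = 1 / sqrt x"
      using elim powr_minus_divide[of x "1/2"] powr_half_sqrt[of x] by simp
    then show ?case using elim K by (simp add: exp_minus divide_simps mult.commute)
  qed
  ultimately show "((\<lambda>x. f x / (K * x powr (-1 / 2) * exp (- (c * x)))) \<longlongrightarrow> 1) at_top"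
    by (rule Lim_transform_eventually)
qed

lemma prod_inverse_sqrt:
  fixes f :: "nat \<Rightarrow> real"
  shows "(\<Prod>k<n. 1 / sqrt (f k)) = 1 / sqrt (\<Prod>k<n. f k)"
  by (induction n) (auto simp: real_sqrt_mult)

lemma wiener_bridge_gaussian:
  assumes T: "0 < T" and \<alpha>: "0 < \<alpha>" and W: "wiener_process M B" and X: "wiener_bridge M B \<alpha> T X"
  shows "gaussian_bridge M X T \<alpha>"
proof -
  have int: "is_wiener_integral M B t (\<lambda>s. ((T - t) / (T - s)) powr \<alpha>) (X t)" if "0 \<le> t" "t < T" for t
    using X that unfolding wiener_bridge_def by auto
  interpret prob_space M using W by (simp add: wiener_process_def)
  show ?thesis
  proof
    show "X t \<in> borel_measurable M" if "0 \<le> t" "t < T" for t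
      using int[OF that] by (simp add: is_wiener_integral_def)
    show "AE \<omega> in M. continuous_on {0..<T} (\<lambda>t. X t \<omega>)"
      using X by (simp add: wiener_bridge_def)
    fix I :: "nat set" and a t :: "nat \<Rightarrow> real"
    assume "finite I" "\<And>i. i \<in> I \<Longrightarrow> 0 \<le> t i \<and> t i < T"
    then show "(CLINT \<omega>|M. iexp (\<Sum>i\<in>I. a i * X (t i) \<omega>))
        = of_real (exp (- ((LINT s|lborel. (\<Sum>i\<in>I. a i * bridge_kernel \<alpha> T (t i) s)\<^sup>2) / 2)))"
      unfolding bridge_kernel_def by (intro wiener_integral_char[OF W] int) auto
  qed (use T \<alpha> in auto)
qed

context bessel_bridge
begin

text \<open>The product of 1 - (z 1)^2 / (z k)^2 over k >= 2 in closed form: minus (z 1)^2 times the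
  derivative of \<open>bessel_entire \<nu>\<close> at (z 1)^2.\<close>

definition zero_product :: real where
  "zero_product = (z 1)\<^sup>2 / (4 * (\<nu> + 1)) * bessel_entire (\<nu> + 1) ((z 1)\<^sup>2)"

lemma zero_product_tendsto: "(\<lambda>n. \<Prod>k<n. 1 - (z 1)\<^sup>2 / (z (k + 2))\<^sup>2) \<longlonglongrightarrow> zero_product"
  unfolding zero_product_def by (rule bessel_zeros_product[OF \<nu>_gt z_mono z_zeros])

lemma z_less: "i < j \<Longrightarrow> z (Suc i) < z (Suc j)"
  using strict_mono_onD[OF z_mono, of "Suc i" "Suc j"] by auto

lemma zero_factor_pos: "0 < 1 - (z 1)\<^sup>2 / (z (k + 2))\<^sup>2"
proof -
  have "(z 1)\<^sup>2 < (z (k + 2))\<^sup>2"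
    using z_less[of 0 "Suc k"] z_pos[of 0] by (intro power_strict_mono) auto
  then show ?thesis using z_pos[of "Suc k"] by (simp add: divide_less_eq)
qed

text \<open>Positive partial products yield only a nonnegative limit; that it is nonzero is read off
  from the closed form, since orders \<nu> and \<nu> + 1 have no common zero.\<close>

lemma zero_product_pos: "0 < zero_product"
proof -
  have "0 \<le> (\<Prod>k<n. 1 - (z 1)\<^sup>2 / (z (k + 2))\<^sup>2)" for n
    by (rule prod_nonneg) (rule less_imp_le[OF zero_factor_pos])
  then have "0 \<le> zero_product"
    by (intro LIMSEQ_le_const[OF zero_product_tendsto]) blast
  moreover have "zero_product \<noteq> 0"
    using bessel_entire_no_common_zero[OF \<nu>_gt bessel_entire_zeros[OF \<nu>_gt z_mono z_zeros, of 0]] z_pos[of 0] \<nu>_gt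
    by (simp add: zero_product_def)
  ultimately show ?thesis by simp
qed

text \<open>Expressing order \<nu> + 1 through \<open>bessel_J\<close> brings in Gamma (\<nu> + 2) =
  (\<nu> + 1) Gamma (\<nu> + 1), which cancels the divisor \<nu> + 1, and the factor (z 1 /
  2)^(-\<nu>-1), which combines with (z 1)^2 / 4.\<close>

lemma zero_product_eq_Bessel:
  "zero_product = Gamma (\<nu> + 1) * bessel_J (\<nu> + 1) (z 1) * (2 powr (\<nu> - 1) * z 1 powr (1 - \<nu>))"
proof -
  have z1: "0 < z 1" using z_pos[of 0] by simp
  have G: "Gamma (\<nu> + 1 + 1) = (\<nu> + 1) * Gamma (\<nu> + 1)"
    using \<nu>_gt by (intro Gamma_plus1) (auto elim!: nonpos_Ints_cases)
  have Gp: "0 < Gamma (\<nu> + 1)" using \<nu>_gt by (intro Gamma_real_pos) auto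
  have J: "bessel_J (\<nu> + 1) (z 1) = (z 1 / 2) powr (\<nu> + 1) / ((\<nu> + 1) * Gamma (\<nu> + 1)) * bessel_entire (\<nu> + 1) ((z 1)\<^sup>2)"
    using bessel_J_eq_bessel_entire[of "\<nu> + 1" "z 1"] z1 \<nu>_gt unfolding G by simp
  have "(z 1 / 2) powr (\<nu> + 1) * (2 powr (\<nu> - 1) * z 1 powr (1 - \<nu>)) = (z 1)\<^sup>2 / 4"
  proof -
    have "(z 1 / 2) powr (\<nu> + 1) = z 1 powr (\<nu> + 1) / 2 powr (\<nu> + 1)"
      using z1 by (simp add: powr_divide)
    then have "(z 1 / 2) powr (\<nu> + 1) * (2 powr (\<nu> - 1) * z 1 powr (1 - \<nu>))
        = (z 1 powr (\<nu> + 1) * z 1 powr (1 - \<nu>)) * (2 powr (\<nu> - 1) / 2 powr (\<nu> + 1))"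
      by simp
    also have "z 1 powr (\<nu> + 1) * z 1 powr (1 - \<nu>) = (z 1)\<^sup>2"
      unfolding powr_add[symmetric] using z1 by simp
    also have "2 powr (\<nu> - 1) / 2 powr (\<nu> + 1) = (1 / 4 :: real)"
      unfolding powr_diff[symmetric] by (simp add: powr_minus_divide)
    finally show ?thesis by simp
  qed
  moreover have "Gamma (\<nu> + 1) * bessel_J (\<nu> + 1) (z 1) * (2 powr (\<nu> - 1) * z 1 powr (1 - \<nu>))
      = Gamma (\<nu> + 1) / ((\<nu> + 1) * Gamma (\<nu> + 1)) * bessel_entire (\<nu> + 1) ((z 1)\<^sup>2)
        * ((z 1 / 2) powr (\<nu> + 1) * (2 powr (\<nu> - 1) * z 1 powr (1 - \<nu>)))"
    unfolding J by (simp only: divide_inverse mult_ac)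
  ultimately have "Gamma (\<nu> + 1) * bessel_J (\<nu> + 1) (z 1) * (2 powr (\<nu> - 1) * z 1 powr (1 - \<nu>))
      = Gamma (\<nu> + 1) / ((\<nu> + 1) * Gamma (\<nu> + 1)) * bessel_entire (\<nu> + 1) ((z 1)\<^sup>2) * ((z 1)\<^sup>2 / 4)"
    by (simp only:)
  also have "\<dots> = zero_product"
  proof -
    have "Gamma (\<nu> + 1) / ((\<nu> + 1) * Gamma (\<nu> + 1)) = 1 / (\<nu> + 1)"
      using less_imp_neq[OF Gp] by auto
    then show ?thesis
      unfolding zero_product_def by (simp only: divide_inverse inverse_mult_distrib mult_1_left mult_ac)
  qed
  finally show ?thesis ..
qed

lemma tail_limit:
  assumes XT: "\<And>\<omega>. \<omega> \<in> space M \<Longrightarrow> X T \<omega> = 0"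
  shows "((\<lambda>x. sqrt x * exp ((z 1)\<^sup>2 / (2 * T\<^sup>2) * x) * tail_prob M T X x)
      \<longlongrightarrow> sqrt (2 / pi) * (T / z 1) * (1 / sqrt zero_product)) at_top"
proof -
  have z1: "0 < z 1" using z_pos[of 0] by simp
  define \<eta> where "\<eta> j \<omega> = coefficient j \<omega> / sqrt (eigenvalue j)" for j \<omega>
  define S where "S \<omega> = (\<Sum>j. eigenvalue j * (\<eta> j \<omega>)\<^sup>2)" for \<omega>
  have [measurable]: "\<eta> j \<in> borel_measurable M" for j unfolding \<eta>_def[abs_def] by measurable
  have S[measurable]: "S \<in> borel_measurable M" unfolding S_def[abs_def] by measurable
  \<comment> \<open>The event in \<open>tail_prob\<close> differs by a null set from one defined
    through the measurable sum S.\<close>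
  have tail: "tail_prob M T X x = prob {\<omega>\<in>space M. x < S \<omega>}" for x
    unfolding tail_prob_def
  proof (rule prob_completion_cong_AE)
    show "AE \<omega> in M. \<omega> \<in> {\<omega>\<in>space M. x < S \<omega>} \<longleftrightarrow> \<omega> \<in> {\<omega>\<in>space M. x < (LINT t:{0..T}|lborel. (X t \<omega>)\<^sup>2)}"
      using path_integral_eq_sum AE_space
    proof eventually_elim
      case (elim \<omega>)
      then show ?case
        using set_integral_half_open[of "\<lambda>t. (X t \<omega>)\<^sup>2"] XT[of \<omega>] by (simp add: S_def \<eta>_def)
    qed
  qed auto
  have ratio: "eigenvalue (Suc k) / eigenvalue 0 = (z 1)\<^sup>2 / (z (k + 2))\<^sup>2" for k
    using T z1 by (simp add: eigenvalue_def)
  have "(\<lambda>n. 1 / sqrt (\<Prod>k<n. 1 - (z 1)\<^sup>2 / (z (k + 2))\<^sup>2)) \<longlonglongrightarrow> 1 / sqrt zero_product"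
    using zero_product_pos by (intro tendsto_intros zero_product_tendsto) auto
  then have L: "(\<lambda>n. \<Prod>k<n. 1 / sqrt (1 - eigenvalue (Suc k) / eigenvalue 0)) \<longlonglongrightarrow> 1 / sqrt zero_product"
    unfolding ratio prod_inverse_sqrt .
  have ev_le: "eigenvalue j \<le> eigenvalue i" if "i \<le> j" for i j
    using z_less[of i j] z_pos[of i] that T unfolding eigenvalue_def
    by (cases "i = j") (auto intro!: divide_left_mono power_mono mult_pos_pos)
  have ev_less: "eigenvalue 1 < eigenvalue 0"
    using z_less[of 0 1] z_pos[of 0] T unfolding eigenvalue_def
    by (intro divide_strict_left_mono power_strict_mono mult_pos_pos) auto
  have "((\<lambda>x. sqrt x * exp (x / (2 * eigenvalue 0)) * prob {\<omega>\<in>space M. x < S \<omega>})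
      \<longlongrightarrow> sqrt (2 * eigenvalue 0 / pi) * (1 / sqrt zero_product)) at_top"
  proof (rule tail_gaussian_squares[OF _ eigenvalue_pos _ _ ev_less S _ L])
    show "std_gaussian_family M \<eta> {..<n}" for n
      unfolding \<eta>_def by (rule gaussian_coefficients)
    show "summable eigenvalue" using eigenvalue_sums by (rule sums_summable)
    show "eigenvalue (Suc k) \<le> eigenvalue 1" for k by (rule ev_le) simp
    show "AE \<omega> in M. S \<omega> = (\<Sum>j. eigenvalue j * (\<eta> j \<omega>)\<^sup>2)" by (simp add: S_def)
  qed
  moreover have "x / (2 * eigenvalue 0) = (z 1)\<^sup>2 / (2 * T\<^sup>2) * x" for x
    using T by (simp add: eigenvalue_def)
  moreover have "sqrt (2 * eigenvalue 0 / pi) = sqrt (2 / pi) * (T / z 1)"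
    using T z1 by (simp add: eigenvalue_def real_sqrt_mult real_sqrt_divide)
  ultimately show ?thesis unfolding tail by simp
qed

text \<open>\<open>convergent_prod\<close> requires partial products with a nonzero limit, not
  merely a limit; positivity of \<open>zero_product\<close> provides it.\<close>

lemma
  shows convergent_inverse_sqrt_product: "convergent_prod (\<lambda>k. (1 - (z 1)\<^sup>2 / (z (k + 2))\<^sup>2) powr (-1 / 2))"
    and prodinf_inverse_sqrt_product: "(\<Prod>k. (1 - (z 1)\<^sup>2 / (z (k + 2))\<^sup>2) powr (-1 / 2)) = 1 / sqrt zero_product"
proof -
  define f where "f k = (1 - (z 1)\<^sup>2 / (z (k + 2))\<^sup>2) powr (-1 / 2)" for k
  have f: "f k = 1 / sqrt (1 - (z 1)\<^sup>2 / (z (k + 2))\<^sup>2)" for k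
    using zero_factor_pos[of k] powr_minus_divide[of "1 - (z 1)\<^sup>2 / (z (k + 2))\<^sup>2" "1/2"]
    unfolding f_def by (simp add: powr_half_sqrt)
  have "(\<lambda>n. 1 / sqrt (\<Prod>k<n. 1 - (z 1)\<^sup>2 / (z (k + 2))\<^sup>2)) \<longlonglongrightarrow> 1 / sqrt zero_product"
    using zero_product_pos by (intro tendsto_intros zero_product_tendsto) auto
  then have "(\<lambda>n. \<Prod>k<n. f k) \<longlonglongrightarrow> 1 / sqrt zero_product"
    unfolding f prod_inverse_sqrt .
  \<comment> \<open>Infinite products are defined through {..n}, one factor more than
    {..<n}.\<close>
  then have lim: "(\<lambda>n. \<Prod>k\<le>n. f k) \<longlonglongrightarrow> 1 / sqrt zero_product"
    unfolding lessThan_Suc_atMost[symmetric] by (rule LIMSEQ_Suc)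
  have "0 < f k" for k
    unfolding f by (intro divide_pos_pos real_sqrt_gt_zero zero_factor_pos) simp
  then have "f k \<noteq> 0" for k by (metis less_irrefl)
  then have conv: "convergent_prod f"
    using lim zero_product_pos by (subst convergent_prod_iff_nz_lim) auto
  then show "convergent_prod (\<lambda>k. (1 - (z 1)\<^sup>2 / (z (k + 2))\<^sup>2) powr (-1 / 2))"
    unfolding f_def[abs_def] .
  have "prodinf f = 1 / sqrt zero_product"
    by (rule LIMSEQ_unique[OF convergent_prod_LIMSEQ[OF conv] lim])
  then show "(\<Prod>k. (1 - (z 1)\<^sup>2 / (z (k + 2))\<^sup>2) powr (-1 / 2)) = 1 / sqrt zero_product"
    unfolding f_def[abs_def] .
qed

text \<open>The inverse root of \<open>zero_product\<close> contributes 2^((1-\<nu>)/2) and (z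
  1)^((\<nu>-1)/2). Together with sqrt 2 and 1 / z 1 the exponents become 1 - \<nu>/2 and (\<nu> -
  3)/2.\<close>

lemma Bessel_constant:
  "2 powr (1 - \<nu> / 2) * T * z 1 powr ((\<nu> - 3) / 2) / sqrt (pi * Gamma (\<nu> + 1) * bessel_J (\<nu> + 1) (z 1))
     = sqrt (2 / pi) * (T / z 1) * (1 / sqrt zero_product)"
proof -
  have z1: "0 < z 1" using z_pos[of 0] by simp
  define g where "g = Gamma (\<nu> + 1) * bessel_J (\<nu> + 1) (z 1)"
  have P: "zero_product = g * (2 powr (\<nu> - 1) * z 1 powr (1 - \<nu>))"
    by (simp add: zero_product_eq_Bessel g_def)
  have sq: "sqrt (2 powr (\<nu> - 1)) = 2 powr ((\<nu> - 1) / 2)" "sqrt (z 1 powr (1 - \<nu>)) = z 1 powr ((1 - \<nu>) / 2)"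
    using z1 by (simp_all add: powr_half_sqrt_powr[symmetric] powr_powr)
  have "sqrt (2 / pi) * (T / z 1) * (1 / sqrt zero_product)
      = T / (sqrt pi * sqrt g) * (sqrt 2 / 2 powr ((\<nu> - 1) / 2)) * (1 / (z 1 * z 1 powr ((1 - \<nu>) / 2)))"
    unfolding P real_sqrt_mult sq real_sqrt_divide by (simp add: mult_ac)
  also have "sqrt 2 / 2 powr ((\<nu> - 1) / 2) = 2 powr (1 - \<nu> / 2)"
  proof -
    have "sqrt 2 / 2 powr ((\<nu> - 1) / 2) = 2 powr (1 / 2) / (2::real) powr ((\<nu> - 1) / 2)"
      by (simp add: powr_half_sqrt)
    also have "\<dots> = 2 powr (1 - \<nu> / 2)"
      unfolding powr_diff[symmetric] by (rule arg_cong[where f="\<lambda>x. 2 powr x"]) (simp add: field_simps)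
    finally show ?thesis .
  qed
  also have "1 / (z 1 * z 1 powr ((1 - \<nu>) / 2)) = z 1 powr ((\<nu> - 3) / 2)"
  proof -
    have "z 1 * z 1 powr ((1 - \<nu>) / 2) = z 1 powr (1 + (1 - \<nu>) / 2)"
      using z1 by (simp add: powr_add)
    moreover have "(\<nu> - 3) / 2 = - (1 + (1 - \<nu>) / 2)" by (simp add: field_simps)
    ultimately show ?thesis by (simp only: powr_minus_divide)
  qed
  finally show ?thesis by (simp add: g_def real_sqrt_mult mult_ac)
qed

end

theorem corollary3p7:
  fixes M :: "'a measure" and B X :: "real \<Rightarrow> 'a \<Rightarrow> real"
    and T \<alpha> \<nu> :: real and z :: "nat \<Rightarrow> real"
  assumes "0 < T" and "0 < \<alpha>" and "\<nu> = \<alpha> - 1 / 2"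
    and "strict_mono_on {1..} z"
    and "z ` {1..} = {x. 0 < x \<and> bessel_J \<nu> x = 0}"
    and "wiener_process M B"
    and "wiener_bridge M B \<alpha> T X"
  shows "tail_prob M T X \<sim>[at_top]
           (\<lambda>x. 2 powr (1 - \<nu> / 2) * T * z 1 powr ((\<nu> - 3) / 2)
                  / sqrt (pi * Gamma (\<nu> + 1) * bessel_J (\<nu> + 1) (z 1))
                * x powr (-1 / 2) * exp (- ((z 1)\<^sup>2 * x / (2 * T\<^sup>2))))
       \<and> convergent_prod (\<lambda>k. (1 - (z 1)\<^sup>2 / (z (k + 2))\<^sup>2) powr (-1 / 2))
       \<and> tail_prob M T X \<sim>[at_top]
           (\<lambda>x. sqrt (2 / pi) * (T / z 1)
                * (\<Prod>k. (1 - (z 1)\<^sup>2 / (z (k + 2))\<^sup>2) powr (-1 / 2))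
                * x powr (-1 / 2) * exp (- ((z 1)\<^sup>2 * x / (2 * T\<^sup>2))))"
proof -
  interpret gaussian_bridge M X T \<alpha>
    by (rule wiener_bridge_gaussian[OF assms(1,2,6,7)])
  interpret bessel_bridge M X T \<alpha> \<nu> z
    by unfold_locales (use assms in auto)
  have XT: "X T \<omega> = 0" if "\<omega> \<in> space M" for \<omega>
    using assms(7) that by (simp add: wiener_bridge_def)
  have "0 < z 1" using z_pos[of 0] by simp
  then have K: "sqrt (2 / pi) * (T / z 1) * (1 / sqrt zero_product) \<noteq> 0"
    using zero_product_pos T by simp
  have e: "(z 1)\<^sup>2 / (2 * T\<^sup>2) * x = (z 1)\<^sup>2 * x / (2 * T\<^sup>2)" for x by simp
  have "tail_prob M T X \<sim>[at_top]
      (\<lambda>x. sqrt (2 / pi) * (T / z 1) * (1 / sqrt zero_product) * x powr (-1 / 2) * exp (- ((z 1)\<^sup>2 * x / (2 * T\<^sup>2))))"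
    using asymp_equiv_of_scaled_limit[OF tail_limit[OF XT] K] unfolding e .
  then show ?thesis
    unfolding Bessel_constant prodinf_inverse_sqrt_product
    using convergent_inverse_sqrt_product by blast
qed

end
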